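(* Let $k\ge0$ be an integer. Suppose that $\mathcal N_{\mathbb S}$ is a stratified right-type group and $K\Subset\mathcal N_{\mathbb S}$. Then there are positive constants $C_1,C_2$ depending only on $K$ such that $$\|\mathscr D_0f\|_0^2\ge C_1\|f\|_{1/2}^2-C_2\|f\|_0^2$$ for any $f\in C_0^\infty(K,\mathscr V_0)$.
   Context: Groups. Let $n\ge1$ and let $\mathbb S$ be a real symmetric $4n\times4n$ matrix. Let $I^1,I^2,I^3$ be the $4\times4$ skew matrices whose only nonzero entries above the diagonal are: $I^1_{12}=1,\ I^1_{34}=-1$; $I^2_{13}=1,\ I^2_{24}=1$; $I^3_{14}=1,\ I^3_{23}=-1$. Put $\mathbb I^\beta=\mathrm{diag}(I^\beta,\dots,I^\beta)$ and $B^\beta=\mathbb S\mathbb I^\beta+\mathbb I^\beta\mathbb S$. $\mathcal N_{\mathbb S}$ is $\mathbb R^{4n}\times\mathbb R^3$ with $(\mathbf x,\mathbf t)(\mathbf y,\mathbf s)=(\mathbf x+\mathbf y,\ t_\beta+s_\beta+2\sum_{a,b}B^\beta_{ab}x_ay_b)$; left invariant fields $X_b=\partial_{x_b}+2\sum_{\beta,a}B^\beta_{ab}x_a\partial_{t_\beta}$, $b=1,\dots,4n$. Its Lie algebra is $\mathfrak g_1\oplus\mathfrak g_2$, $\mathfrak g_1=\mathrm{span}\{X_b\}$, $\mathfrak g_2=\mathrm{span}\{\partial_{t_\beta}\}$; the group is stratified if $[\mathfrak g_1,\mathfrak g_1]=\mathfrak g_2$. Right-type. With $\nabla_{2l}^{0'}=-\partial_{x_{4l+3}}-\mathbf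 i\partial_{x_{4l+4}}$, $\nabla_{2l}^{1'}=-\partial_{x_{4l+1}}-\mathbf i\partial_{x_{4l+2}}$, $\nabla_{2l+1}^{0'}=\partial_{x_{4l+1}}-\mathbf i\partial_{x_{4l+2}}$, $\nabla_{2l+1}^{1'}=-\partial_{x_{4l+3}}+\mathbf i\partial_{x_{4l+4}}$ ($l=0,\dots,n-1$), $\phi(\mathbf x)=\sum_{a,b}\mathbb S_{ab}x_ax_b$, and a basis $\omega^0,\dots,\omega^{2n-1}$ of $\mathbb C^{2n}$, the group is right-type if $\mathcal E:=\sum_{A,B=0}^{2n-1}(\nabla_A^{0'}\nabla_B^{1'}\phi)\,\omega^A\wedge\omega^B=0$. Operators (repeated indices summed, $A',B'\in\{0',1'\}$). $Z_{2l}^{0'}=-X_{4l+3}-\mathbf iX_{4l+4}$, $Z_{2l}^{1'}=-X_{4l+1}-\mathbf iX_{4l+2}$, $Z_{2l+1}^{0'}=X_{4l+1}-\mathbf iX_{4l+2}$, $Z_{2l+1}^{1'}=-X_{4l+3}+\mathbf iX_{4l+4}$; $\mathfrak d^{A'}f=Z_A^{A'}f_{\mathbf A}\omega^A\wedge\omega^{\mathbf A}$ for $f=f_{\mathbf A}\omega^{\mathbf A}$. $\mathbf T_{0'}^{0'}=-\mathbf i\partial_{t_1}$, $\mathbf T_{0'}^{1'}=-\partial_{t_2}+\mathbf i\partial_{t_3}$, $\mathbf T_{1'}^{0'}=\partial_{t_2}+\mathbf i\partial_{t_3}$, $\mathbf T_{1'}^{1'}=\mathbf i\partial_{t_1}$,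 and $\mathbf T^{A'0'}=\mathbf T_{1'}^{A'}$, $\mathbf T^{A'1'}=-\mathbf T_{0'}^{A'}$. $\odot^\sigma\mathbb C^2$ is identified with homogeneous polynomials of degree $\sigma$ in $(s^{0'},s^{1'})$, $\partial_{A'}=\partial/\partial s^{A'}$. $\mathscr V_0=\odot^k\mathbb C^2$ and $\mathscr D_0$ is the first operator of the boundary complex of the $k$-Cauchy-Fueter complex on a right-type group: for $k\ge2$: $\mathscr D_0f=(\partial_{A'}\mathfrak d^{A'}f,\ -\partial_{A'}\partial_{B'}\mathbf T^{A'B'}f)$ with values in $(\odot^{k-1}\mathbb C^2\otimes\mathbb C^{2n})\oplus\odot^{k-2}\mathbb C^2$; for $k=1$: $\mathscr D_0f=(\partial_{A'}\mathfrak d^{A'}f,\ -\partial_{A'}\mathfrak d^{B'}\mathbf T_{B'}^{A'}f)$ with values in $\mathbb C^{2n}\oplus\mathbb C^{2n}$; for $k=0$: $\mathscr D_0f=\mathfrak d^{0'}\mathfrak d^{1'}f$ for scalar $f$, with values in $\wedge^2\mathbb C^{2n}$. $\|\cdot\|_s$ is the Sobolev norm of order $s$ on $\mathbb R^{4n+3}$ (with $\|\cdot\|_0$ the $L^2$ norm for Lebesgue measure), for fixed Hermitian inner products on the values; $C_0^\infty(K,\cdot)$ denotes smooth functions compactly supported in $K$. *)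

theory Defs
  imports "HOL-Analysis.Analysis"
begin

text \<open>
  The number of quaternionic coordinates is \<open>n = CARD('n)\<close>. The coordinate \<open>x\<^sub>4\<^sub>l\<^sub>+\<^sub>j\<close>
  (\<open>j = 1,2,3,4\<close>) is indexed by \<open>(l, j)\<close>, and a spinor index \<open>A = 2l, 2l+1\<close> by \<open>(l, 0)\<close>, \<open>(l, 1)\<close>.
  Primed indices \<open>0', 1'\<close> are \<open>0, 1 :: 2\<close>. In the type \<open>4\<close> one has \<open>4 = 0\<close>, and likewise
  \<open>3 = 0\<close> in the type \<open>3\<close>, so \<open>1,2,3,4\<close> and \<open>1,2,3\<close> enumerate these types.
\<close>

type_synonym 'n grp = "(real ^ ('n \<times> 4)) \<times> (real ^ 3)"

definition skew_unit :: "4 \<Rightarrow> 4 \<Rightarrow> real ^ 4 ^ 4" where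
  "skew_unit i j = (\<chi> p q. (if p = i \<and> q = j then 1 else 0) - (if p = j \<and> q = i then 1 else 0))"

definition I4 :: "3 \<Rightarrow> real ^ 4 ^ 4" where
  "I4 \<beta> = (if \<beta> = 1 then skew_unit 1 2 - skew_unit 3 4
           else if \<beta> = 2 then skew_unit 1 3 + skew_unit 2 4
           else skew_unit 1 4 - skew_unit 2 3)"

definition II :: "3 \<Rightarrow> real ^ ('n::finite \<times> 4) ^ ('n \<times> 4)" where
  "II \<beta> = (\<chi> a b. if fst a = fst b then I4 \<beta> $ snd a $ snd b else 0)"

definition Bmat :: "real ^ ('n::finite \<times> 4) ^ ('n \<times> 4) \<Rightarrow> 3 \<Rightarrow> real ^ ('n \<times> 4) ^ ('n \<times> 4)" where
  "Bmat S \<beta> = S ** II \<beta> + II \<beta> ** S"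

definition gmult :: "real ^ ('n::finite \<times> 4) ^ ('n \<times> 4) \<Rightarrow> 'n grp \<Rightarrow> 'n grp \<Rightarrow> 'n grp" where
  "gmult S p q = (fst p + fst q,
     \<chi> \<beta>. snd p $ \<beta> + snd q $ \<beta> + 2 * (\<Sum>a\<in>UNIV. \<Sum>b\<in>UNIV. Bmat S \<beta> $ a $ b * fst p $ a * fst q $ b))"

text \<open>
  A vector field is a map assigning to a point its tangent vector; it acts on functions
  by \<open>deriv_along\<close>.
\<close>

definition dx :: "('n::finite \<times> 4) \<Rightarrow> 'n grp \<Rightarrow> 'n grp" where
  "dx b p = (axis b 1, 0)"

definition dt :: "3 \<Rightarrow> ('n::finite) grp \<Rightarrow> 'n grp" where
  "dt \<beta> p = (0, axis \<beta> 1)"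

definition X :: "real ^ ('n::finite \<times> 4) ^ ('n \<times> 4) \<Rightarrow> ('n \<times> 4) \<Rightarrow> 'n grp \<Rightarrow> 'n grp" where
  "X S b p = dx b p + (\<Sum>\<beta>\<in>UNIV. (2 * (\<Sum>a\<in>UNIV. Bmat S \<beta> $ a $ b * fst p $ a)) *\<^sub>R dt \<beta> p)"

lemma has_derivative_gmult:
  "(gmult S p has_derivative (\<lambda>v. gmult S p v - p)) (at q)"
proof -
  have eq: "gmult S p v - p = (fst v, \<chi> \<beta>. snd v $ \<beta> +
      2 * (\<Sum>a\<in>UNIV. \<Sum>b\<in>UNIV. Bmat S \<beta> $ a $ b * fst p $ a * fst v $ b))" for v
    by (simp add: gmult_def prod_eq_iff vec_eq_iff)
  have lin: "linear (\<lambda>v. gmult S p v - p)"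
    unfolding eq
    by (rule linearI)
       (simp_all add: prod_eq_iff vec_eq_iff algebra_simps sum.distrib sum_distrib_left)
  have "((\<lambda>v. (gmult S p v - p) + p) has_derivative (\<lambda>v. (gmult S p v - p) + 0)) (at q)"
    by (intro has_derivative_add has_derivative_const
        bounded_linear_imp_has_derivative linear_conv_bounded_linear[THEN iffD1] lin)
  then show ?thesis by simp
qed

lemma X_left_invariant:
  "frechet_derivative (gmult S p) (at q) (X S b q) = X S b (gmult S p q)"
proof -
  have "frechet_derivative (gmult S p) (at q) (X S b q) = gmult S p (X S b q) - p"
    using has_derivative_gmult frechet_derivative_at by metis
  also have "\<dots> = X S b (gmult S p q)"
  proof -
    have 1: "(\<Sum>c\<in>UNIV. g c * axis b 1 $ c) = g b" for g :: "_ \<Rightarrow> real"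
      by (simp add: axis_def if_distrib[of "\<lambda>x. _ * x"] cong: if_cong)
    have 2: "(\<Sum>\<beta>\<in>UNIV. g \<beta> * axis \<beta> 1 $ i) = g i" for g :: "3 \<Rightarrow> real" and i
      by (simp add: axis_def if_distrib[of "\<lambda>x. _ * x"] cong: if_cong)
    show ?thesis
      by (simp add: X_def gmult_def dx_def dt_def prod_eq_iff vec_eq_iff fst_sum snd_sum 1 2
          sum.distrib distrib_left)
  qed
  finally show ?thesis .
qed

definition deriv_along ::
    "('p::real_normed_vector \<Rightarrow> 'p) \<Rightarrow> ('p \<Rightarrow> complex) \<Rightarrow> 'p \<Rightarrow> complex" where
  "deriv_along V f p = frechet_derivative f (at p) (V p)"

definition lie_bracket ::
    "('p::real_normed_vector \<Rightarrow> 'p) \<Rightarrow> ('p \<Rightarrow> 'p) \<Rightarrow> 'p \<Rightarrow> 'p" where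
  "lie_bracket V W p = frechet_derivative W (at p) (V p) - frechet_derivative V (at p) (W p)"

definition field_span :: "('p::real_vector \<Rightarrow> 'p) set \<Rightarrow> ('p \<Rightarrow> 'p) set" where
  "field_span F = {(\<lambda>p. \<Sum>V\<in>G. c V *\<^sub>R V p) | c G. finite G \<and> G \<subseteq> F}"

definition g1 :: "real ^ ('n::finite \<times> 4) ^ ('n \<times> 4) \<Rightarrow> ('n grp \<Rightarrow> 'n grp) set" where
  "g1 S = field_span (range (X S))"

definition g2 :: "(('n::finite) grp \<Rightarrow> 'n grp) set" where
  "g2 = field_span (range dt)"

definition stratified :: "real ^ ('n::finite \<times> 4) ^ ('n \<times> 4) \<Rightarrow> bool" where
  "stratified S \<longleftrightarrow> field_span {lie_bracket V W | V W. V \<in> g1 S \<and> W \<in> g1 S} = g2"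

text \<open>
  An element of \<open>\<odot>\<^sup>\<sigma>\<complex>\<^sup>2 \<otimes> \<Lambda>\<^sup>\<tau>\<complex>\<^sup>2\<^sup>n\<close> is given by its values \<open>u (i, j, L)\<close>, where \<open>(i, j)\<close> are the exponents
  of the monomial \<open>(s\<^sup>0\<^sup>')\<^sup>i (s\<^sup>1\<^sup>')\<^sup>j\<close> and a \<open>\<tau>\<close>-form is the alternating function of a list \<open>L\<close> of \<open>\<tau>\<close>
  indices that it is on the dual basis of \<open>\<omega>\<^sup>0, \<dots>, \<omega>\<^sup>2\<^sup>n\<^sup>-\<^sup>1\<close>.
\<close>

type_synonym 'n spinor = "'n \<times> 2"
type_synonym 'n idx = "nat \<times> nat \<times> 'n spinor list"
type_synonym 'n val = "'n idx \<Rightarrow> complex"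

definition alternating_form :: "nat \<Rightarrow> ('a list \<Rightarrow> complex) \<Rightarrow> bool" where
  "alternating_form \<tau> u \<longleftrightarrow>
     (\<forall>L. length L \<noteq> \<tau> \<longrightarrow> u L = 0) \<and>
     (\<forall>L i j. i < j \<and> j < length L \<longrightarrow> u (L[i := L ! j, j := L ! i]) = - u L)"

definition sym_forms :: "nat \<Rightarrow> nat \<Rightarrow> 'n val set" where
  "sym_forms \<sigma> \<tau> = {u. (\<forall>i j L. i + j \<noteq> \<sigma> \<longrightarrow> u (i, j, L) = 0) \<and>
                       (\<forall>i j. alternating_form \<tau> (\<lambda>L. u (i, j, L)))}"

definition one_form0 :: "'a list \<Rightarrow> complex" where
  "one_form0 L = (if L = [] then 1 else 0)"

text \<open>\<open>omega_wedge A u\<close> is \<open>\<omega>\<^sup>A \<and> u\<close>; the list with its \<open>i\<close>-th entry deleted is \<open>take i L @ drop (Suc i) L\<close>.\<close>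

definition omega_wedge :: "'a \<Rightarrow> ('a list \<Rightarrow> complex) \<Rightarrow> 'a list \<Rightarrow> complex" where
  "omega_wedge A u L =
     (\<Sum>i<length L. if L ! i = A then (-1) ^ i * u (take i L @ drop (Suc i) L) else 0)"

text \<open>The derivative \<open>\<partial>\<^sub>A\<^sub>'\<close> of polynomials in \<open>(s\<^sup>0\<^sup>', s\<^sup>1\<^sup>')\<close>, on coefficients.\<close>

definition ds :: "2 \<Rightarrow> 'n val \<Rightarrow> 'n val" where
  "ds A' u = (\<lambda>(i, j, L). if A' = 0 then of_nat (Suc i) * u (Suc i, j, L)
                          else of_nat (Suc j) * u (i, Suc j, L))"

text \<open>The common pattern of \<open>\<nabla>\<^sub>A\<^sup>A\<^sup>'\<close> (for \<open>Y b = \<partial>\<^bsub>x_b\<^esub>\<close>) and of \<open>Z\<^sub>A\<^sup>A\<^sup>'\<close> (for \<open>Y b = X\<^sub>b\<close>).\<close>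

definition spinor_op ::
    "(('n \<times> 4) \<Rightarrow> 'p::real_normed_vector \<Rightarrow> 'p) \<Rightarrow> 'n spinor \<Rightarrow> 2 \<Rightarrow> ('p \<Rightarrow> complex) \<Rightarrow> 'p \<Rightarrow> complex" where
  "spinor_op Y A A' f p = (let l = fst A; D = (\<lambda>j. deriv_along (Y (l, j)) f p) in
     if snd A = 0
     then (if A' = 0 then - D 3 - \<i> * D 4 else - D 1 - \<i> * D 2)
     else (if A' = 0 then D 1 - \<i> * D 2 else - D 3 + \<i> * D 4))"

definition nabla ::
    "('n::finite) spinor \<Rightarrow> 2 \<Rightarrow> (real ^ ('n \<times> 4) \<Rightarrow> complex) \<Rightarrow> real ^ ('n \<times> 4) \<Rightarrow> complex" where
  "nabla = spinor_op (\<lambda>b x. axis b 1)"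

definition Z :: "real ^ ('n::finite \<times> 4) ^ ('n \<times> 4) \<Rightarrow> 'n spinor \<Rightarrow> 2 \<Rightarrow>
    ('n grp \<Rightarrow> complex) \<Rightarrow> 'n grp \<Rightarrow> complex" where
  "Z S = spinor_op (X S)"

definition phi :: "real ^ ('n::finite \<times> 4) ^ ('n \<times> 4) \<Rightarrow> real ^ ('n \<times> 4) \<Rightarrow> complex" where
  "phi S x = complex_of_real (\<Sum>a\<in>UNIV. \<Sum>b\<in>UNIV. S $ a $ b * x $ a * x $ b)"

definition E_form :: "real ^ ('n::finite \<times> 4) ^ ('n \<times> 4) \<Rightarrow> real ^ ('n \<times> 4) \<Rightarrow> 'n spinor list \<Rightarrow> complex" where
  "E_form S x L = (\<Sum>A\<in>UNIV. \<Sum>B\<in>UNIV.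
     nabla A 0 (nabla B 1 (phi S)) x * omega_wedge A (omega_wedge B one_form0) L)"

definition right_type :: "real ^ ('n::finite \<times> 4) ^ ('n \<times> 4) \<Rightarrow> bool" where
  "right_type S \<longleftrightarrow> (\<forall>x L. E_form S x L = 0)"

definition dd :: "real ^ ('n::finite \<times> 4) ^ ('n \<times> 4) \<Rightarrow> 2 \<Rightarrow> ('n grp \<Rightarrow> 'n val) \<Rightarrow> 'n grp \<Rightarrow> 'n val" where
  "dd S A' f p = (\<lambda>(i, j, L).
     \<Sum>A\<in>UNIV. omega_wedge A (\<lambda>M. Z S A A' (\<lambda>q. f q (i, j, M)) p) L)"

text \<open>\<open>T_low A' B'\<close> is \<open>\<^bold>T\<^sub>A\<^sub>'\<^sup>B\<^sup>'\<close> and \<open>T_up A' B'\<close> is \<open>\<^bold>T\<^sup>A\<^sup>'\<^sup>B\<^sup>'\<close>.\<close>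

definition T_low :: "2 \<Rightarrow> 2 \<Rightarrow> (('n::finite) grp \<Rightarrow> complex) \<Rightarrow> 'n grp \<Rightarrow> complex" where
  "T_low A' B' f p = (let D = (\<lambda>\<beta>. deriv_along (dt \<beta>) f p) in
     if A' = 0
     then (if B' = 0 then - \<i> * D 1 else - D 2 + \<i> * D 3)
     else (if B' = 0 then D 2 + \<i> * D 3 else \<i> * D 1))"

definition T_up :: "2 \<Rightarrow> 2 \<Rightarrow> (('n::finite) grp \<Rightarrow> complex) \<Rightarrow> 'n grp \<Rightarrow> complex" where
  "T_up A' B' f p = (if B' = 0 then T_low 1 A' f p else - T_low 0 A' f p)"

definition componentwise ::
    "(('p \<Rightarrow> complex) \<Rightarrow> 'p \<Rightarrow> complex) \<Rightarrow> ('p \<Rightarrow> 'i \<Rightarrow> complex) \<Rightarrow> 'p \<Rightarrow> 'i \<Rightarrow> complex" where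
  "componentwise P f p i = P (\<lambda>q. f q i) p"

text \<open>
  Elements \<open>(u, v)\<close> of a direct sum are written as \<open>case_sum u v\<close>. For \<open>k = 0\<close> the second summand is \<open>0\<close>.
\<close>

definition V0 :: "nat \<Rightarrow> 'n val set" where
  "V0 k = sym_forms k 0"

definition V1 :: "nat \<Rightarrow> ('n idx + 'n idx \<Rightarrow> complex) set" where
  "V1 k =
    (if k \<ge> 2 then {case_sum u v | u v. u \<in> sym_forms (k - 1) 1 \<and> v \<in> sym_forms (k - 2) 0}
     else if k = 1 then {case_sum u v | u v. u \<in> sym_forms 0 1 \<and> v \<in> sym_forms 0 1}
     else {case_sum u (\<lambda>_. 0) | u. u \<in> sym_forms 0 2})"

definition D0 :: "real ^ ('n::finite \<times> 4) ^ ('n \<times> 4) \<Rightarrow> nat \<Rightarrow> ('n grp \<Rightarrow> 'n val) \<Rightarrow>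
    'n grp \<Rightarrow> 'n idx + 'n idx \<Rightarrow> complex" where
  "D0 S k f p =
    (if k \<ge> 2 then
       case_sum
         (\<lambda>i. \<Sum>A'\<in>UNIV. ds A' (dd S A' f p) i)
         (\<lambda>i. - (\<Sum>A'\<in>UNIV. \<Sum>B'\<in>UNIV. ds A' (ds B' (componentwise (T_up A' B') f p)) i))
     else if k = 1 then
       case_sum
         (\<lambda>i. \<Sum>A'\<in>UNIV. ds A' (dd S A' f p) i)
         (\<lambda>i. - (\<Sum>A'\<in>UNIV. \<Sum>B'\<in>UNIV. ds A' (dd S B' (componentwise (T_low B' A') f) p) i))
     else
       case_sum (dd S 0 (dd S 1 f) p) (\<lambda>_. 0))"

fun cont_diff :: "nat \<Rightarrow> ('p::euclidean_space \<Rightarrow> complex) \<Rightarrow> bool" where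
  "cont_diff 0 f \<longleftrightarrow> continuous_on UNIV f"
| "cont_diff (Suc m) f \<longleftrightarrow> (\<forall>p. f differentiable (at p)) \<and>
     (\<forall>v\<in>Basis. cont_diff m (\<lambda>p. frechet_derivative f (at p) v))"

definition smooth :: "('p::euclidean_space \<Rightarrow> complex) \<Rightarrow> bool" where
  "smooth f \<longleftrightarrow> (\<forall>m. cont_diff m f)"

definition test_functions ::
    "'p::euclidean_space set \<Rightarrow> ('i \<Rightarrow> complex) set \<Rightarrow> ('p \<Rightarrow> 'i \<Rightarrow> complex) set" where
  "test_functions K V = {f. (\<forall>p. f p \<in> V) \<and> (\<forall>i. smooth (\<lambda>p. f p i)) \<and>
     compact (closure {p. f p \<noteq> (\<lambda>_. 0)}) \<and> closure {p. f p \<noteq> (\<lambda>_. 0)} \<subseteq> K}"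

definition hermitian_inner ::
    "('i \<Rightarrow> complex) set \<Rightarrow> (('i \<Rightarrow> complex) \<Rightarrow> ('i \<Rightarrow> complex) \<Rightarrow> complex) \<Rightarrow> bool" where
  "hermitian_inner V h \<longleftrightarrow>
     (\<forall>u\<in>V. \<forall>v\<in>V. \<forall>w\<in>V. h (\<lambda>i. u i + v i) w = h u w + h v w) \<and>
     (\<forall>c. \<forall>u\<in>V. \<forall>w\<in>V. h (\<lambda>i. c * u i) w = c * h u w) \<and>
     (\<forall>u\<in>V. \<forall>w\<in>V. h w u = cnj (h u w)) \<and>
     (\<forall>u\<in>V. u \<noteq> (\<lambda>_. 0) \<longrightarrow> Re (h u u) > 0)"

definition L2_norm ::
    "(('i \<Rightarrow> complex) \<Rightarrow> ('i \<Rightarrow> complex) \<Rightarrow> complex) \<Rightarrow> ('p::euclidean_space \<Rightarrow> 'i \<Rightarrow> complex) \<Rightarrow> real" where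
  "L2_norm h f = sqrt (LINT p|lborel. Re (h (f p) (f p)))"

text \<open>The factor makes the Fourier transform unitary, so that the Sobolev norm of order \<open>0\<close> is the \<open>L\<^sup>2\<close> norm.\<close>

definition fourier :: "('p::euclidean_space \<Rightarrow> complex) \<Rightarrow> 'p \<Rightarrow> complex" where
  "fourier f \<xi> = complex_of_real ((2 * pi) powr (- real DIM('p) / 2)) *
     (LINT p|lborel. cis (- (p \<bullet> \<xi>)) * f p)"

definition sobolev_norm ::
    "(('i \<Rightarrow> complex) \<Rightarrow> ('i \<Rightarrow> complex) \<Rightarrow> complex) \<Rightarrow> real \<Rightarrow>
     ('p::euclidean_space \<Rightarrow> 'i \<Rightarrow> complex) \<Rightarrow> real" where
  "sobolev_norm h s f = sqrt (LINT \<xi>|lborel. (1 + (norm \<xi>)\<^sup>2) powr s *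
     Re (h (\<lambda>i. fourier (\<lambda>p. f p i) \<xi>) (\<lambda>i. fourier (\<lambda>p. f p i) \<xi>)))"

end

theory Submission
  imports Defs "HOL-Probability.Characteristic_Functions"
begin

text \<open>
  The right-type condition kills the trace of every diagonal \<open>4 \<times> 4\<close> block of \<open>S\<close>. Since
  \<open>I\<^sup>1, I\<^sup>2, I\<^sup>3\<close> anticommute and square to \<open>-1\<close>, this makes the \<open>B\<^sup>\<beta>\<close>-blocks orthogonal to the \<open>I\<^sup>\<gamma>\<close>, so all
  commutators that arise when \<open>\<Sum>\<^sub>A \<parallel>Z\<^sub>A\<^sup>0\<^sup>' g + Z\<^sub>A\<^sup>1\<^sup>' h\<parallel>\<^sup>2\<close> is expanded cancel, and the sum equals
  \<open>\<Sum>\<^sub>b \<parallel>X\<^sub>b g\<parallel>\<^sup>2 + \<Sum>\<^sub>b \<parallel>X\<^sub>b h\<parallel>\<^sup>2\<close>. Hence for \<open>k \<ge> 1\<close> the first component of \<open>D0\<close> alone controls the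
  horizontal energy \<open>\<Sum>\<^sub>b \<parallel>X\<^sub>b f\<parallel>\<^sup>2\<close>. For \<open>k = 0\<close> the coefficients of \<open>\<omega>\<^sup>2\<^sup>l \<and> \<omega>\<^sup>2\<^sup>l\<^sup>+\<^sup>1\<close> in \<open>D0 f\<close> add up to the
  sublaplacian, which controls the energy after pairing with \<open>f\<close>.

  The energy controls the Sobolev norm of order \<open>1/2\<close>: after a Fourier transform in the
  central variables, with dual variable \<open>\<tau>\<close>, the commutator of \<open>X\<^sub>a\<close> and \<open>X\<^sub>b\<close> is multiplication by
  \<open>4i \<Sum>\<^sub>\<beta> \<tau>\<^sub>\<beta> B\<^sup>\<beta>\<^sub>a\<^sub>b\<close>. By stratification the uncertainty principle gives \<open>|\<tau>| \<parallel>g\<parallel>\<^sup>2 \<le> C \<Sum>\<^sub>b \<parallel>X\<^sub>b g\<parallel>\<^sup>2\<close>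
  for every \<open>\<tau>\<close>, and as \<open>x\<close> is bounded on the support, \<open>|\<xi>| \<le> (1 + |\<tau>|) + |\<xi>|\<^sup>2 / (1 + |\<tau>|)\<close> yields the
  derivatives in \<open>x\<close>. Only the inequality \<open>\<parallel>Ff\<parallel> \<le> C \<parallel>f\<parallel>\<close> for the Fourier transform \<open>F\<close> is needed.
\<close>

subsection \<open>Integration by parts\<close>

text \<open>The fields in Z_A^0' and Z_A^1' carry the same quaternionic index as A, so expanding the
  squares meets only commutators inside one diagonal 4 x 4 block of the B^\<beta>; there the
  commutators occur exactly in the combinations that pair the block with I^1, I^2 or I^3.
  Off-diagonal blocks, on which the right-type hypothesis gives no such relation, do not occur.

  The order 1/2 reflects that one central derivative is a commutator of two horizontal ones. For
  fixed \<tau> every commutation and integration by parts takes place in x alone. The Fourier side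
  carries only the quantity to be bounded from above, so Bessel's inequality is applied twice in the
  same direction: in x for each \<tau>, then in t for each x.

  The Hermitian products on the values are arbitrary. They are compared once with the sum of squared
  coordinates, by compactness of a unit sphere, after which the analysis concerns scalar functions,
  one coefficient at a time. All constants are fixed before f: they involve S, the Hermitian
  products and one radius R of a ball containing K.\<close>

text \<open>Stands in for compact support. The radius is explicit so that constants can depend on it
  and not on the function, and sums, products and derivatives keep it.\<close>

definition vanishes :: "real \<Rightarrow> ('p::real_normed_vector \<Rightarrow> complex) \<Rightarrow> bool" where
  "vanishes R f \<longleftrightarrow> (\<forall>p. R < norm p \<longrightarrow> f p = 0)"

abbreviation sqint :: "('p::euclidean_space \<Rightarrow> complex) \<Rightarrow> real" where
  "sqint f \<equiv> LINT p|lborel. (cmod (f p))\<^sup>2"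

text \<open>The Fourier transform without the normalising factor of \<open>fourier\<close>. That
  factor is at most 1, so upper bounds carry over.\<close>

abbreviation fint :: "('p::euclidean_space \<Rightarrow> complex) \<Rightarrow> 'p \<Rightarrow> complex" where
  "fint f \<xi> \<equiv> LINT p|lborel. cis (- (p \<bullet> \<xi>)) * f p"

lemmas lebesgue_intros = Bochner_Integration.integrable_add Bochner_Integration.integrable_diff
  Bochner_Integration.integrable_sum Bochner_Integration.integrable_mult_right

lemmas lebesgue_add = Bochner_Integration.integral_add
lemmas lebesgue_diff = Bochner_Integration.integral_diff
lemmas lebesgue_sum = Bochner_Integration.integral_sum

lemma cball_subset_cube:
  obtains a b :: "'a::euclidean_space" where "cball 0 R \<subseteq> cbox a b"
  using bounded_subset_cbox_symmetric[OF bounded_cball] by metis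

lemma integrable_vanishes:
  fixes g :: "'a::euclidean_space \<Rightarrow> complex"
  assumes "continuous_on UNIV g" "vanishes R g"
  shows "integrable lborel g"
proof -
  have "integrable lborel (\<lambda>x. indicator (cball 0 R) x *\<^sub>R g x)"
    by (rule borel_integrable_compact) (use assms continuous_on_subset in auto)
  moreover have "(\<lambda>x. indicator (cball 0 R) x *\<^sub>R g x) = g"
    using assms(2) by (auto simp: vanishes_def indicator_def fun_eq_iff)
  ultimately show ?thesis by simp
qed

text \<open>Passes from a Lebesgue integral over the whole space to a gauge integral over a box,
  where the Leibniz rule and the continuity of parameter integrals apply.\<close>

lemma lint_vanishes:
  fixes g :: "'a::euclidean_space \<Rightarrow> complex"
  assumes "continuous_on UNIV g" "vanishes R g" "cball 0 R \<subseteq> cbox a b"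
  shows "(LINT x|lborel. g x) = integral (cbox a b) g"
proof -
  have "(LINT x|lborel. g x) = integral UNIV g"
    using integral_lborel[OF integrable_vanishes[OF assms(1,2)]] by simp
  also have "\<dots> = integral (cbox a b) g"
    using assms(2,3) by (intro integral_spike_set[where S=UNIV])
      (auto simp: vanishes_def subset_iff not_le[symmetric] intro!: negligible_subset[OF negligible_empty])
  finally show ?thesis .
qed

text \<open>Differentiation under the integral sign. One radius for all \<open>s\<close> in
  \<open>U\<close> confines the integrals to a fixed box, and there joint continuity of
  \<open>f'\<close> replaces a dominating function.\<close>

lemma has_vector_derivative_lint:
  fixes f :: "real \<Rightarrow> 'b::euclidean_space \<Rightarrow> complex"
  assumes der: "\<And>s t. s \<in> U \<Longrightarrow> ((\<lambda>s. f s t) has_vector_derivative f' s t) (at s)"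
    and cont': "continuous_on (U \<times> UNIV) (\<lambda>(s, t). f' s t)"
    and cont: "\<And>s. s \<in> U \<Longrightarrow> continuous_on UNIV (f s)"
    and van: "\<And>s. s \<in> U \<Longrightarrow> vanishes R (f s)"
    and U: "open U" "convex U" "s0 \<in> U"
  shows "((\<lambda>s. LINT t|lborel. f s t) has_vector_derivative (LINT t|lborel. f' s0 t)) (at s0)"
proof -
  obtain a b :: 'b where ab: "cball 0 R \<subseteq> cbox a b" by (rule cball_subset_cube)
  \<comment> \<open>For \<open>t\<close> outside the ball the function of \<open>s\<close> is
    identically 0 on the open set \<open>U\<close>, hence so is its derivative.\<close>
  have van': "vanishes R (f' s0)"
    unfolding vanishes_def
  proof (intro allI impI)
    fix t :: 'b assume t: "R < norm t"
    have "((\<lambda>s. f s t) has_vector_derivative 0) (at s0)"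
    proof (rule has_vector_derivative_transform_within_open[OF _ U(1,3)])
      show "((\<lambda>s. 0) has_vector_derivative 0) (at s0)" by simp
    qed (use van t in \<open>auto simp: vanishes_def\<close>)
    from vector_derivative_unique_at[OF der[OF U(3)] this] show "f' s0 t = 0" .
  qed
  have c': "continuous_on UNIV (f' s0)"
  proof -
    have "continuous_on UNIV (Pair s0 :: 'b \<Rightarrow> _)"
      by (intro continuous_on_Pair continuous_on_const continuous_on_id)
    from continuous_on_compose2[OF cont' this] U(3) show ?thesis by auto
  qed
  have "((\<lambda>s. integral (cbox a b) (f s)) has_vector_derivative integral (cbox a b) (f' s0))
      (at s0 within U)"
  proof (rule leibniz_rule_vector_derivative)
    show "((\<lambda>s. f s t) has_vector_derivative f' s t) (at s within U)" if "s \<in> U" for s t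
      using der[OF that] by (rule has_vector_derivative_at_within)
    show "f s integrable_on cbox a b" if "s \<in> U" for s
      using cont[OF that] by (intro integrable_continuous) (auto intro: continuous_on_subset)
    show "continuous_on (U \<times> cbox a b) (\<lambda>(s, t). f' s t)"
      using cont' by (rule continuous_on_subset) auto
  qed (use U in auto)
  then have "((\<lambda>s. integral (cbox a b) (f s)) has_vector_derivative integral (cbox a b) (f' s0)) (at s0)"
    unfolding at_within_open[OF U(3,1)] .
  then have "((\<lambda>s. LINT t|lborel. f s t) has_vector_derivative integral (cbox a b) (f' s0)) (at s0)"
    by (rule has_vector_derivative_transform_within_open[OF _ U(1,3)])
       (rule lint_vanishes[OF cont van ab, symmetric])
  then show ?thesis unfolding lint_vanishes[OF c' van' ab] .
qed

text \<open>The integral of \<open>\<phi> (p + s v)\<close> over \<open>p\<close> does not depend on \<open>s\<close>.\<close>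

lemma integral_directional_derivative:
  fixes \<phi> :: "'a::euclidean_space \<Rightarrow> complex"
  assumes der: "\<And>p. ((\<lambda>s. \<phi> (p + s *\<^sub>R v)) has_vector_derivative \<phi>' p) (at 0)"
    and cont: "continuous_on UNIV \<phi>" "continuous_on UNIV \<phi>'" and van: "vanishes R \<phi>"
  shows "(LINT p|lborel. \<phi>' p) = 0"
proof -
  \<comment> \<open>The hypothesis covers only \<open>s = 0\<close>, but at every base point; moving
    the base point to \<open>p + s *\<^sub>R v\<close> gives all \<open>s\<close>.\<close>
  have der': "((\<lambda>s. \<phi> (p + s *\<^sub>R v)) has_vector_derivative \<phi>' (p + s *\<^sub>R v)) (at s)" for p s
  proof -
    have "((\<lambda>r. \<phi> ((p + s *\<^sub>R v) + r *\<^sub>R v)) \<circ> (\<lambda>r. r - s) has_vector_derivative 1 *\<^sub>R \<phi>' (p + s *\<^sub>R v)) (at s)"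
      by (rule vector_diff_chain_at) (auto intro!: derivative_eq_intros simp: der)
    then show ?thesis by (simp add: o_def algebra_simps)
  qed
  have "((\<lambda>s. LINT p|lborel. \<phi> (p + s *\<^sub>R v)) has_vector_derivative (LINT p|lborel. \<phi>' (p + 0 *\<^sub>R v))) (at 0)"
  \<comment> \<open>A bounded interval of translations keeps the supports in the common ball of
    radius \<open>R + norm v\<close>.\<close>
  proof (rule has_vector_derivative_lint[where U = "{-1<..<1}" and R = "R + norm v"])
    show "continuous_on ({- 1<..<1} \<times> UNIV) (\<lambda>(s, t). \<phi>' (t + s *\<^sub>R v))"
      unfolding split_beta by (rule continuous_on_compose2[OF cont(2)]) (auto intro!: continuous_intros)
    show "continuous_on UNIV (\<lambda>p. \<phi> (p + s *\<^sub>R v))" for s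
      by (rule continuous_on_compose2[OF cont(1)]) (auto intro!: continuous_intros)
    show "vanishes (R + norm v) (\<lambda>p. \<phi> (p + s *\<^sub>R v))" if s: "s \<in> {-1<..<1}" for s
      unfolding vanishes_def
    proof (intro allI impI)
      fix p :: 'a assume p: "R + norm v < norm p"
      have "norm (s *\<^sub>R v) \<le> 1 * norm v"
        unfolding norm_scaleR by (rule mult_right_mono) (use s in auto)
      moreover have "norm p - norm (s *\<^sub>R v) \<le> norm (p + s *\<^sub>R v)"
        using norm_diff_ineq by blast
      ultimately have "R < norm (p + s *\<^sub>R v)" using p by linarith
      then show "\<phi> (p + s *\<^sub>R v) = 0" using van by (auto simp: vanishes_def)
    qed
  qed (use der' in auto)
  moreover have "(\<lambda>s. LINT p|lborel. \<phi> (p + s *\<^sub>R v)) = (\<lambda>s. LINT p|lborel. \<phi> p)"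
  proof
    fix s
    have "(LINT p|lborel. \<phi> p) = (LINT p|distr lborel borel ((+) (s *\<^sub>R v)). \<phi> p)"
      by (simp add: lborel_distr_plus)
    also have "\<dots> = (LINT p|lborel. \<phi> (s *\<^sub>R v + p))"
      by (rule integral_distr) (auto intro!: borel_measurable_continuous_onI cont)
    finally show "(LINT p|lborel. \<phi> (p + s *\<^sub>R v)) = (LINT p|lborel. \<phi> p)"
      by (simp add: add.commute)
  qed
  ultimately have "((\<lambda>s::real. LINT p|lborel. \<phi> p) has_vector_derivative (LINT p|lborel. \<phi>' p)) (at 0)"
    by simp
  from vector_derivative_unique_at[OF this has_vector_derivative_const] show ?thesis .
qed

subsection \<open>Continuously differentiable functions\<close>

definition dderiv :: "'p \<Rightarrow> ('p::real_normed_vector \<Rightarrow> complex) \<Rightarrow> 'p \<Rightarrow> complex" where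
  "dderiv v f p = frechet_derivative f (at p) v"

definition cdiff1 :: "('p::real_normed_vector \<Rightarrow> complex) \<Rightarrow> bool" where
  "cdiff1 f \<longleftrightarrow> (\<forall>p. f differentiable (at p)) \<and> (\<forall>v. continuous_on UNIV (dderiv v f))"

definition cdiff2 :: "('p::real_normed_vector \<Rightarrow> complex) \<Rightarrow> bool" where
  "cdiff2 f \<longleftrightarrow> cdiff1 f \<and> (\<forall>v. cdiff1 (dderiv v f))"

lemma cdiff1_has_derivative: "cdiff1 f \<Longrightarrow> (f has_derivative (\<lambda>v. dderiv v f p)) (at p)"
  unfolding cdiff1_def dderiv_def by (simp add: frechet_derivative_works)

lemma dderiv_eqI: "(f has_derivative f') (at p) \<Longrightarrow> dderiv v f p = f' v"
  unfolding dderiv_def by (simp add: frechet_derivative_at[symmetric])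

lemma cdiff1_cont_dderiv: "cdiff1 f \<Longrightarrow> continuous_on UNIV (dderiv v f)"
  by (simp add: cdiff1_def)

lemma cdiff1_cont: "cdiff1 f \<Longrightarrow> continuous_on UNIV f"
  by (intro differentiable_imp_continuous_on differentiable_at_imp_differentiable_on) (simp add: cdiff1_def)

lemma cdiff1I:
  assumes "\<And>p. (f has_derivative (\<lambda>v. f' v p)) (at p)" "\<And>v. continuous_on UNIV (f' v)"
  shows "cdiff1 f"
proof -
  have "dderiv v f = f' v" for v using dderiv_eqI[OF assms(1)] by auto
  with assms show ?thesis by (auto simp: cdiff1_def differentiable_def)
qed

lemma cdiff2_cdiff1: "cdiff2 f \<Longrightarrow> cdiff1 f" and cdiff2_cdiff1_dderiv: "cdiff2 f \<Longrightarrow> cdiff1 (dderiv v f)"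
  by (simp_all add: cdiff2_def)

lemma dderiv_add_dir: "cdiff1 f \<Longrightarrow> dderiv (u + v) f p = dderiv u f p + dderiv v f p"
  using cdiff1_has_derivative has_derivative_linear linear_add by blast

lemma dderiv_scale_dir: "cdiff1 f \<Longrightarrow> dderiv (c *\<^sub>R v) f p = of_real c * dderiv v f p"
  using linear_scale[OF has_derivative_linear[OF cdiff1_has_derivative]] by (metis scaleR_conv_of_real)

lemma dderiv_zero_dir: "cdiff1 f \<Longrightarrow> dderiv 0 f p = 0"
  using linear_0[OF has_derivative_linear[OF cdiff1_has_derivative]] by auto

lemma dderiv_sum_dir: "cdiff1 f \<Longrightarrow> dderiv (\<Sum>i\<in>I. c i *\<^sub>R v i) f p = (\<Sum>i\<in>I. of_real (c i) * dderiv (v i) f p)"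
proof (induction I rule: infinite_finite_induct)
  case (insert i I)
  then show ?case by (simp add: dderiv_add_dir dderiv_scale_dir)
qed (simp_all add: dderiv_zero_dir)

lemma cdiff1_const: "cdiff1 (\<lambda>p. c)"
  by (rule cdiff1I[where f'="\<lambda>_ _. 0"]) (auto intro!: derivative_eq_intros)

lemma dderiv_const: "dderiv v (\<lambda>p. c) p = 0"
  by (rule dderiv_eqI[where f'="\<lambda>_. 0"]) (auto intro!: derivative_eq_intros)

lemma assumes "cdiff1 f" "cdiff1 g"
  shows cdiff1_add: "cdiff1 (\<lambda>p. f p + g p)" and dderiv_add: "dderiv v (\<lambda>p. f p + g p) p = dderiv v f p + dderiv v g p"
proof -
  have d: "((\<lambda>p. f p + g p) has_derivative (\<lambda>v. dderiv v f p + dderiv v g p)) (at p)" for p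
    by (intro has_derivative_add cdiff1_has_derivative assms)
  show "cdiff1 (\<lambda>p. f p + g p)"
    by (rule cdiff1I[where f'="\<lambda>v p. dderiv v f p + dderiv v g p"]) (intro d continuous_on_add cdiff1_cont_dderiv assms)+
  show "dderiv v (\<lambda>p. f p + g p) p = dderiv v f p + dderiv v g p" by (rule dderiv_eqI[OF d])
qed

lemma
  assumes "\<And>i. i \<in> I \<Longrightarrow> cdiff1 (f i)"
  shows cdiff1_sum: "cdiff1 (\<lambda>p. \<Sum>i\<in>I. f i p)" and dderiv_sum: "dderiv v (\<lambda>p. \<Sum>i\<in>I. f i p) p = (\<Sum>i\<in>I. dderiv v (f i) p)"
proof -
  have d: "((\<lambda>p. \<Sum>i\<in>I. f i p) has_derivative (\<lambda>v. \<Sum>i\<in>I. dderiv v (f i) p)) (at p)" for p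
    by (intro has_derivative_sum cdiff1_has_derivative assms)
  show "cdiff1 (\<lambda>p. \<Sum>i\<in>I. f i p)"
    by (rule cdiff1I[where f'="\<lambda>v p. \<Sum>i\<in>I. dderiv v (f i) p"]) (intro d continuous_on_sum cdiff1_cont_dderiv assms; assumption)+
  show "dderiv v (\<lambda>p. \<Sum>i\<in>I. f i p) p = (\<Sum>i\<in>I. dderiv v (f i) p)" by (rule dderiv_eqI[OF d])
qed

lemma assumes "cdiff1 f" "cdiff1 g"
  shows cdiff1_mult: "cdiff1 (\<lambda>p. f p * g p)" and dderiv_mult: "dderiv v (\<lambda>p. f p * g p) p = f p * dderiv v g p + dderiv v f p * g p"
proof -
  have d: "((\<lambda>p. f p * g p) has_derivative (\<lambda>v. f p * dderiv v g p + dderiv v f p * g p)) (at p)" for p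
    by (intro has_derivative_mult cdiff1_has_derivative assms)
  show "cdiff1 (\<lambda>p. f p * g p)"
    by (rule cdiff1I[where f'="\<lambda>v p. f p * dderiv v g p + dderiv v f p * g p"])
       (intro d continuous_on_add continuous_on_mult cdiff1_cont_dderiv cdiff1_cont assms)+
  show "dderiv v (\<lambda>p. f p * g p) p = f p * dderiv v g p + dderiv v f p * g p" by (rule dderiv_eqI[OF d])
qed

lemma dderiv_cmult: "cdiff1 f \<Longrightarrow> dderiv v (\<lambda>p. c * f p) p = c * dderiv v f p"
  by (simp add: dderiv_mult[OF cdiff1_const] dderiv_const)

lemma cdiff1_cmult: "cdiff1 f \<Longrightarrow> cdiff1 (\<lambda>p. c * f p)"
  by (rule cdiff1_mult[OF cdiff1_const])

lemma assumes "cdiff1 f"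
  shows cdiff1_cnj: "cdiff1 (\<lambda>p. cnj (f p))" and dderiv_cnj: "dderiv v (\<lambda>p. cnj (f p)) p = cnj (dderiv v f p)"
proof -
  have d: "((\<lambda>p. cnj (f p)) has_derivative (\<lambda>v. cnj (dderiv v f p))) (at p)" for p
    by (intro has_derivative_cnj cdiff1_has_derivative assms)
  show "cdiff1 (\<lambda>p. cnj (f p))"
    by (rule cdiff1I[where f'="\<lambda>v p. cnj (dderiv v f p)"]) (intro d continuous_on_cnj cdiff1_cont_dderiv assms)+
  show "dderiv v (\<lambda>p. cnj (f p)) p = cnj (dderiv v f p)" by (rule dderiv_eqI[OF d])
qed

lemma
  fixes l :: "'p::euclidean_space \<Rightarrow> real"
  assumes "linear l"
  shows cdiff1_linear: "cdiff1 (\<lambda>p. complex_of_real (l p))" 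
    and dderiv_linear: "dderiv v (\<lambda>p. complex_of_real (l p)) p = complex_of_real (l v)"
proof -
  have d: "((\<lambda>p. complex_of_real (l p)) has_derivative (\<lambda>v. complex_of_real (l v))) (at p)" for p
    using assms by (intro has_derivative_of_real linear_imp_has_derivative)
  show "cdiff1 (\<lambda>p. complex_of_real (l p))" by (rule cdiff1I[where f'="\<lambda>v p. complex_of_real (l v)"]) (auto intro: d)
  show "dderiv v (\<lambda>p. complex_of_real (l p)) p = complex_of_real (l v)" by (rule dderiv_eqI[OF d])
qed

lemma cdiff1_has_vector_derivative:
  assumes "cdiff1 f"
  shows "((\<lambda>s. f (p + s *\<^sub>R v)) has_vector_derivative dderiv v f (p + s *\<^sub>R v)) (at s within U)"
proof -
  have "((\<lambda>s. f (p + s *\<^sub>R v)) has_derivative (\<lambda>r. dderiv (r *\<^sub>R v) f (p + s *\<^sub>R v))) (at s within U)"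
  proof (rule has_derivative_compose[where g=f, OF _ cdiff1_has_derivative[OF assms]])
    show "((\<lambda>s. p + s *\<^sub>R v) has_derivative (\<lambda>r. r *\<^sub>R v)) (at s within U)"
      by (auto intro!: derivative_eq_intros)
  qed
  then show ?thesis
    using assms by (simp add: has_vector_derivative_def dderiv_scale_dir scaleR_conv_of_real)
qed

lemma vanishes_dderiv:
  fixes f :: "'p::real_normed_vector \<Rightarrow> complex"
  assumes "cdiff1 f" "vanishes R f"
  shows "vanishes R (dderiv v f)"
  unfolding vanishes_def
proof (intro allI impI)
  fix p :: 'p assume p: "R < norm p"
  have "(f has_derivative (\<lambda>_. 0)) (at p)"
  proof (rule has_derivative_transform_within_open[where f = "\<lambda>_. 0" and s = "{p. R < norm p}"])
    show "((\<lambda>_. 0) has_derivative (\<lambda>_. 0)) (at p)" by simp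
    show "open {p. R < norm p}" by (intro open_Collect_less continuous_intros)
  qed (use assms(2) p in \<open>auto simp: vanishes_def\<close>)
  then show "dderiv v f p = 0" by (rule dderiv_eqI)
qed

lemma integral_dderiv:
  fixes f :: "'a::euclidean_space \<Rightarrow> complex"
  assumes "cdiff1 f" "vanishes R f"
  shows "(LINT p|lborel. dderiv v f p) = 0"
proof (rule integral_directional_derivative[where v=v])
  show "((\<lambda>s. f (p + s *\<^sub>R v)) has_vector_derivative dderiv v f p) (at 0)" for p
    using cdiff1_has_vector_derivative[OF assms(1), of p v 0 UNIV] by simp
qed (use assms cdiff1_cont cdiff1_cont_dderiv in auto)

text \<open>Differentiate \<open>f (p + r v + s u) - f (p + s u) = \<integral>\<^sub>0\<^sup>r \<partial>\<^sub>v f (p + \<rho> v + s u) d\<rho>\<close> in \<open>s\<close>, then in \<open>r\<close>.\<close>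

lemma dderiv_commute:
  fixes f :: "'a::euclidean_space \<Rightarrow> complex"
  assumes f: "cdiff2 f"
  shows "dderiv u (dderiv v f) p = dderiv v (dderiv u f) p"
proof -
  let ?g = "\<lambda>s r. dderiv v f (p + r *\<^sub>R v + s *\<^sub>R u)"
  let ?g' = "\<lambda>s r. dderiv u (dderiv v f) (p + r *\<^sub>R v + s *\<^sub>R u)"
  have cg: "continuous_on UNIV (\<lambda>r. ?g s r)" for s
    by (rule continuous_on_compose2[OF cdiff1_cont[OF cdiff2_cdiff1_dderiv[OF f]]]) (auto intro!: continuous_intros)
  have cg': "continuous_on UNIV (\<lambda>(s, r). ?g' s r)"
    unfolding split_beta
    by (rule continuous_on_compose2[OF cdiff1_cont_dderiv[OF cdiff2_cdiff1_dderiv[OF f]]]) (auto intro!: continuous_intros)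
  have 1: "integral {0..r} (?g s) = f (p + r *\<^sub>R v + s *\<^sub>R u) - f (p + s *\<^sub>R u)" if "0 \<le> r" for r s
  proof -
    have "((\<lambda>r. f ((p + s *\<^sub>R u) + r *\<^sub>R v)) has_vector_derivative ?g s x) (at x within {0..r})" for x
      using cdiff1_has_vector_derivative[OF cdiff2_cdiff1[OF f], of "p + s *\<^sub>R u" v x] by (simp add: algebra_simps)
    from fundamental_theorem_of_calculus[OF that this] show ?thesis
      by (auto simp: algebra_simps dest: integral_unique)
  qed
  have 2: "integral {0..r} (?g' 0) = dderiv u f (p + r *\<^sub>R v) - dderiv u f p" if r: "0 \<le> r" for r
  proof -
    have "((\<lambda>s. integral (cbox 0 r) (?g s)) has_vector_derivative integral (cbox 0 r) (?g' 0)) (at 0 within UNIV)"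
    proof (rule leibniz_rule_vector_derivative)
      show "((\<lambda>s. ?g s t) has_vector_derivative ?g' s t) (at s within UNIV)" for s t
        by (rule cdiff1_has_vector_derivative[OF cdiff2_cdiff1_dderiv[OF f]])
      show "?g s integrable_on cbox 0 r" for s
        by (intro integrable_continuous continuous_on_subset[OF cg]) auto
      show "continuous_on (UNIV \<times> cbox 0 r) (\<lambda>(s, r). ?g' s r)"
        by (rule continuous_on_subset[OF cg']) auto
    qed auto
    moreover have "(\<lambda>s. integral (cbox 0 r) (?g s)) = (\<lambda>s. f (p + r *\<^sub>R v + s *\<^sub>R u) - f (p + s *\<^sub>R u))"
      using 1[OF r] by auto
    ultimately have a: "((\<lambda>s. f (p + r *\<^sub>R v + s *\<^sub>R u) - f (p + s *\<^sub>R u)) has_vector_derivative integral (cbox 0 r) (?g' 0)) (at 0)"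
      by simp
    have b: "((\<lambda>s. f (p + r *\<^sub>R v + s *\<^sub>R u) - f (p + s *\<^sub>R u)) has_vector_derivative dderiv u f (p + r *\<^sub>R v) - dderiv u f p) (at 0)"
      using cdiff1_has_vector_derivative[OF cdiff2_cdiff1[OF f], of _ u 0 UNIV]
      by (intro has_vector_derivative_diff) (metis add_0_right scale_zero_left)+
    show ?thesis using vector_derivative_unique_at[OF a b] by simp
  qed
  have cg0: "continuous_on {0..1} (?g' 0)"
    by (rule continuous_on_compose2[OF cdiff1_cont_dderiv[OF cdiff2_cdiff1_dderiv[OF f]]]) (auto intro!: continuous_intros)
  \<comment> \<open>The formula for the integral holds for \<open>r\<close> \<ge> 0, so only
    one-sided derivatives at 0 are compared. They are still unique, since 0 is a limit point of the
    interval.\<close>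
  have "((\<lambda>r. integral {0..r} (?g' 0)) has_vector_derivative ?g' 0 0) (at 0 within {0..1})"
    by (rule integral_has_vector_derivative[OF cg0]) auto
  then have a: "((\<lambda>r. dderiv u f (p + r *\<^sub>R v) - dderiv u f p) has_vector_derivative dderiv u (dderiv v f) p) (at 0 within {0..1})"
  proof -
    assume *: "((\<lambda>r. integral {0..r} (?g' 0)) has_vector_derivative ?g' 0 0) (at 0 within {0..1})"
    have "((\<lambda>r. dderiv u f (p + r *\<^sub>R v) - dderiv u f p) has_vector_derivative ?g' 0 0) (at 0 within {0..1})"
    proof (rule has_vector_derivative_transform[OF _ _ *])
      show "dderiv u f (p + r *\<^sub>R v) - dderiv u f p = integral {0..r} (?g' 0)" if "r \<in> {0..1}" for r
        by (rule 2[symmetric]) (use that in auto)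
    qed auto
    then show ?thesis by simp
  qed
  have b: "((\<lambda>r. dderiv u f (p + r *\<^sub>R v) - dderiv u f p) has_vector_derivative dderiv v (dderiv u f) p - 0) (at 0 within {0..1})"
    using cdiff1_has_vector_derivative[OF cdiff2_cdiff1_dderiv[OF f], of _ p v 0]
    by (intro has_vector_derivative_diff has_vector_derivative_const) (metis add_0_right scale_zero_left)
  show ?thesis
    using vector_derivative_unique_within[OF _ a b] by (simp add: trivial_limit_within islimpt_Icc)
qed

lemma cdiff1_of_cont_diff:
  assumes "cont_diff (Suc 0) f" 
  shows "cdiff1 f"
proof -
  have d: "\<And>p. f differentiable (at p)" and c: "\<And>b. b \<in> Basis \<Longrightarrow> continuous_on UNIV (dderiv b f)"
    using assms by (auto simp: dderiv_def[abs_def])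
  have "dderiv v f = (\<lambda>p. \<Sum>b\<in>Basis. (v \<bullet> b) *\<^sub>R dderiv b f p)" for v
  proof
    fix p
    have l: "linear (frechet_derivative f (at p))" using d by (rule linear_frechet_derivative)
    have "dderiv v f p = frechet_derivative f (at p) (\<Sum>b\<in>Basis. (v \<bullet> b) *\<^sub>R b)"
      by (simp add: dderiv_def euclidean_representation)
    also have "\<dots> = (\<Sum>b\<in>Basis. (v \<bullet> b) *\<^sub>R dderiv b f p)"
      by (simp only: linear_sum[OF l] linear_scale[OF l] dderiv_def)
    finally show "dderiv v f p = (\<Sum>b\<in>Basis. (v \<bullet> b) *\<^sub>R dderiv b f p)" .
  qed
  note eq = this
  have "continuous_on UNIV (dderiv v f)" for v
    by (subst eq) (intro continuous_on_sum continuous_on_scaleR continuous_on_const c)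
  then show ?thesis using d by (simp add: cdiff1_def)
qed

lemma smooth_cdiff2:
  assumes "smooth f"
  shows "cdiff2 f"
proof -
  have 1: "cdiff1 f" by (rule cdiff1_of_cont_diff) (use assms in \<open>simp only: smooth_def\<close>)
  have 2: "cdiff1 (dderiv b f)" if "b \<in> Basis" for b
  proof (rule cdiff1_of_cont_diff)
    have "cont_diff (Suc (Suc 0)) f" using assms by (simp only: smooth_def)
    then show "cont_diff (Suc 0) (dderiv b f)" using that
      unfolding dderiv_def[abs_def] by (subst (asm) cont_diff.simps) auto
  qed
  have "dderiv v f = (\<lambda>p. \<Sum>b\<in>Basis. of_real (v \<bullet> b) * dderiv b f p)" for v
    using dderiv_sum_dir[OF 1, of "\<lambda>b. v \<bullet> b" "\<lambda>b. b" Basis] by (simp add: euclidean_representation fun_eq_iff)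
  note eq = this
  have "cdiff1 (dderiv v f)" for v
    by (subst eq) (intro cdiff1_sum cdiff1_cmult 2)
  then show ?thesis using 1 by (simp add: cdiff2_def)
qed

subsection \<open>Bessel's inequality for the Fourier transform\<close>

text \<open>Complex-valued companion of \<open>nn_integral_lborel_prod\<close>:
  \<open>lborel\<close> is the image of the product of one-dimensional Lebesgue measures under the
  coordinate map.\<close>

lemma
  fixes f :: "'a::euclidean_space \<Rightarrow> real \<Rightarrow> complex"
  assumes f: "\<And>b. b \<in> Basis \<Longrightarrow> integrable lborel (f b)"
  shows integrable_lborel_prod: "integrable lborel (\<lambda>x::'a. \<Prod>b\<in>Basis. f b (x \<bullet> b))"
    and integral_lborel_prod: "(LINT x|lborel. (\<Prod>b\<in>Basis. f b (x \<bullet> b))) = (\<Prod>b\<in>Basis. LINT y|lborel. f b y)"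
proof -
  interpret product_sigma_finite "\<lambda>_::'a. lborel :: real measure" ..
  have m[measurable]: "f b \<in> borel_measurable borel" if "b \<in> Basis" for b
    using borel_measurable_integrable[OF f[OF that]] by simp
  have m2: "(\<lambda>x::'a. \<Prod>b\<in>Basis. f b (x \<bullet> b)) \<in> borel_measurable borel"
  proof (rule borel_measurable_prod)
    fix b :: 'a assume "b \<in> Basis"
    then show "(\<lambda>x::'a. f b (x \<bullet> b)) \<in> borel_measurable borel"
      by (intro measurable_compose[OF _ m]) auto
  qed
  have m3: "(\<lambda>g. \<Sum>b\<in>Basis. g b *\<^sub>R b) \<in> measurable (Pi\<^sub>M Basis (\<lambda>_::'a. lborel :: real measure)) borel"
    by simp
  have eq: "(\<Prod>b\<in>Basis. f b ((\<Sum>b\<in>Basis. g b *\<^sub>R b) \<bullet> b)) = (\<Prod>b\<in>Basis. f b (g b))" for g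
    by (intro prod.cong) (simp_all add: inner_sum_left inner_Basis if_distrib cong: if_cong)
  show "integrable lborel (\<lambda>x::'a. \<Prod>b\<in>Basis. f b (x \<bullet> b))"
    by (subst lborel_eq, subst integrable_distr_eq[OF m3 m2], unfold eq)
       (rule product_integrable_prod, auto intro: f)
  show "(LINT x|lborel. (\<Prod>b\<in>Basis. f b (x \<bullet> b))) = (\<Prod>b\<in>Basis. LINT y|lborel. f b y)"
    by (subst lborel_eq, subst integral_distr[OF m3 m2], unfold eq)
       (rule product_integral_prod, auto intro: f)
qed

lemma continuous_on_cis [continuous_intros]:
  "continuous_on S f \<Longrightarrow> continuous_on S (\<lambda>x. cis (f x))"
  unfolding cis_conv_exp by (intro continuous_intros)

text \<open>A rescaling of the characteristic function of the standard normal distribution. The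
  transform is written as a multiple of a density, so that its total mass 2 pi is known at
  once.\<close>

lemma
  assumes s: "s > 0"
  shows integrable_gauss_cis: "integrable lborel (\<lambda>x. complex_of_real (exp (- (s * x)\<^sup>2 / 2)) * cis (- (z * x)))"
    and integral_gauss_cis: "(LINT x|lborel. complex_of_real (exp (- (s * x)\<^sup>2 / 2)) * cis (- (z * x))) =
      complex_of_real (2 * pi * normal_density 0 s z)"
proof -
  let ?g = "\<lambda>x. complex_of_real (exp (- (s * x)\<^sup>2 / 2)) * cis (- (z * x))"
  let ?h = "\<lambda>x. std_normal_density x *\<^sub>R iexp ((- z / s) * x)"
  interpret std: real_distribution std_normal_distribution by (rule real_dist_normal_dist)
  have "integrable std_normal_distribution (\<lambda>x. iexp ((- z / s) * x))"
    by (rule std.integrable_iexp) simp_all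
  then have ih: "integrable lborel ?h"
    by (subst (asm) integrable_density) (auto simp: normal_density_nonneg)
  have "(LINT x|lborel. ?h x) = char std_normal_distribution (- z / s)"
    unfolding char_def by (subst integral_density) (auto simp: normal_density_nonneg)
  also have "\<dots> = complex_of_real (exp (- ((- z / s)^2) / 2))"
    by (simp only: char_std_normal_distribution)
  finally have h: "(LINT x|lborel. ?h x) = complex_of_real (exp (- ((- z / s)^2) / 2))" .
  have g: "?g = (\<lambda>x. complex_of_real (sqrt (2 * pi)) * ?h (0 + s * x))"
    using s by (auto simp: fun_eq_iff normal_density_def scaleR_conv_of_real cis_conv_exp)
  show "integrable lborel ?g"
    unfolding g using s by (intro integrable_mult_right lborel_integrable_real_affine ih) auto
  have "(LINT x|lborel. ?g x) = complex_of_real (sqrt (2 * pi)) * (LINT x|lborel. ?h (0 + s * x))"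
    unfolding g by (subst integral_mult_right_zero) simp
  also have "(LINT x|lborel. ?h (0 + s * x)) = (1 / s) *\<^sub>R (LINT x|lborel. ?h x)"
    using lborel_integral_real_affine[of s ?h 0] s by simp
  also have "complex_of_real (sqrt (2 * pi)) * \<dots> = complex_of_real (2 * pi * normal_density 0 s z)"
    unfolding h using s
    by (simp add: normal_density_def scaleR_conv_of_real real_sqrt_mult field_simps flip: of_real_mult)
  finally show "(LINT x|lborel. ?g x) = complex_of_real (2 * pi * normal_density 0 s z)" .
qed

context
  fixes s :: real
  assumes s: "s > 0"
begin

text \<open>The Fourier transform of the damping factor exp(-(s |\<xi>|)^2 / 2): (2 pi)^d times the
  centred normal density with deviation s in each coordinate.\<close>

definition gauss_kernel :: "'a::euclidean_space \<Rightarrow> real" where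
  "gauss_kernel z = (\<Prod>b\<in>Basis. 2 * pi * normal_density 0 s (z \<bullet> b))"

lemma gauss_kernel_nonneg: "gauss_kernel z \<ge> 0"
  unfolding gauss_kernel_def by (intro prod_nonneg) (simp add: normal_density_nonneg)

lemma gauss_kernel_minus: "gauss_kernel (- z) = gauss_kernel z"
  unfolding gauss_kernel_def by (simp add: normal_density_def)

lemma measurable_gauss_kernel [measurable]: "gauss_kernel \<in> borel_measurable borel"
  unfolding gauss_kernel_def[abs_def] by measurable

lemma nn_integral_gauss_kernel:
  "(\<integral>\<^sup>+z. ennreal (gauss_kernel (z::'a::euclidean_space)) \<partial>lborel) = ennreal ((2 * pi) ^ DIM('a))"
proof -
  have 1: "(\<integral>\<^sup>+x. ennreal (2 * pi * normal_density 0 s x) \<partial>lborel) = ennreal (2 * pi)"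
    using s by (subst nn_integral_eq_integral) (auto simp: normal_density_nonneg)
  have "(\<integral>\<^sup>+z. ennreal (gauss_kernel (z::'a)) \<partial>lborel) =
      (\<integral>\<^sup>+z. (\<Prod>b\<in>Basis. ennreal (2 * pi * normal_density 0 s ((z::'a) \<bullet> b))) \<partial>lborel)"
    unfolding gauss_kernel_def by (subst prod_ennreal) (auto simp: normal_density_nonneg)
  also have "\<dots> = (\<Prod>b\<in>(Basis::'a set). (\<integral>\<^sup>+x. ennreal (2 * pi * normal_density 0 s x) \<partial>lborel))"
    by (rule nn_integral_lborel_prod) auto
  also have "\<dots> = ennreal ((2 * pi) ^ DIM('a))" by (simp add: 1 ennreal_power)
  finally show ?thesis .
qed

lemma nn_integral_gauss_kernel_shift:
  "(\<integral>\<^sup>+z. ennreal (gauss_kernel (z - p::'a::euclidean_space)) \<partial>lborel) = ennreal ((2 * pi) ^ DIM('a))"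
proof -
  have "(\<integral>\<^sup>+z. ennreal (gauss_kernel (z::'a)) \<partial>lborel) = (\<integral>\<^sup>+z. ennreal (gauss_kernel z) \<partial>(distr lborel borel ((+) (- p))))"
    by (simp only: lborel_distr_plus)
  also have "\<dots> = (\<integral>\<^sup>+z. ennreal (gauss_kernel (- p + z)) \<partial>lborel)"
    by (rule nn_integral_distr) auto
  finally show ?thesis by (simp add: nn_integral_gauss_kernel)
qed

lemma
  shows integrable_gauss: "integrable lborel (\<lambda>\<xi>::'a::euclidean_space. exp (- (s * norm \<xi>)\<^sup>2 / 2))"
    and integral_gauss_kernel: "(LINT \<xi>|lborel. complex_of_real (exp (- (s * norm \<xi>)\<^sup>2 / 2)) * cis (- (z \<bullet> \<xi>))) =
      complex_of_real (gauss_kernel (z::'a))"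
proof -
  have e: "complex_of_real (exp (- (s * norm \<xi>)\<^sup>2 / 2)) * cis (- (z \<bullet> \<xi>)) =
     (\<Prod>b\<in>Basis. complex_of_real (exp (- (s * (\<xi> \<bullet> b))\<^sup>2 / 2)) * cis (- ((z \<bullet> b) * (\<xi> \<bullet> b))))" for z \<xi> :: 'a
  proof -
    have 1: "- (s * norm \<xi>)\<^sup>2 / 2 = (\<Sum>b\<in>Basis. - (s * (\<xi> \<bullet> b))\<^sup>2 / 2)"
    proof -
      have "(norm \<xi>)\<^sup>2 = (\<Sum>b\<in>Basis. (\<xi> \<bullet> b)\<^sup>2)"
        unfolding power2_norm_eq_inner by (subst euclidean_inner) (simp add: power2_eq_square)
      then show ?thesis
        by (simp add: power_mult_distrib sum_negf sum_divide_distrib sum_distrib_left)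
    qed
    have 2: "cis (- (z \<bullet> \<xi>)) = (\<Prod>b\<in>Basis. cis (- ((z \<bullet> b) * (\<xi> \<bullet> b))))"
      by (simp add: cis_conv_exp euclidean_inner[of z \<xi>] sum_distrib_left sum_negf flip: exp_sum)
    show ?thesis unfolding 1 2 prod.distrib by (simp add: exp_sum)
  qed
  have i: "integrable lborel (\<lambda>\<xi>::'a. complex_of_real (exp (- (s * norm \<xi>)\<^sup>2 / 2)) * cis (- (z \<bullet> \<xi>)))" for z
    unfolding e by (rule integrable_lborel_prod) (rule integrable_gauss_cis[OF s])
  from integrable_norm[OF i[of 0]]
  show "integrable lborel (\<lambda>\<xi>::'a. exp (- (s * norm \<xi>)\<^sup>2 / 2))" by simp
  show "(LINT \<xi>|lborel. complex_of_real (exp (- (s * norm \<xi>)\<^sup>2 / 2)) * cis (- (z \<bullet> \<xi>))) =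
      complex_of_real (gauss_kernel (z::'a))"
    unfolding e gauss_kernel_def of_real_prod
    by (subst integral_lborel_prod) (simp_all only: integrable_gauss_cis[OF s] integral_gauss_cis[OF s])
qed

end


lemma borel_measurable_lborel_continuous:
  fixes f :: "'a::euclidean_space \<Rightarrow> 'b::topological_space"
  shows "continuous_on UNIV f \<Longrightarrow> f \<in> borel_measurable lborel"
  by (simp add: borel_measurable_continuous_onI)

text \<open>The damping factor has a nonnegative Fourier transform of total mass \<open>(2\<pi>)\<^sup>n\<close>, so that
  \<open>|\<phi> p| |\<phi> q| \<le> (|\<phi> p|\<^sup>2 + |\<phi> q|\<^sup>2) / 2\<close> suffices; no inversion formula is needed.\<close>

lemma bessel_gauss:
  fixes \<phi> :: "'a::euclidean_space \<Rightarrow> complex"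
  assumes s: "s > 0" and c: "continuous_on UNIV \<phi>" and v: "vanishes R \<phi>"
  shows "(\<integral>\<^sup>+\<xi>. ennreal (exp (- (s * norm \<xi>)\<^sup>2 / 2) * (cmod (fint \<phi> \<xi>))\<^sup>2) \<partial>lborel)
    \<le> ennreal ((2 * pi) ^ DIM('a)) * (\<integral>\<^sup>+p. ennreal ((cmod (\<phi> p))\<^sup>2) \<partial>lborel)"
proof -
  let ?w = "\<lambda>\<xi>::'a. exp (- (s * norm \<xi>)\<^sup>2 / 2)"
  let ?F = "\<lambda>\<xi>. fint \<phi> \<xi>"
  let ?P = "\<lambda>z::'a\<times>'a. \<phi> (fst z) * cnj (\<phi> (snd z))"
  let ?K = "\<lambda>\<xi> z. complex_of_real (?w \<xi>) * cis (- ((fst z - snd z) \<bullet> \<xi>)) * ?P z"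
  have [measurable]: "\<phi> \<in> borel_measurable borel" by (rule borel_measurable_continuous_onI[OF c])
  have i\<phi>: "integrable lborel \<phi>" by (rule integrable_vanishes[OF c v])
  have ic: "integrable lborel (\<lambda>p. cis (r p) * \<phi> p)" if "continuous_on UNIV r" for r
    by (rule integrable_vanishes[where R=R]) (use v that c in \<open>auto simp: vanishes_def intro!: continuous_intros\<close>)
  have iP: "integrable (lborel \<Otimes>\<^sub>M lborel) ?P"
  proof (rule lborel_pair.Fubini_integrable)
    show "integrable lborel (\<lambda>x. LINT y|lborel. norm (?P (x, y)))"
      using i\<phi> by (simp add: norm_mult)
    show "?P \<in> borel_measurable (lborel \<Otimes>\<^sub>M lborel)"
      unfolding lborel_prod
      by (intro borel_measurable_lborel_continuous continuous_intros
          continuous_on_compose2[OF c]) auto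
  qed (use i\<phi> in auto)
  \<comment> \<open>The squared modulus as a double integral over p and q; integrating it against
    the damping factor in \<xi> first leaves the kernel at p - q.\<close>
  have pft_fint: "complex_of_real ((cmod (?F \<xi>))\<^sup>2) = (LINT z|lborel. cis (- ((fst z - snd z) \<bullet> \<xi>)) * ?P z)" for \<xi>
  proof -
    have m: "(\<lambda>z. cis (- ((fst z - snd z) \<bullet> \<xi>))) \<in> borel_measurable (lborel \<Otimes>\<^sub>M lborel)"
      unfolding lborel_prod by (intro borel_measurable_lborel_continuous continuous_intros)
    have i: "integrable (lborel \<Otimes>\<^sub>M lborel) (\<lambda>z. cis (- ((fst z - snd z) \<bullet> \<xi>)) * ?P z)"
      by (rule Bochner_Integration.integrable_bound[OF iP borel_measurable_times[OF m borel_measurable_integrable[OF iP]]])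
         (simp add: norm_mult)
    have "complex_of_real ((cmod (?F \<xi>))\<^sup>2) = ?F \<xi> * cnj (?F \<xi>)"
      by (rule complex_norm_square)
    also have "cnj (?F \<xi>) = (LINT q|lborel. cis (q \<bullet> \<xi>) * cnj (\<phi> q))"
      by (simp add: cis_cnj flip: Bochner_Integration.integral_cnj)
    also have "?F \<xi> * \<dots> = (LINT p|lborel. LINT q|lborel. (cis (- (p \<bullet> \<xi>)) * \<phi> p) * (cis (q \<bullet> \<xi>) * cnj (\<phi> q)))"
      by simp
    also have "\<dots> = (LINT p|lborel. LINT q|lborel. cis (- ((fst (p, q) - snd (p, q)) \<bullet> \<xi>)) * ?P (p, q))"
    proof (intro Bochner_Integration.integral_cong refl)
      fix p q
      have "cis (- ((p - q) \<bullet> \<xi>)) = cis (- (p \<bullet> \<xi>)) * cis (q \<bullet> \<xi>)"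
        unfolding cis_mult by (simp add: inner_diff_left)
      then show "(cis (- (p \<bullet> \<xi>)) * \<phi> p) * (cis (q \<bullet> \<xi>) * cnj (\<phi> q)) = cis (- ((fst (p, q) - snd (p, q)) \<bullet> \<xi>)) * ?P (p, q)"
        unfolding fst_conv snd_conv by (simp only: mult.assoc mult.left_commute mult.commute)
    qed
    also have "\<dots> = (LINT z|(lborel \<Otimes>\<^sub>M lborel). cis (- ((fst z - snd z) \<bullet> \<xi>)) * ?P z)"
      by (rule lborel_pair.integral_fst'[OF i])
    finally show ?thesis by (simp add: lborel_prod)
  qed
  have mK: "case_prod ?K \<in> borel_measurable (lborel \<Otimes>\<^sub>M lborel)"
    unfolding lborel_prod split_beta
    by (intro borel_measurable_lborel_continuous continuous_intros
        continuous_on_compose2[OF c]) auto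
  have iK: "integrable (lborel \<Otimes>\<^sub>M lborel) (case_prod ?K)"
  proof (rule lborel_pair.Fubini_integrable[OF mK])
    have "(\<lambda>\<xi>. LINT z|lborel. norm (case_prod ?K (\<xi>, z))) = (\<lambda>\<xi>. ?w \<xi> * (LINT z|lborel. norm (?P z)))"
      by (simp add: norm_mult mult.assoc)
    then show "integrable lborel (\<lambda>\<xi>. LINT z|lborel. norm (case_prod ?K (\<xi>, z)))"
      using integrable_gauss[OF s, where 'a='a] by simp
    show "AE \<xi> in lborel. integrable lborel (\<lambda>z. case_prod ?K (\<xi>, z))"
    proof (rule AE_I2)
      fix \<xi> :: 'a
      have m: "(\<lambda>z. ?K \<xi> z) \<in> borel_measurable lborel"
        by (intro borel_measurable_lborel_continuous continuous_intros
          continuous_on_compose2[OF c]) auto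
      have "integrable lborel (\<lambda>z. of_real (?w \<xi>) * ?P z)" using iP by (simp add: lborel_prod)
      from Bochner_Integration.integrable_bound[OF this m]
      show "integrable lborel (\<lambda>z. case_prod ?K (\<xi>, z))" by (simp add: norm_mult)
    qed
  qed
  have wF: "complex_of_real (?w \<xi> * (cmod (?F \<xi>))\<^sup>2) = (LINT z|lborel. ?K \<xi> z)" for \<xi>
    unfolding of_real_mult pft_fint by (subst integral_mult_right_zero[symmetric]) (simp add: mult.assoc)
  have iwF: "integrable lborel (\<lambda>\<xi>. ?w \<xi> * (cmod (?F \<xi>))\<^sup>2)"
  proof -
    have "integrable lborel (\<lambda>\<xi>. LINT z|lborel. ?K \<xi> z)"
      using lborel_pair.integrable_fst[OF iK] by simp
    then have "integrable lborel (\<lambda>\<xi>. Re (complex_of_real (?w \<xi> * (cmod (?F \<xi>))\<^sup>2)))"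
      unfolding wF by (rule integrable_Re)
    then show ?thesis by simp
  qed
  have "complex_of_real (LINT \<xi>|lborel. ?w \<xi> * (cmod (?F \<xi>))\<^sup>2) = (LINT \<xi>|lborel. LINT z|lborel. ?K \<xi> z)"
    by (subst integral_of_real[symmetric], rule iwF) (simp only: wF)
  also have "\<dots> = (LINT z|lborel. LINT \<xi>|lborel. ?K \<xi> z)"
    by (rule lborel_pair.Fubini_integral[OF iK, symmetric])
  also have "\<dots> = (LINT z|lborel. complex_of_real (gauss_kernel s (fst z - snd z)) * ?P z)"
    by (subst integral_mult_left_zero) (simp only: integral_gauss_kernel[OF s])
  finally have eq: "complex_of_real (LINT \<xi>|lborel. ?w \<xi> * (cmod (?F \<xi>))\<^sup>2) =
      (LINT z|lborel. complex_of_real (gauss_kernel s (fst z - snd z)) * ?P z)" .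
  let ?a = "\<lambda>p. ennreal ((cmod (\<phi> p))\<^sup>2)"
  let ?G = "\<lambda>p q. ennreal (gauss_kernel s (p - q))"
  have nn: "(LINT \<xi>|lborel. ?w \<xi> * (cmod (?F \<xi>))\<^sup>2) \<ge> 0" by simp
  have "(\<integral>\<^sup>+\<xi>. ennreal (?w \<xi> * (cmod (?F \<xi>))\<^sup>2) \<partial>lborel) = ennreal (LINT \<xi>|lborel. ?w \<xi> * (cmod (?F \<xi>))\<^sup>2)"
    by (rule nn_integral_eq_integral[OF iwF]) simp
  also have "\<dots> = ennreal (norm (LINT z|lborel. complex_of_real (gauss_kernel s (fst z - snd z)) * ?P z))"
    unfolding eq[symmetric] norm_of_real using nn by simp
  \<comment> \<open>If the integrand were not integrable its integral would be 0 by convention and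
    the bound would hold trivially, so both cases are covered.\<close>
  also have "\<dots> \<le> (\<integral>\<^sup>+z. ennreal (norm (complex_of_real (gauss_kernel s (fst z - snd z)) * ?P z)) \<partial>lborel)"
    by (cases "integrable lborel (\<lambda>z. complex_of_real (gauss_kernel s (fst z - snd z)) * ?P z)")
       (auto intro: integral_norm_bound_ennreal simp: not_integrable_integral_eq)
  \<comment> \<open>Schur's test: after splitting the product of the moduli, each summand depends on
    one variable apart from the kernel, and the kernel has mass (2 pi)^d in the other.\<close>
  also have "\<dots> \<le> (\<integral>\<^sup>+z. ennreal (1/2) * (?a (fst z) * ?G (fst z) (snd z) + ?a (snd z) * ?G (fst z) (snd z)) \<partial>lborel)"
  proof (rule nn_integral_mono)
    fix z :: "'a \<times> 'a"
    let ?x = "cmod (\<phi> (fst z))" and ?y = "cmod (\<phi> (snd z))" and ?g = "gauss_kernel s (fst z - snd z)"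
    have g: "0 \<le> ?g" by (rule gauss_kernel_nonneg[OF s])
    have "norm (complex_of_real ?g * ?P z) = ?g * (?x * ?y)" using g by (simp add: norm_mult)
    also have "\<dots> \<le> ?g * (1/2 * (?x\<^sup>2 + ?y\<^sup>2))"
      using g sum_squares_bound[of ?x ?y] by (intro mult_left_mono) auto
    also have "\<dots> = 1/2 * (?x\<^sup>2 * ?g + ?y\<^sup>2 * ?g)" by (simp add: algebra_simps)
    finally have "norm (complex_of_real ?g * ?P z) \<le> 1/2 * (?x\<^sup>2 * ?g + ?y\<^sup>2 * ?g)" .
    moreover have e: "ennreal c * (ennreal a * ennreal g + ennreal b * ennreal g) = ennreal (c * (a * g + b * g))"
      if "0 \<le> c" "0 \<le> a" "0 \<le> b" "0 \<le> g" for a b c g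
      using that by (simp add: ennreal_mult)
    ultimately show "ennreal (norm (complex_of_real ?g * ?P z)) \<le> ennreal (1/2) * (?a (fst z) * ?G (fst z) (snd z) + ?a (snd z) * ?G (fst z) (snd z))"
      using g by (subst e) (auto intro: ennreal_leI)
  qed
  also have "\<dots> = ennreal (1/2) * ((\<integral>\<^sup>+z. ?a (fst z) * ?G (fst z) (snd z) \<partial>(lborel \<Otimes>\<^sub>M lborel)) +
      (\<integral>\<^sup>+z. ?a (snd z) * ?G (fst z) (snd z) \<partial>(lborel \<Otimes>\<^sub>M lborel)))"
    unfolding lborel_prod[symmetric] using measurable_gauss_kernel[OF s, measurable]
    by (subst nn_integral_cmult, simp) (subst nn_integral_add, auto)
  also have "(\<integral>\<^sup>+z. ?a (fst z) * ?G (fst z) (snd z) \<partial>(lborel \<Otimes>\<^sub>M lborel)) = (\<integral>\<^sup>+p. ?a p \<partial>lborel) * ennreal ((2 * pi) ^ DIM('a))"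
  proof -
    have "(\<integral>\<^sup>+z. ?a (fst z) * ?G (fst z) (snd z) \<partial>(lborel \<Otimes>\<^sub>M lborel)) = (\<integral>\<^sup>+p. \<integral>\<^sup>+q. ?a p * ?G p q \<partial>lborel \<partial>lborel)"
      using measurable_gauss_kernel[OF s, measurable] by (subst lborel.nn_integral_fst[symmetric]) auto
    also have "\<dots> = (\<integral>\<^sup>+p. ?a p * ennreal ((2 * pi) ^ DIM('a)) \<partial>lborel)"
    proof (intro nn_integral_cong)
      fix p :: 'a
      have "(\<integral>\<^sup>+q. ?G p q \<partial>lborel) = ennreal ((2 * pi) ^ DIM('a))"
        using nn_integral_gauss_kernel_shift[OF s, of p] gauss_kernel_minus[OF s, of "p - _"] by simp
      then show "(\<integral>\<^sup>+q. ?a p * ?G p q \<partial>lborel) = ?a p * ennreal ((2 * pi) ^ DIM('a))"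
        using measurable_gauss_kernel[OF s, measurable] by (subst nn_integral_cmult) auto
    qed
    finally show ?thesis by (simp add: nn_integral_multc)
  qed
  also have "(\<integral>\<^sup>+z. ?a (snd z) * ?G (fst z) (snd z) \<partial>(lborel \<Otimes>\<^sub>M lborel)) = (\<integral>\<^sup>+p. ?a p \<partial>lborel) * ennreal ((2 * pi) ^ DIM('a))"
  proof -
    have "(\<integral>\<^sup>+z. ?a (snd z) * ?G (fst z) (snd z) \<partial>(lborel \<Otimes>\<^sub>M lborel)) = (\<integral>\<^sup>+q. \<integral>\<^sup>+p. ?a q * ?G p q \<partial>lborel \<partial>lborel)"
      using measurable_gauss_kernel[OF s, measurable] by (subst lborel_pair.nn_integral_snd[symmetric]) auto
    also have "\<dots> = (\<integral>\<^sup>+q. ?a q * ennreal ((2 * pi) ^ DIM('a)) \<partial>lborel)"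
      using measurable_gauss_kernel[OF s, measurable]
      by (intro nn_integral_cong) (subst nn_integral_cmult, auto simp: nn_integral_gauss_kernel_shift[OF s])
    finally show ?thesis by (simp add: nn_integral_multc)
  qed
  also have "ennreal (1/2) * (i * c + i * c) = c * i" for i c
  proof -
    have "ennreal (1/2) * (i * c + i * c) = (ennreal (1/2) * 2) * (i * c)"
      by (simp add: mult_2[symmetric] mult.assoc)
    also have "ennreal (1/2) * 2 = 1"
    proof -
      have "ennreal (1/2) * ennreal 2 = ennreal (1/2 * 2)" by (rule ennreal_mult[symmetric]) auto
      then show ?thesis unfolding ennreal_numeral by (simp only:) simp
    qed
    finally show ?thesis by (simp add: mult.commute)
  qed
  finally show ?thesis .
qed

text \<open>The bound of \<open>bessel_gauss\<close> does not depend on the width s. Taking s =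
  1/(n+1) and applying Fatou's lemma removes the damping.\<close>

theorem bessel:
  fixes \<phi> :: "'a::euclidean_space \<Rightarrow> complex"
  assumes c: "continuous_on UNIV \<phi>" and v: "vanishes R \<phi>"
  shows "(\<integral>\<^sup>+\<xi>. ennreal ((cmod (fint \<phi> \<xi>))\<^sup>2) \<partial>lborel)
    \<le> ennreal ((2 * pi) ^ DIM('a)) * (\<integral>\<^sup>+p. ennreal ((cmod (\<phi> p))\<^sup>2) \<partial>lborel)"
proof -
  let ?w = "\<lambda>n (\<xi>::'a). exp (- (inverse (real (Suc n)) * norm \<xi>)\<^sup>2 / 2)"
  let ?F = "\<lambda>\<xi>. fint \<phi> \<xi>"
  have m: "(\<lambda>(\<xi>, p). cis (- (p \<bullet> \<xi>)) * \<phi> p) \<in> borel_measurable (borel \<Otimes>\<^sub>M lborel)"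
    unfolding split_beta
    by (subst measurable_cong_sets[OF sets_pair_measure_cong[OF refl sets_lborel] refl])
       (unfold borel_prod, intro borel_measurable_continuous_onI continuous_intros continuous_on_compose2[OF c], auto)
  have [measurable]: "?F \<in> borel_measurable borel"
    by (rule lborel.borel_measurable_lebesgue_integral[OF m])
  have "(\<integral>\<^sup>+\<xi>. ennreal ((cmod (?F \<xi>))\<^sup>2) \<partial>lborel) =
      (\<integral>\<^sup>+\<xi>. liminf (\<lambda>n. ennreal (?w n \<xi> * (cmod (?F \<xi>))\<^sup>2)) \<partial>lborel)"
  proof (intro nn_integral_cong)
    fix \<xi> :: 'a
    have "(\<lambda>n. ?w n \<xi> * (cmod (?F \<xi>))\<^sup>2) \<longlonglongrightarrow> exp (- (0 * norm \<xi>)\<^sup>2 / 2) * (cmod (?F \<xi>))\<^sup>2"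
      by (intro tendsto_intros LIMSEQ_inverse_real_of_nat)  auto
    then have "(\<lambda>n. ennreal (?w n \<xi> * (cmod (?F \<xi>))\<^sup>2)) \<longlonglongrightarrow> ennreal ((cmod (?F \<xi>))\<^sup>2)"
      by (intro tendsto_ennrealI) simp
    then show "ennreal ((cmod (?F \<xi>))\<^sup>2) = liminf (\<lambda>n. ennreal (?w n \<xi> * (cmod (?F \<xi>))\<^sup>2))"
      by (intro lim_imp_Liminf[symmetric]) auto
  qed
  also have "\<dots> \<le> liminf (\<lambda>n. \<integral>\<^sup>+\<xi>. ennreal (?w n \<xi> * (cmod (?F \<xi>))\<^sup>2) \<partial>lborel)"
    by (rule nn_integral_liminf) measurable
  also have "\<dots> \<le> limsup (\<lambda>n. \<integral>\<^sup>+\<xi>. ennreal (?w n \<xi> * (cmod (?F \<xi>))\<^sup>2) \<partial>lborel)"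
    by (rule Liminf_le_Limsup) simp
  also have "\<dots> \<le> ennreal ((2 * pi) ^ DIM('a)) * (\<integral>\<^sup>+p. ennreal ((cmod (\<phi> p))\<^sup>2) \<partial>lborel)"
    by (intro Limsup_bounded always_eventually allI bessel_gauss[OF _ c v]) simp
  finally show ?thesis .
qed

subsection \<open>The structure matrices of a stratified right-type group\<close>

type_synonym 'n gram = "real ^ ('n \<times> 4) ^ ('n \<times> 4)"

lemma omega_wedge_1 [simp]: "omega_wedge A u [P] = (if P = A then u [] else 0)"
  by (simp add: omega_wedge_def)

lemma omega_wedge_2 [simp]:
  "omega_wedge A u [P, Q] = (if P = A then u [Q] else 0) - (if Q = A then u [P] else 0)"
  by (simp add: omega_wedge_def numeral_2_eq_2)

lemma deriv_along_dderiv: "deriv_along V f p = dderiv (V p) f p"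
  by (simp add: deriv_along_def dderiv_def)

lemma symmetric_nth:
  assumes "transpose S = S"
  shows "S $ a $ b = S $ b $ a"
proof -
  have "transpose S $ a $ b = S $ b $ a" by (simp add: transpose_def)
  then show ?thesis using assms by simp
qed

lemma phi_derivative:
  fixes S :: "('n::finite) gram"
  assumes "transpose S = S"
  shows "(phi S has_derivative (\<lambda>v. complex_of_real (2 * (\<Sum>b\<in>UNIV. (\<Sum>a\<in>UNIV. S $ a $ b * x $ a) * v $ b)))) (at x)"
proof -
  note S = symmetric_nth[OF assms]
  have 1: "(\<Sum>a\<in>UNIV. \<Sum>b\<in>UNIV. S $ a $ b * v $ a * x $ b) = (\<Sum>b\<in>UNIV. (\<Sum>a\<in>UNIV. S $ a $ b * x $ a) * v $ b)" for v
    unfolding sum_distrib_right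
  proof (intro sum.cong refl)
    fix a b show "S $ a $ b * v $ a * x $ b = S $ b $ a * x $ b * v $ a"
      unfolding S[of b a] by (simp add: ac_simps)
  qed
  have 2: "(\<Sum>a\<in>UNIV. \<Sum>b\<in>UNIV. S $ a $ b * x $ a * v $ b) = (\<Sum>b\<in>UNIV. (\<Sum>a\<in>UNIV. S $ a $ b * x $ a) * v $ b)" for v
    by (subst sum.swap) (simp add: sum_distrib_right)
  have "((\<lambda>x. \<Sum>a\<in>UNIV. \<Sum>b\<in>UNIV. S $ a $ b * x $ a * x $ b) has_derivative
      (\<lambda>v. \<Sum>a\<in>UNIV. \<Sum>b\<in>UNIV. S $ a $ b * x $ a * v $ b + S $ a $ b * v $ a * x $ b)) (at x)"
    by (intro has_derivative_sum has_derivative_mult[OF has_derivative_mult_right]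
        bounded_linear_imp_has_derivative bounded_linear_vec_nth)
  then have "((\<lambda>x. \<Sum>a\<in>UNIV. \<Sum>b\<in>UNIV. S $ a $ b * x $ a * x $ b) has_derivative
      (\<lambda>v. 2 * (\<Sum>b\<in>UNIV. (\<Sum>a\<in>UNIV. S $ a $ b * x $ a) * v $ b))) (at x)"
    unfolding sum.distrib 1 2 mult_2[symmetric] .
  then show ?thesis unfolding phi_def[abs_def] by (rule has_derivative_of_real)
qed

lemma axis_sum: "(\<Sum>c\<in>UNIV. g c * axis b 1 $ c) = (g b :: real)"
  by (simp add: axis_def if_distrib[of "\<lambda>x. _ * x"] cong: if_cong)

lemma double_delta:
  fixes g :: "'a::finite \<Rightarrow> 'b::finite \<Rightarrow> complex"
  shows "(\<Sum>A\<in>UNIV. \<Sum>B\<in>UNIV. g A B * (if P = A then if Q = B then 1 else 0 else 0)) = g P Q"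
proof -
  have "(\<Sum>B\<in>UNIV. g A B * (if P = A then if Q = B then 1 else 0 else 0)) = (if P = A then g A Q else 0)" for A
    by (cases "P = A") (simp_all add: if_distrib[of "\<lambda>x. _ * x"] cong: if_cong)
  then show ?thesis by simp
qed

lemma E_form_2:
  "E_form S x [P, Q] = nabla P 0 (nabla Q 1 (phi S)) x - nabla Q 0 (nabla P 1 (phi S)) x"
proof -
  have "E_form S x [P, Q] = (\<Sum>A\<in>UNIV. \<Sum>B\<in>UNIV. nabla A 0 (nabla B 1 (phi S)) x *
     ((if P = A then if Q = B then 1 else 0 else 0) - (if Q = A then if P = B then 1 else 0 else 0)))"
    unfolding E_form_def omega_wedge_2 omega_wedge_1 one_form0_def by simp
  then show ?thesis by (simp only: right_diff_distrib sum_subtractf double_delta)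
qed

text \<open>The coefficient of \<open>\<omega>\<^sup>2\<^sup>l \<and> \<omega>\<^sup>2\<^sup>l\<^sup>+\<^sup>1\<close> in \<open>E_form\<close> is the Laplacian of \<open>phi\<close> in the \<open>l\<close>-th quaternionic variable.\<close>

lemma right_type_block_trace:
  fixes S :: "('n::finite) gram"
  assumes S: "transpose S = S" and r: "right_type S"
  shows "S $ (l, 1) $ (l, 1) + S $ (l, 2) $ (l, 2) + S $ (l, 3) $ (l, 3) + S $ (l, 4) $ (l, 4) = 0"
proof -
  define m where "m b x = 2 * (\<Sum>a\<in>UNIV. S $ a $ b * x $ a)" for b and x :: "real ^ ('n \<times> 4)"
  note sym = symmetric_nth[OF S]
  have lin: "linear (m b)" for b
    by (rule linearI) (simp_all add: m_def algebra_simps sum.distrib sum_distrib_left)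
  have m_axis: "m b (axis c 1) = 2 * S $ b $ c" for b c
    by (simp add: m_def axis_sum sym)
  have p: "dderiv (axis b 1) (phi S) x = complex_of_real (m b x)" for b x
    using dderiv_eqI[OF phi_derivative[OF S], of "axis b 1" x] by (simp add: axis_sum m_def)
  have q: "dderiv v (\<lambda>x. c * complex_of_real (m b x) + d * complex_of_real (m b' x)) x =
      c * complex_of_real (m b v) + d * complex_of_real (m b' v)" for c d b b' v x
    by (simp add: dderiv_add dderiv_cmult cdiff1_cmult cdiff1_linear lin dderiv_linear)
  have n1: "nabla (l, 1) 1 (phi S) = (\<lambda>x. (-1) * complex_of_real (m (l, 3) x) + \<i> * complex_of_real (m (l, 4) x))"
    by (simp add: fun_eq_iff nabla_def spinor_op_def deriv_along_dderiv p)
  have n2: "nabla (l, 0) 1 (phi S) = (\<lambda>x. (-1) * complex_of_real (m (l, 1) x) + (-\<i>) * complex_of_real (m (l, 2) x))"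
    by (simp add: fun_eq_iff nabla_def spinor_op_def deriv_along_dderiv p)
  \<comment> \<open>\<open>phi S\<close> is quadratic, so its second derivatives are constant and
    the base point 0 suffices. The mixed entries at (1, 2) and (3, 4) cancel by symmetry of
    \<open>S\<close>.\<close>
  have "0 = E_form S 0 [(l, 0), (l, 1)]" using r by (simp add: right_type_def)
  also have "\<dots> = nabla (l, 0) 0 (nabla (l, 1) 1 (phi S)) 0 - nabla (l, 1) 0 (nabla (l, 0) 1 (phi S)) 0"
    by (rule E_form_2)
  also have "\<dots> = 2 * complex_of_real (S $ (l, 1) $ (l, 1) + S $ (l, 2) $ (l, 2) + S $ (l, 3) $ (l, 3) + S $ (l, 4) $ (l, 4))"
    unfolding n1 n2 unfolding nabla_def spinor_op_def deriv_along_dderiv Let_def q m_axis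
    by (simp add: algebra_simps sym[of "(l, 4)" "(l, 3)"] sym[of "(l, 2)" "(l, 1)"])
  finally show ?thesis by (simp flip: of_real_add)
qed

lemma I4_skew: "I4 \<beta> $ i $ j = - I4 \<beta> $ j $ i"
proof -
  have "skew_unit p q $ i $ j = - skew_unit p q $ j $ i" for p q
    by (simp add: skew_unit_def conj_commute)
  then show ?thesis by (simp add: I4_def)
qed

lemma sum_UNIV_prod: "(\<Sum>k\<in>UNIV. f k) = (\<Sum>a\<in>UNIV. \<Sum>b\<in>UNIV. f (a, b))"
  unfolding UNIV_Times_UNIV[symmetric] sum.cartesian_product by (simp add: split_beta)

text \<open>\<open>II \<beta>\<close> is block diagonal, so each 4 x 4 block of
  \<open>Bmat S \<beta>\<close> depends on the corresponding block of \<open>S\<close>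
  alone.\<close>

lemma Bmat_nth:
  "Bmat S \<beta> $ (l, i) $ (m, j) =
     (\<Sum>p\<in>UNIV. S $ (l, i) $ (m, p) * I4 \<beta> $ p $ j) + (\<Sum>p\<in>UNIV. I4 \<beta> $ i $ p * S $ (l, p) $ (m, j))"
proof -
  have "(\<Sum>k\<in>UNIV. S $ (l, i) $ k * II \<beta> $ k $ (m, j)) =
     (\<Sum>k\<in>UNIV. \<Sum>p\<in>UNIV. if k = m then S $ (l, i) $ (k, p) * I4 \<beta> $ p $ j else 0)"
    unfolding sum_UNIV_prod by (simp add: II_def if_distrib cong: if_cong)
  also have "\<dots> = (\<Sum>p\<in>UNIV. S $ (l, i) $ (m, p) * I4 \<beta> $ p $ j)"
    by (subst sum.swap) simp
  moreover have "(\<Sum>k\<in>UNIV. II \<beta> $ (l, i) $ k * S $ k $ (m, j)) =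
     (\<Sum>k\<in>UNIV. \<Sum>p\<in>UNIV. if k = l then I4 \<beta> $ i $ p * S $ (k, p) $ (m, j) else 0)"
    unfolding sum_UNIV_prod by (simp add: II_def if_distrib if_distribR eq_commute cong: if_cong)
  moreover have "\<dots> = (\<Sum>p\<in>UNIV. I4 \<beta> $ i $ p * S $ (l, p) $ (m, j))"
    by (subst sum.swap) simp
  ultimately show ?thesis by (simp add: Bmat_def matrix_matrix_mult_def)
qed

lemma Bmat_skew:
  assumes "transpose S = S"
  shows "Bmat S \<beta> $ a $ b = - Bmat S \<beta> $ b $ a"
proof -
  note S = symmetric_nth[OF assms]
  obtain l i m j where ab: "a = (l, i)" "b = (m, j)" by (cases a, cases b) auto
  show ?thesis unfolding ab Bmat_nth
    by (simp add: S[of "(m, _)" "(l, _)"] I4_skew[of \<beta> _ j] I4_skew[of \<beta> _ i] sum_negf mult.commute)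
qed

text \<open>Orthogonality of a diagonal block to I^1, I^2 and I^3 in turn, spelled out in entries.
  Skewness reduces each trace pairing to one entry above the diagonal and its complementary
  one.\<close>

lemma
  assumes S: "transpose S = S" and r: "right_type S"
  shows Bmat_block1: "Bmat S \<beta> $ (l, 1) $ (l, 2) = Bmat S \<beta> $ (l, 3) $ (l, 4)"
    and Bmat_block2: "Bmat S \<beta> $ (l, 1) $ (l, 3) = - Bmat S \<beta> $ (l, 2) $ (l, 4)"
    and Bmat_block3: "Bmat S \<beta> $ (l, 1) $ (l, 4) = Bmat S \<beta> $ (l, 2) $ (l, 3)"
proof -
  note sym = symmetric_nth[OF S]
  note s = sym[of "(l, 2)" "(l, 1)"] sym[of "(l, 3)" "(l, 1)"] sym[of "(l, 4)" "(l, 1)"]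
    sym[of "(l, 3)" "(l, 2)"] sym[of "(l, 4)" "(l, 2)"] sym[of "(l, 4)" "(l, 3)"]
  have "\<forall>\<beta>::3. Bmat S \<beta> $ (l, 1) $ (l, 2) = Bmat S \<beta> $ (l, 3) $ (l, 4) \<and>
     Bmat S \<beta> $ (l, 1) $ (l, 3) = - Bmat S \<beta> $ (l, 2) $ (l, 4) \<and>
     Bmat S \<beta> $ (l, 1) $ (l, 4) = Bmat S \<beta> $ (l, 2) $ (l, 3)"
    unfolding forall_3 Bmat_nth sum_4 I4_def skew_unit_def
    using right_type_block_trace[OF S r, of l] s by simp
  then show "Bmat S \<beta> $ (l, 1) $ (l, 2) = Bmat S \<beta> $ (l, 3) $ (l, 4)"
    and "Bmat S \<beta> $ (l, 1) $ (l, 3) = - Bmat S \<beta> $ (l, 2) $ (l, 4)"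
    and "Bmat S \<beta> $ (l, 1) $ (l, 4) = Bmat S \<beta> $ (l, 2) $ (l, 3)" by auto
qed

section \<open>Horizontal left invariant fields and the bracket form\<close>

lemma X_eq: "X S b p = (axis b 1, \<chi> \<beta>. 2 * (\<Sum>a\<in>UNIV. Bmat S \<beta> $ a $ b * fst p $ a))"
proof -
  have "(\<Sum>\<beta>\<in>UNIV. g \<beta> * axis \<beta> 1 $ i) = g i" for g :: "3 \<Rightarrow> real" and i
    by (simp add: axis_def if_distrib[of "\<lambda>x. _ * x"] cong: if_cong)
  then show ?thesis
    by (simp add: X_def dx_def dt_def prod_eq_iff vec_eq_iff fst_sum snd_sum)
qed

text \<open>The left invariant field with value \<open>(v, 0)\<close> at the identity;
  \<open>v\<close> is the vector of coefficients with respect to the X_b.\<close>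

definition hor_field :: "('n::finite) gram \<Rightarrow> real ^ ('n \<times> 4) \<Rightarrow> 'n grp \<Rightarrow> 'n grp" where
  "hor_field S v p = (v, \<chi> \<beta>. 2 * (\<Sum>a\<in>UNIV. \<Sum>b\<in>UNIV. Bmat S \<beta> $ a $ b * fst p $ a * v $ b))"

lemma hor_field_axis: "hor_field S (axis b 1) = X S b"
  by (simp add: fun_eq_iff hor_field_def X_eq axis_sum)

lemma hor_field_linear: "hor_field S (c *\<^sub>R u + v) p = c *\<^sub>R hor_field S u p + hor_field S v p"
  by (simp add: hor_field_def prod_eq_iff vec_eq_iff algebra_simps sum.distrib sum_distrib_left)

lemma g1_hor_field:
  assumes "V \<in> g1 S"
  obtains v where "V = hor_field S v"
proof -
  from assms obtain c G where V: "V = (\<lambda>p. \<Sum>W\<in>G. c W *\<^sub>R W p)" and G: "finite G" "G \<subseteq> range (X S)"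
    by (auto simp: g1_def field_span_def)
  from G have "\<exists>v. \<forall>p. (\<Sum>W\<in>G. c W *\<^sub>R W p) = hor_field S v p"
  proof (induction G rule: finite_induct)
    case empty
    show ?case by (rule exI[of _ 0]) (simp add: hor_field_def prod_eq_iff vec_eq_iff)
  next
    case (insert W G)
    then obtain v b where v: "\<forall>p. (\<Sum>W\<in>G. c W *\<^sub>R W p) = hor_field S v p" and W: "W = X S b" by auto
    show ?case
      by (rule exI[of _ "c W *\<^sub>R axis b 1 + v"])
         (use insert.hyps v in \<open>simp add: hor_field_linear W hor_field_axis\<close>)
  qed
  then obtain v where "\<forall>p. (\<Sum>W\<in>G. c W *\<^sub>R W p) = hor_field S v p" ..
  then have "V = hor_field S v" unfolding V by (intro ext) (erule spec)
  then show ?thesis by (rule that)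
qed

lemma hor_field_derivative:
  "(hor_field S v has_derivative (\<lambda>u. (0, \<chi> \<beta>. 2 * (\<Sum>a\<in>UNIV. \<Sum>b\<in>UNIV. Bmat S \<beta> $ a $ b * fst u $ a * v $ b)))) (at p)"
proof -
  have "linear (\<lambda>u. (0 :: real ^ ('a \<times> 4), \<chi> \<beta>. 2 * (\<Sum>a\<in>UNIV. \<Sum>b\<in>UNIV. Bmat S \<beta> $ a $ b * fst u $ a * v $ b)))"
    by (rule linearI) (simp_all add: prod_eq_iff vec_eq_iff algebra_simps sum.distrib sum_distrib_left)
  then have "((\<lambda>u. (v, 0) + (0 :: real ^ ('a \<times> 4), \<chi> \<beta>. 2 * (\<Sum>a\<in>UNIV. \<Sum>b\<in>UNIV. Bmat S \<beta> $ a $ b * fst u $ a * v $ b))) has_derivative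
     (\<lambda>u. 0 + (0, \<chi> \<beta>. 2 * (\<Sum>a\<in>UNIV. \<Sum>b\<in>UNIV. Bmat S \<beta> $ a $ b * fst u $ a * v $ b)))) (at p)"
    by (intro has_derivative_add has_derivative_const linear_imp_has_derivative)
  moreover have "(\<lambda>u. (v, 0) + (0 :: real ^ ('a \<times> 4), \<chi> \<beta>. 2 * (\<Sum>a\<in>UNIV. \<Sum>b\<in>UNIV. Bmat S \<beta> $ a $ b * fst u $ a * v $ b))) = hor_field S v"
    by (auto simp: hor_field_def fun_eq_iff)
  ultimately show ?thesis by simp
qed

text \<open>The skew form through which brackets of horizontal fields act once the central variable
  has dual variable \<tau>.\<close>

definition Bmat_comb :: "('n::finite) gram \<Rightarrow> real ^ 3 \<Rightarrow> real ^ ('n \<times> 4) ^ ('n \<times> 4)" where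
  "Bmat_comb S \<tau> = (\<chi> a b. \<Sum>\<beta>\<in>UNIV. \<tau> $ \<beta> * Bmat S \<beta> $ a $ b)"

text \<open>If the combined form vanishes, \<tau> annihilates the central part of every bracket of
  horizontal fields. Stratification makes each central coordinate field a combination of such
  brackets, so every coordinate of \<tau> is 0.\<close>

lemma stratified_Bmat_comb_nonzero:
  assumes st: "stratified S" and B: "Bmat_comb S \<tau> = 0"
  shows "\<tau> = 0"
proof -
  have Bz: "(\<Sum>\<beta>\<in>UNIV. \<tau> $ \<beta> * Bmat S \<beta> $ a $ b) = 0" for a b
  proof -
    have "Bmat_comb S \<tau> $ a $ b = 0" by (simp add: B)
    then show ?thesis by (simp add: Bmat_comb_def)
  qed
  have Bz': "(\<Sum>\<beta>\<in>UNIV. \<tau> $ \<beta> * (\<Sum>a\<in>UNIV. \<Sum>b\<in>UNIV. Bmat S \<beta> $ a $ b * x $ a * y $ b)) = 0" for x y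
  proof -
    have "(\<Sum>\<beta>\<in>UNIV. \<tau> $ \<beta> * (\<Sum>a\<in>UNIV. \<Sum>b\<in>UNIV. Bmat S \<beta> $ a $ b * x $ a * y $ b)) =
       (\<Sum>a\<in>UNIV. \<Sum>b\<in>UNIV. (\<Sum>\<beta>\<in>UNIV. \<tau> $ \<beta> * Bmat S \<beta> $ a $ b) * (x $ a * y $ b))"
      unfolding sum_distrib_left sum_distrib_right
      by (subst sum.swap, rule sum.cong[OF refl], subst sum.swap) (simp add: mult.assoc)
    then show ?thesis by (simp add: Bz)
  qed
  have br: "\<tau> \<bullet> snd (lie_bracket V W p) = 0" if VW: "V \<in> g1 S" "W \<in> g1 S" for V W p
  proof -
    obtain v w where v: "V = hor_field S v" and w: "W = hor_field S w" using VW g1_hor_field by metis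
    show ?thesis
      unfolding lie_bracket_def v w frechet_derivative_at[OF hor_field_derivative, symmetric]
      by (simp add: inner_vec_def right_diff_distrib sum_subtractf hor_field_def mult.left_commute[of _ 2] sum_distrib_left[symmetric] Bz')
  qed
  have "\<tau> $ \<beta> = 0" for \<beta>
  proof -
    have "dt \<beta> \<in> g2" unfolding g2_def field_span_def
      by (rule CollectI, rule exI[of _ "\<lambda>_. 1"], rule exI[of _ "{dt \<beta>}"]) auto
    then have "dt \<beta> \<in> field_span {lie_bracket V W | V W. V \<in> g1 S \<and> W \<in> g1 S}"
      using st by (simp add: stratified_def)
    then obtain c G where e: "dt \<beta> = (\<lambda>p. \<Sum>V\<in>G. c V *\<^sub>R V p)" 
      and G: "G \<subseteq> {lie_bracket V W | V W. V \<in> g1 S \<and> W \<in> g1 S}" by (auto simp: field_span_def)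
    have "\<tau> $ \<beta> = \<tau> \<bullet> snd (dt \<beta> 0 :: 'a grp)" by (simp add: dt_def inner_axis)
    also have "\<dots> = (\<Sum>V\<in>G. c V * (\<tau> \<bullet> snd (V 0)))" by (simp add: e snd_sum inner_sum_right)
    also have "\<dots> = 0"
    proof (rule sum.neutral, rule ballI)
      fix V assume "V \<in> G"
      with G obtain U W where "V = lie_bracket U W" "U \<in> g1 S" "W \<in> g1 S" by auto
      then show "c V * (\<tau> \<bullet> snd (V 0)) = 0" by (simp add: br)
    qed
    finally show ?thesis .
  qed
  then show ?thesis by (simp add: vec_eq_iff)
qed

lemma vec_norm_le_sum: "norm (x :: 'a::real_normed_vector ^ 'n) \<le> (\<Sum>i\<in>UNIV. norm (x $ i))"
  unfolding norm_vec_def by (rule L2_set_le_sum) simp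

text \<open>An injective linear map on a finite-dimensional space is bounded below, which makes the
  constant uniform in \<tau>. The size is measured by the sum of the entries because
  \<open>uncertainty\<close> treats one entry at a time.\<close>

lemma stratified_lower_bound:
  fixes S :: "('n::finite) gram"
  assumes st: "stratified S"
  obtains c where "c > 0" "\<And>\<tau>. c * norm \<tau> \<le> (\<Sum>a\<in>UNIV. \<Sum>b\<in>UNIV. \<bar>Bmat_comb S \<tau> $ a $ b\<bar>)"
proof -
  have lin: "linear (Bmat_comb S)"
    by (rule linearI) (simp_all add: Bmat_comb_def vec_eq_iff algebra_simps sum.distrib sum_distrib_left)
  have "inj (Bmat_comb S)"
    unfolding linear_injective_0[OF lin] using stratified_Bmat_comb_nonzero[OF st] by blast
  then obtain c where c: "c > 0" "\<And>\<tau>. c * norm \<tau> \<le> norm (Bmat_comb S \<tau>)"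
    using linear_inj_bounded_below_pos[OF lin] by metis
  have "norm (Bmat_comb S \<tau>) \<le> (\<Sum>a\<in>UNIV. \<Sum>b\<in>UNIV. \<bar>Bmat_comb S \<tau> $ a $ b\<bar>)" for \<tau>
    by (rule order_trans[OF vec_norm_le_sum]) (intro sum_mono norm_le_l1_cart)
  with c that show ?thesis by (meson order_trans)
qed

subsection \<open>Horizontal derivatives and the energy identity\<close>

definition hor :: "('n::finite) gram \<Rightarrow> 'n \<times> 4 \<Rightarrow> ('n grp \<Rightarrow> complex) \<Rightarrow> 'n grp \<Rightarrow> complex" where
  "hor S b f p = dderiv (X S b p) f p"

text \<open>The coefficient of the \<beta>-th central derivative in X_b. It is linear in x and
  independent of t, which yields both the constant commutators and the vanishing divergence of
  X_b.\<close>

definition hor_coeff :: "('n::finite) gram \<Rightarrow> 3 \<Rightarrow> 'n \<times> 4 \<Rightarrow> real ^ ('n \<times> 4) \<Rightarrow> real" where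
  "hor_coeff S \<beta> b x = 2 * (\<Sum>a\<in>UNIV. Bmat S \<beta> $ a $ b * x $ a)"

abbreviation e_x :: "('n::finite \<times> 4) \<Rightarrow> 'n grp" where "e_x b \<equiv> (axis b 1, 0)"
abbreviation e_t :: "3 \<Rightarrow> ('n::finite) grp" where "e_t \<beta> \<equiv> (0, axis \<beta> 1)"

lemma X_decomp: "X S b p = e_x b + (\<Sum>\<beta>\<in>UNIV. hor_coeff S \<beta> b (fst p) *\<^sub>R e_t \<beta>)"
  by (simp add: X_def dx_def dt_def hor_coeff_def)

lemma dderiv_X: "cdiff1 f \<Longrightarrow> dderiv (X S b p) f q = dderiv (e_x b) f q + (\<Sum>\<beta>\<in>UNIV. of_real (hor_coeff S \<beta> b (fst p)) * dderiv (e_t \<beta>) f q)"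
  by (simp only: X_decomp dderiv_add_dir dderiv_sum_dir)

lemma hor_eq: "cdiff1 f \<Longrightarrow> hor S b f = (\<lambda>p. dderiv (e_x b) f p + (\<Sum>\<beta>\<in>UNIV. of_real (hor_coeff S \<beta> b (fst p)) * dderiv (e_t \<beta>) f p))"
  by (rule ext) (simp only: hor_def dderiv_X)

lemma linear_hor_coeff: "linear (\<lambda>p :: ('n::finite) grp. hor_coeff S \<beta> b (fst p))"
  by (rule linearI) (simp_all add: hor_coeff_def algebra_simps sum.distrib sum_distrib_left)

lemma cdiff1_hor_coeff: "cdiff1 (\<lambda>p :: ('n::finite) grp. complex_of_real (hor_coeff S \<beta> b (fst p)))"
  by (rule cdiff1_linear[OF linear_hor_coeff])

lemma dderiv_hor_coeff: "dderiv v (\<lambda>p :: ('n::finite) grp. complex_of_real (hor_coeff S \<beta> b (fst p))) p = complex_of_real (hor_coeff S \<beta> b (fst v))"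
  by (rule dderiv_linear[OF linear_hor_coeff])

lemma hor_coeff_axis: "hor_coeff S \<beta> b (axis a 1) = 2 * Bmat S \<beta> $ a $ b"
  by (simp add: hor_coeff_def axis_sum)

lemma hor_coeff_0: "hor_coeff S \<beta> b 0 = 0"
  by (simp add: hor_coeff_def)

lemma cdiff1_hor: "cdiff2 f \<Longrightarrow> cdiff1 (hor S b f)"
  unfolding hor_eq[OF cdiff2_cdiff1] by (intro cdiff1_add cdiff1_sum cdiff1_mult cdiff1_hor_coeff cdiff2_cdiff1_dderiv)

lemma continuous_hor: "cdiff1 f \<Longrightarrow> continuous_on UNIV (hor S b f)"
  unfolding hor_eq by (intro continuous_on_add continuous_on_sum continuous_on_mult cdiff1_cont[OF cdiff1_hor_coeff] cdiff1_cont_dderiv)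

lemma vanishes_hor:
  assumes "cdiff1 f" "vanishes R f"
  shows "vanishes R (hor S b f)"
  using vanishes_dderiv[OF assms] by (simp add: vanishes_def hor_def)

lemma hor_add: "cdiff1 f \<Longrightarrow> cdiff1 g \<Longrightarrow> hor S b (\<lambda>p. f p + g p) p = hor S b f p + hor S b g p"
  unfolding hor_def by (rule dderiv_add)

lemma hor_cmult: "cdiff1 f \<Longrightarrow> hor S b (\<lambda>p. c * f p) p = c * hor S b f p"
  unfolding hor_def by (rule dderiv_cmult)

lemma hor_mult: "cdiff1 f \<Longrightarrow> cdiff1 g \<Longrightarrow> hor S b (\<lambda>p. f p * g p) p = f p * hor S b g p + hor S b f p * g p"
  unfolding hor_def by (rule dderiv_mult)

lemma hor_cnj: "cdiff1 f \<Longrightarrow> hor S b (\<lambda>p. cnj (f p)) p = cnj (hor S b f p)"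
  unfolding hor_def by (rule dderiv_cnj)

text \<open>The first term freezes the coefficients of X_b at p; the sum comes from X_a acting on
  these coefficients, whose derivative along X_a is 2 B_ab.\<close>

lemma hor_hor:
  fixes S :: "('n::finite) gram"
  assumes f: "cdiff2 f"
  shows "hor S a (hor S b f) p = dderiv (X S a p) (dderiv (X S b p) f) p + (\<Sum>\<beta>\<in>UNIV. of_real (2 * Bmat S \<beta> $ a $ b) * dderiv (e_t \<beta>) f p)"
proof -
  have f1: "cdiff1 f" using f by (rule cdiff2_cdiff1)
  have f2: "cdiff1 (dderiv v f)" for v using f by (rule cdiff2_cdiff1_dderiv)
  have "hor S a (hor S b f) p = dderiv (X S a p) (dderiv (e_x b) f) p +
      (\<Sum>\<beta>\<in>UNIV. of_real (hor_coeff S \<beta> b (fst p)) * dderiv (X S a p) (dderiv (e_t \<beta>) f) p + of_real (2 * Bmat S \<beta> $ a $ b) * dderiv (e_t \<beta>) f p)"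
    unfolding hor_def[of S a] hor_eq[OF f1]
    by (simp add: dderiv_add dderiv_sum dderiv_mult cdiff1_sum cdiff1_mult cdiff1_hor_coeff f2 dderiv_hor_coeff X_eq hor_coeff_axis)
  also have "\<dots> = dderiv (X S a p) (\<lambda>q. dderiv (e_x b) f q + (\<Sum>\<beta>\<in>UNIV. of_real (hor_coeff S \<beta> b (fst p)) * dderiv (e_t \<beta>) f q)) p
      + (\<Sum>\<beta>\<in>UNIV. of_real (2 * Bmat S \<beta> $ a $ b) * dderiv (e_t \<beta>) f p)"
    by (simp add: dderiv_add dderiv_sum dderiv_cmult cdiff1_sum cdiff1_cmult f2 sum.distrib)
  also have "(\<lambda>q. dderiv (e_x b) f q + (\<Sum>\<beta>\<in>UNIV. of_real (hor_coeff S \<beta> b (fst p)) * dderiv (e_t \<beta>) f q)) = dderiv (X S b p) f"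
    by (simp add: fun_eq_iff dderiv_X[OF f1])
  finally show ?thesis .
qed

lemma hor_commutator:
  fixes S :: "('n::finite) gram"
  assumes f: "cdiff2 f" and S: "transpose S = S"
  shows "hor S a (hor S b f) p - hor S b (hor S a f) p = (\<Sum>\<beta>\<in>UNIV. of_real (4 * Bmat S \<beta> $ a $ b) * dderiv (e_t \<beta>) f p)"
  unfolding hor_hor[OF f] dderiv_commute[OF f, of "X S b p"] Bmat_skew[OF S, of _ b a]
  by (simp add: sum_negf sum.distrib[symmetric] algebra_simps)

text \<open>X_b is divergence free: its central coefficients depend on x only, so they may be moved
  inside the derivatives in t, leaving derivatives of compactly supported functions.\<close>

lemma integral_hor:
  assumes f: "cdiff1 f" and v: "vanishes R f"
  shows "(LINT p|lborel. hor S b f p) = 0"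
proof -
  have m: "cdiff1 (\<lambda>p. of_real (hor_coeff S \<beta> b (fst p)) * f p)" "vanishes R (\<lambda>p. of_real (hor_coeff S \<beta> b (fst p)) * f p)" for \<beta>
    using v by (auto intro: cdiff1_mult cdiff1_hor_coeff f simp: vanishes_def)
  have e: "hor S b f p = dderiv (e_x b) f p + (\<Sum>\<beta>\<in>UNIV. dderiv (e_t \<beta>) (\<lambda>p. of_real (hor_coeff S \<beta> b (fst p)) * f p) p)" for p
    by (simp add: hor_eq f dderiv_mult cdiff1_hor_coeff dderiv_hor_coeff hor_coeff_0)
  have i: "integrable lborel (dderiv w g)" if "cdiff1 g" "vanishes R g" for w g
    using that by (intro integrable_vanishes[OF cdiff1_cont_dderiv vanishes_dderiv])
  have "(LINT p|lborel. hor S b f p) = (LINT p|lborel. dderiv (e_x b) f p) +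
      (LINT p|lborel. (\<Sum>\<beta>\<in>UNIV. dderiv (e_t \<beta>) (\<lambda>p. of_real (hor_coeff S \<beta> b (fst p)) * f p) p))"
    unfolding e by (intro lebesgue_add Bochner_Integration.integrable_sum i f v m)
  also have "\<dots> = (LINT p|lborel. dderiv (e_x b) f p) + (\<Sum>\<beta>\<in>UNIV. LINT p|lborel. dderiv (e_t \<beta>) (\<lambda>p. of_real (hor_coeff S \<beta> b (fst p)) * f p) p)"
    by (subst lebesgue_sum) (auto intro: i m)
  also have "\<dots> = 0" by (simp only: integral_dderiv[OF f v] integral_dderiv[OF m] sum.neutral_const add_0)
  finally show ?thesis .
qed

lemma vanishes_mult: "vanishes R f \<Longrightarrow> vanishes R (\<lambda>p. f p * g p)"
  by (simp add: vanishes_def)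

lemma integrable_mult_vanishes:
  fixes f g :: "'a::euclidean_space \<Rightarrow> complex"
  shows "continuous_on UNIV f \<Longrightarrow> continuous_on UNIV g \<Longrightarrow> vanishes R f \<Longrightarrow> integrable lborel (\<lambda>p. f p * g p)"
  by (intro integrable_vanishes[where R=R] continuous_on_mult vanishes_mult)

lemma hor_by_parts:
  assumes f: "cdiff1 f" "vanishes R f" and g: "cdiff1 g"
  shows "(LINT p|lborel. hor S b f p * g p) = - (LINT p|lborel. f p * hor S b g p)"
proof -
  have "0 = (LINT p|lborel. hor S b (\<lambda>p. f p * g p) p)"
    by (rule integral_hor[symmetric]) (use f g in \<open>auto intro: cdiff1_mult vanishes_mult\<close>)
  also have "\<dots> = (LINT p|lborel. f p * hor S b g p) + (LINT p|lborel. hor S b f p * g p)"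
    unfolding hor_mult[OF f(1) g]
    by (intro lebesgue_add integrable_mult_vanishes[where R=R] continuous_hor vanishes_hor cdiff1_cont f g)
  finally show ?thesis by (simp add: eq_neg_iff_add_eq_0 add.commute)
qed

text \<open>The shape of the cross terms when the squares of the Z-combinations are expanded, one
  argument then being a conjugate. Integration by parts turns its integral into a pairing with a
  commutator.\<close>

definition wronskian where
  "wronskian S a b g h p = hor S a g p * hor S b h p - hor S b g p * hor S a h p"

lemma integrable_wronskian:
  assumes "cdiff1 g" "cdiff1 h" "vanishes R g"
  shows "integrable lborel (wronskian S a b g h)"
  unfolding wronskian_def[abs_def] using assms
  by (intro lebesgue_intros integrable_mult_vanishes[where R=R] continuous_hor vanishes_hor)

lemma integral_wronskian:
  fixes S :: "('n::finite) gram"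
  assumes S: "transpose S = S" and g: "cdiff1 g" "vanishes R g" and h: "cdiff2 h"
  shows "(LINT p|lborel. wronskian S a b g h p) = - (\<Sum>\<beta>\<in>UNIV. of_real (4 * Bmat S \<beta> $ a $ b) * (LINT p|lborel. g p * dderiv (e_t \<beta>) h p))"
proof -
  note c = continuous_hor vanishes_hor cdiff1_cont cdiff1_hor cdiff2_cdiff1
  have "(LINT p|lborel. wronskian S a b g h p) = (LINT p|lborel. hor S a g p * hor S b h p) - (LINT p|lborel. hor S b g p * hor S a h p)"
    unfolding wronskian_def by (intro lebesgue_diff integrable_mult_vanishes[where R=R] c g h)
  also have "\<dots> = - ((LINT p|lborel. g p * hor S a (hor S b h) p) - (LINT p|lborel. g p * hor S b (hor S a h) p))"
    unfolding hor_by_parts[OF g cdiff1_hor[OF h]] by simp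
  also have "(LINT p|lborel. g p * hor S a (hor S b h) p) - (LINT p|lborel. g p * hor S b (hor S a h) p) =
      (LINT p|lborel. g p * hor S a (hor S b h) p - g p * hor S b (hor S a h) p)"
    by (intro lebesgue_diff[symmetric] integrable_mult_vanishes[where R=R] c g h)
  also have "\<dots> = (LINT p|lborel. (\<Sum>\<beta>\<in>UNIV. of_real (4 * Bmat S \<beta> $ a $ b) * (g p * dderiv (e_t \<beta>) h p)))"
    unfolding right_diff_distrib[symmetric] hor_commutator[OF h S] by (simp add: sum_distrib_left ac_simps)
  also have "\<dots> = (\<Sum>\<beta>\<in>UNIV. LINT p|lborel. of_real (4 * Bmat S \<beta> $ a $ b) * (g p * dderiv (e_t \<beta>) h p))"
    by (intro lebesgue_sum Bochner_Integration.integrable_mult_right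
        integrable_mult_vanishes[where R=R] cdiff1_cont_dderiv cdiff1_cont cdiff2_cdiff1 g h)
  also have "\<dots> = (\<Sum>\<beta>\<in>UNIV. of_real (4 * Bmat S \<beta> $ a $ b) * (LINT p|lborel. g p * dderiv (e_t \<beta>) h p))"
    by simp
  finally show ?thesis .
qed

definition energy :: "('n::finite) gram \<Rightarrow> ('n grp \<Rightarrow> complex) \<Rightarrow> real" where
  "energy S f = (\<Sum>b\<in>UNIV. LINT p|lborel. (cmod (hor S b f p))\<^sup>2)"

lemma cdiff2_cnj: "cdiff2 f \<Longrightarrow> cdiff2 (\<lambda>p. cnj (f p))"
proof -
  assume f: "cdiff2 f"
  have "dderiv v (\<lambda>p. cnj (f p)) = (\<lambda>p. cnj (dderiv v f p))" for v using dderiv_cnj[OF cdiff2_cdiff1[OF f]] by auto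
  then show ?thesis using f by (simp add: cdiff2_def cdiff1_cnj)
qed

lemma integrable_cmod_sq:
  fixes f :: "'a::euclidean_space \<Rightarrow> complex"
  assumes "continuous_on UNIV f" "vanishes R f"
  shows "integrable lborel (\<lambda>p. (cmod (f p))\<^sup>2)"
proof -
  have "integrable lborel (\<lambda>p. Re (f p * cnj (f p)))"
    using assms by (intro integrable_Re integrable_mult_vanishes[where R=R] continuous_on_cnj)
  then show ?thesis by (simp add: complex_norm_square[symmetric] del: of_real_power)
qed

lemma Z_eq:
  "Z S (l, 0) 0 f p = - hor S (l, 3) f p - \<i> * hor S (l, 4) f p"
  "Z S (l, 0) 1 f p = - hor S (l, 1) f p - \<i> * hor S (l, 2) f p"
  "Z S (l, 1) 0 f p = hor S (l, 1) f p - \<i> * hor S (l, 2) f p"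
  "Z S (l, 1) 1 f p = - hor S (l, 3) f p + \<i> * hor S (l, 4) f p"
  by (simp_all add: Z_def spinor_op_def deriv_along_dderiv hor_def)

text \<open>Regularity and supports of all the Z operators follow from this common form, without
  distinguishing the indices again.\<close>

lemma Z_cases:
  obtains c b d b' where "\<And>f. Z S A A' f = (\<lambda>p. c * hor S b f p + d * hor S b' f p)"
proof -
  have "A' = 0 \<or> A' = 1" "snd A = 0 \<or> snd A = 1" using exhaust_2[of A'] exhaust_2[of "snd A"] by auto
  moreover obtain l m where A: "A = (l, m)" by (cases A)
  ultimately consider "A = (l, 0)" "A' = 0" | "A = (l, 0)" "A' = 1" | "A = (l, 1)" "A' = 0" | "A = (l, 1)" "A' = 1"
    by auto
  then show ?thesis
  proof cases
    case 1 then show ?thesis by (intro that[of "-1" "(l, 3)" "-\<i>" "(l, 4)"]) (simp add: fun_eq_iff Z_eq)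
  next
    case 2 then show ?thesis by (intro that[of "-1" "(l, 1)" "-\<i>" "(l, 2)"]) (simp add: fun_eq_iff Z_eq)
  next
    case 3 then show ?thesis by (intro that[of "1" "(l, 1)" "-\<i>" "(l, 2)"]) (simp add: fun_eq_iff Z_eq)
  next
    case 4 then show ?thesis by (intro that[of "-1" "(l, 3)" "\<i>" "(l, 4)"]) (simp add: fun_eq_iff Z_eq)
  qed
qed

lemma cdiff1_Z: "cdiff2 f \<Longrightarrow> cdiff1 (Z S A A' f)"
proof -
  assume f: "cdiff2 f"
  obtain c b d b' where e: "\<And>f. Z S A A' f = (\<lambda>p. c * hor S b f p + d * hor S b' f p)"
    by (rule Z_cases[of S A A']) blast
  show "cdiff1 (Z S A A' f)" unfolding e by (intro cdiff1_add cdiff1_cmult cdiff1_hor f)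
qed

lemma continuous_Z: "cdiff1 f \<Longrightarrow> continuous_on UNIV (Z S A A' f)"
proof -
  assume f: "cdiff1 f"
  obtain c b d b' where e: "\<And>f. Z S A A' f = (\<lambda>p. c * hor S b f p + d * hor S b' f p)"
    by (rule Z_cases[of S A A']) blast
  show "continuous_on UNIV (Z S A A' f)"
    unfolding e by (intro continuous_on_add continuous_on_mult continuous_on_const continuous_hor f)
qed

lemma vanishes_Z: "cdiff1 f \<Longrightarrow> vanishes R f \<Longrightarrow> vanishes R (Z S A A' f)"
proof -
  assume f: "cdiff1 f" "vanishes R f"
  obtain c b d b' where e: "\<And>f. Z S A A' f = (\<lambda>p. c * hor S b f p + d * hor S b' f p)"
    by (rule Z_cases[of S A A']) blast
  show "vanishes R (Z S A A' f)" using vanishes_hor[OF f] by (simp add: e vanishes_def)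
qed

lemma vanishes_add: "vanishes R f \<Longrightarrow> vanishes R g \<Longrightarrow> vanishes R (\<lambda>p. f p + g p)"
  by (simp add: vanishes_def)

lemma sum_2_UNIV:
  fixes g :: "2 \<Rightarrow> 'b::comm_monoid_add"
  shows "(\<Sum>A'\<in>UNIV. g A') = g 0 + g 1"
proof -
  have "(UNIV :: 2 set) = {0, 1}" using exhaust_2 by (auto, metis zero_neq_one)
  then have "(\<Sum>b\<in>UNIV. g b) = (\<Sum>b\<in>{0, 1}. g b)" by (rule arg_cong)
  then show ?thesis by simp
qed

lemma sum_spinor: "(\<Sum>A\<in>UNIV. f A) = (\<Sum>l\<in>UNIV. f (l, 0) + f (l, 1))"
  for f :: "('n::finite) spinor \<Rightarrow> 'b::comm_monoid_add"
  by (simp only: sum_UNIV_prod sum_2_UNIV)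

lemma sum_coord: "(\<Sum>b\<in>(UNIV :: ('n::finite \<times> 4) set). f b) = (\<Sum>l\<in>UNIV. f (l, 1) + f (l, 2) + f (l, 3) + f (l, 4))"
  by (simp add: sum_UNIV_prod sum_4)

text \<open>The two spinor indices belonging to l involve the four fields of that l only, so the
  identity is proved for each l and then summed.\<close>

lemma energy_identity:
  fixes S :: "('n::finite) gram"
  assumes S: "transpose S = S" "right_type S" and g: "cdiff2 g" "vanishes R g" and h: "cdiff2 h" "vanishes R h"
  shows "(\<Sum>A\<in>UNIV. LINT p|lborel. (cmod (Z S A 0 g p + Z S A 1 h p))\<^sup>2) = energy S g + energy S h"
proof -
  let ?g = "\<lambda>p. cnj (g p)" and ?h = "\<lambda>p. cnj (h p)"
  have iZ: "integrable lborel (\<lambda>p. (cmod (Z S A 0 g p + Z S A 1 h p))\<^sup>2)" for A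
    by (rule integrable_cmod_sq[where R=R])
       (intro continuous_on_add continuous_Z vanishes_add vanishes_Z g h cdiff2_cdiff1)+
  have iX: "integrable lborel (\<lambda>p. (cmod (hor S b f p))\<^sup>2)" if "cdiff2 f" "vanishes R f" for b f
    by (rule integrable_cmod_sq[OF continuous_hor vanishes_hor]) (use that cdiff2_cdiff1 in auto)
  have "(sqint (\<lambda>p. Z S (l, 0) 0 g p + Z S (l, 0) 1 h p)) + (sqint (\<lambda>p. Z S (l, 1) 0 g p + Z S (l, 1) 1 h p))
     = ((sqint (hor S (l, 1) g)) + (sqint (hor S (l, 2) g))
      + (sqint (hor S (l, 3) g)) + (sqint (hor S (l, 4) g)))
      + ((sqint (hor S (l, 1) h)) + (sqint (hor S (l, 2) h))
      + (sqint (hor S (l, 3) h)) + (sqint (hor S (l, 4) h)))" (is "?L = ?R") for l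
  proof -
    let ?q = "\<lambda>u p. (cmod (hor S (l, 1) u p))\<^sup>2 + (cmod (hor S (l, 2) u p))\<^sup>2 + (cmod (hor S (l, 3) u p))\<^sup>2 + (cmod (hor S (l, 4) u p))\<^sup>2"
    let ?W = "\<lambda>i j u v. wronskian S (l, i) (l, j) u v"
    \<comment> \<open>All terms of the expanded squares other than the squared moduli of single
      derivatives, grouped into the three pairs to which the block identities apply.\<close>
    define E where "E p = \<i> * (?W 1 2 g ?g p - ?W 3 4 g ?g p) + (- \<i>) * (?W 1 2 h ?h p - ?W 3 4 h ?h p)
       + (-1) * (?W 1 3 g ?h p + ?W 2 4 g ?h p) + (-\<i>) * (?W 1 4 g ?h p - ?W 2 3 g ?h p)
       + (?W 1 3 h ?g p + ?W 2 4 h ?g p) + (-\<i>) * (?W 1 4 h ?g p - ?W 2 3 h ?g p)" for p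
    have 1: "complex_of_real ((cmod (Z S (l, 0) 0 g p + Z S (l, 0) 1 h p))\<^sup>2 + (cmod (Z S (l, 1) 0 g p + Z S (l, 1) 1 h p))\<^sup>2) =
       complex_of_real (?q g p + ?q h p) + E p" for p
      unfolding of_real_add complex_norm_square E_def wronskian_def Z_eq hor_cnj[OF cdiff2_cdiff1[OF g(1)]] hor_cnj[OF cdiff2_cdiff1[OF h(1)]]
      by (simp add: algebra_simps)
    note c = g h cdiff2_cdiff1 cdiff2_cnj
    have iW: "integrable lborel (?W i j u v)" if "u = g \<or> u = h" "v = ?g \<or> v = ?h" for i j u v
      by (rule integrable_wronskian[where R=R]) (use that c in auto)
    \<comment> \<open>By \<open>integral_wronskian\<close> the integral depends on the two indices
      through an entry of \<open>Bmat\<close> alone, so relations between entries become relations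
      between integrals.\<close>
    have W12: "(LINT p|lborel. ?W 1 2 u v p) = (LINT p|lborel. ?W 3 4 u v p)"
      and W13: "(LINT p|lborel. ?W 1 3 u v p) = - (LINT p|lborel. ?W 2 4 u v p)"
      and W14: "(LINT p|lborel. ?W 1 4 u v p) = (LINT p|lborel. ?W 2 3 u v p)"
      if "u = g \<or> u = h" "v = ?g \<or> v = ?h" for u v
    proof -
      have u: "cdiff1 u" "vanishes R u" and v: "cdiff2 v" using that c by auto
      show "(LINT p|lborel. ?W 1 2 u v p) = (LINT p|lborel. ?W 3 4 u v p)"
        "(LINT p|lborel. ?W 1 3 u v p) = - (LINT p|lborel. ?W 2 4 u v p)"
        "(LINT p|lborel. ?W 1 4 u v p) = (LINT p|lborel. ?W 2 3 u v p)"
        unfolding integral_wronskian[OF S(1) u v] Bmat_block1[OF S] Bmat_block2[OF S] Bmat_block3[OF S]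
        by (simp_all add: sum_negf)
    qed
    have iE: "integrable lborel E"
      unfolding E_def[abs_def]
      by (intro lebesgue_intros integrable_mult_right iW) auto
    have E0: "(LINT p|lborel. E p) = 0"
      unfolding E_def
      by (simp add: lebesgue_add lebesgue_diff iW W12 W13 W14)
    have "complex_of_real ?L = complex_of_real ?R + (LINT p|lborel. E p)"
    proof -
      have "complex_of_real ?L = (LINT p|lborel. complex_of_real ((cmod (Z S (l, 0) 0 g p + Z S (l, 0) 1 h p))\<^sup>2 + (cmod (Z S (l, 1) 0 g p + Z S (l, 1) 1 h p))\<^sup>2))"
        by (simp only: integral_complex_of_real lebesgue_add[OF iZ iZ])
      also have "\<dots> = (LINT p|lborel. complex_of_real (?q g p + ?q h p) + E p)"
        by (simp only: 1)
      also have "\<dots> = complex_of_real ?R + (LINT p|lborel. E p)"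
        by (subst lebesgue_add)
           (simp_all only: integral_complex_of_real integrable_of_real iE iX[OF g] iX[OF h] Bochner_Integration.integrable_add lebesgue_add)
      finally show ?thesis .
    qed
    then show "?L = ?R" unfolding E0 add_0_right of_real_eq_iff .
  qed
  then show ?thesis
    unfolding sum_spinor energy_def sum_coord sum.distrib[symmetric] by simp
qed

section \<open>The sublaplacian and its quadratic form\<close>

definition sublaplacian :: "('n::finite) gram \<Rightarrow> ('n grp \<Rightarrow> complex) \<Rightarrow> 'n grp \<Rightarrow> complex" where
  "sublaplacian S f p = (\<Sum>b\<in>UNIV. hor S b (hor S b f) p)"

text \<open>Besides the squares, multiplying out leaves \<i> times the commutator of X_1 and X_2
  minus \<i> times that of X_3 and X_4. The two commutators coincide pointwise by
  \<open>Bmat_block1\<close>.\<close>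

lemma Z_Z:
  fixes S :: "('n::finite) gram"
  assumes S: "transpose S = S" "right_type S" and f: "cdiff2 f"
  shows "Z S (l, 0) 0 (Z S (l, 1) 1 f) p - Z S (l, 1) 0 (Z S (l, 0) 1 f) p =
     hor S (l, 1) (hor S (l, 1) f) p + hor S (l, 2) (hor S (l, 2) f) p + hor S (l, 3) (hor S (l, 3) f) p + hor S (l, 4) (hor S (l, 4) f) p"
proof -
  have e: "Z S (l, 1) 1 f = (\<lambda>p. (-1) * hor S (l, 3) f p + \<i> * hor S (l, 4) f p)"
    "Z S (l, 0) 1 f = (\<lambda>p. (-1) * hor S (l, 1) f p + (-\<i>) * hor S (l, 2) f p)"
    by (simp_all add: fun_eq_iff Z_eq)
  have x: "hor S c (\<lambda>p. z * hor S a f p + w * hor S b f p) p = z * hor S c (hor S a f) p + w * hor S c (hor S b f) p" for z w a b c p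
    by (simp only: hor_add cdiff1_cmult cdiff1_hor[OF f] hor_cmult)
  have "hor S (l, 1) (hor S (l, 2) f) p - hor S (l, 2) (hor S (l, 1) f) p = hor S (l, 3) (hor S (l, 4) f) p - hor S (l, 4) (hor S (l, 3) f) p"
    unfolding hor_commutator[OF f S(1)] Bmat_block1[OF S] ..
  then have "\<i> * (hor S (l, 1) (hor S (l, 2) f) p - hor S (l, 2) (hor S (l, 1) f) p) = \<i> * (hor S (l, 3) (hor S (l, 4) f) p - hor S (l, 4) (hor S (l, 3) f) p)"
    by simp
  then show ?thesis unfolding e Z_eq x by (simp add: algebra_simps)
qed

lemma integral_sublaplacian:
  assumes f: "cdiff2 f" "vanishes R f"
  shows "(LINT p|lborel. sublaplacian S f p * cnj (f p)) = - complex_of_real (energy S f)"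
proof -
  note f1 = cdiff2_cdiff1[OF f(1)]
  have 1: "(LINT p|lborel. hor S b (hor S b f) p * cnj (f p)) = - complex_of_real (sqint (hor S b f))" for b
    unfolding hor_by_parts[OF cdiff1_hor[OF f(1)] vanishes_hor[OF f1 f(2)] cdiff1_cnj[OF f1]] hor_cnj[OF f1]
    by (simp add: complex_norm_square[symmetric] del: of_real_power)
  have "(LINT p|lborel. sublaplacian S f p * cnj (f p)) = (\<Sum>b\<in>UNIV. LINT p|lborel. hor S b (hor S b f) p * cnj (f p))"
    unfolding sublaplacian_def sum_distrib_right
    by (intro lebesgue_sum integrable_mult_vanishes[where R=R] continuous_hor vanishes_hor cdiff1_hor
        continuous_on_cnj cdiff1_cont f f1)
  then show ?thesis by (simp add: 1 energy_def sum_negf)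
qed

subsection \<open>Partial Fourier transform in the central variables\<close>

lemma vanishes_cis: "vanishes R \<phi> \<Longrightarrow> vanishes R (\<lambda>x. cis (r x) * \<phi> x)"
  by (simp add: vanishes_def)

text \<open>The derivative of the product with the exponential integrates to 0. Only a directional
  derivative at 0 is assumed, which is what \<open>pft_derivative\<close> supplies for partial
  transforms.\<close>

lemma integral_cis_derivative:
  fixes \<psi> :: "'a::euclidean_space \<Rightarrow> complex"
  assumes der: "\<And>p. ((\<lambda>s. \<psi> (p + s *\<^sub>R v)) has_vector_derivative \<psi>' p) (at 0)"
    and cont: "continuous_on UNIV \<psi>" "continuous_on UNIV \<psi>'" and van: "vanishes R \<psi>" "vanishes R \<psi>'"
  shows "(fint \<psi>' \<xi>) = \<i> * of_real (v \<bullet> \<xi>) * (fint \<psi> \<xi>)"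
proof -
  let ?d = "\<lambda>x. cis (- (x \<bullet> \<xi>)) * \<psi>' x + (- \<i> * of_real (v \<bullet> \<xi>)) * (cis (- (x \<bullet> \<xi>)) * \<psi> x)"
  have c: "continuous_on UNIV (\<lambda>x::'a. cis (- (x \<bullet> \<xi>)))" by (intro continuous_intros)
  have "(LINT x|lborel. ?d x) = 0"
  proof (rule integral_directional_derivative[where \<phi>="\<lambda>x. cis (- (x \<bullet> \<xi>)) * \<psi> x" and R=R and v=v])
    fix p :: 'a
    have "((\<lambda>s. cis (- ((p + s *\<^sub>R v) \<bullet> \<xi>))) has_vector_derivative (- \<i> * of_real (v \<bullet> \<xi>)) * cis (- (p \<bullet> \<xi>))) (at 0)"
    proof -
      have "((\<lambda>s. exp (of_real s * (- \<i> * of_real (v \<bullet> \<xi>))) * cis (- (p \<bullet> \<xi>))) has_vector_derivative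
          (- \<i> * of_real (v \<bullet> \<xi>)) * cis (- (p \<bullet> \<xi>))) (at 0)"
      proof -
        have "((\<lambda>z. exp (z * (- \<i> * of_real (v \<bullet> \<xi>))) * cis (- (p \<bullet> \<xi>))) has_field_derivative
          (- \<i> * of_real (v \<bullet> \<xi>)) * cis (- (p \<bullet> \<xi>))) (at (of_real 0))"
          by (auto intro!: derivative_eq_intros)
        from has_vector_derivative_real_field[OF this] show ?thesis by (simp add: o_def)
      qed
      moreover have "exp (of_real s * (- \<i> * of_real (v \<bullet> \<xi>))) * cis (- (p \<bullet> \<xi>)) = cis (- ((p + s *\<^sub>R v) \<bullet> \<xi>))" for s
        by (simp add: cis_conv_exp inner_add_left algebra_simps flip: exp_add)
      ultimately show ?thesis by simp
    qed
    from has_vector_derivative_mult[OF this der[of p]]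
    show "((\<lambda>s. cis (- ((p + s *\<^sub>R v) \<bullet> \<xi>)) * \<psi> (p + s *\<^sub>R v)) has_vector_derivative ?d p) (at 0)"
      by (simp add: mult.assoc)
  qed (intro continuous_on_add continuous_on_mult continuous_on_const c cont vanishes_cis van)+
  moreover have "(LINT x|lborel. ?d x) = (fint \<psi>' \<xi>) + (LINT x|lborel. (- \<i> * of_real (v \<bullet> \<xi>)) * (cis (- (x \<bullet> \<xi>)) * \<psi> x))"
  proof (rule lebesgue_add)
    show "integrable lborel (\<lambda>x. cis (- (x \<bullet> \<xi>)) * \<psi>' x)"
      using integrable_mult_vanishes[OF cont(2) c van(2)] by (simp add: mult.commute)
    show "integrable lborel (\<lambda>x. (- \<i> * of_real (v \<bullet> \<xi>)) * (cis (- (x \<bullet> \<xi>)) * \<psi> x))"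
      using integrable_mult_vanishes[OF cont(1) c van(1)] by (intro lebesgue_intros) (simp add: mult.commute)
  qed
  ultimately show ?thesis by (simp add: add_eq_0_iff2)
qed

definition pft :: "('a::euclidean_space \<times> 'b::euclidean_space \<Rightarrow> complex) \<Rightarrow> 'b \<Rightarrow> 'a \<Rightarrow> complex" where
  "pft \<phi> \<tau> x = (LINT t|lborel. cis (- (t \<bullet> \<tau>)) * \<phi> (x, t))"

lemma vanishes_slice:
  fixes \<phi> :: "'a::real_normed_vector \<times> 'b::real_normed_vector \<Rightarrow> complex"
  assumes "vanishes R \<phi>"
  shows "vanishes R (\<lambda>t. \<phi> (x, t))"
  unfolding vanishes_def
proof (intro allI impI)
  fix t :: 'b assume "R < norm t"
  also have "norm t \<le> norm (x, t)" by (rule norm_snd_le)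
  finally show "\<phi> (x, t) = 0" using assms by (simp add: vanishes_def)
qed

lemma continuous_slice: "continuous_on UNIV \<phi> \<Longrightarrow> continuous_on UNIV (\<lambda>t. \<phi> (x, t))"
  by (rule continuous_on_compose2[of UNIV \<phi>]) (auto intro!: continuous_on_Pair continuous_on_const continuous_on_id)

lemma continuous_on_cis_inner: "continuous_on S (\<lambda>x. cis (- (x \<bullet> \<xi>)))"
  by (intro continuous_intros)

lemma integrable_cis_slice:
  fixes \<phi> :: "'a::euclidean_space \<times> 'b::euclidean_space \<Rightarrow> complex"
  assumes "continuous_on UNIV \<phi>" "vanishes R \<phi>"
  shows "integrable lborel (\<lambda>t. cis (- (t \<bullet> \<tau>)) * \<phi> (x, t))"
  by (rule integrable_vanishes[where R=R, OF continuous_on_mult[OF continuous_on_cis_inner continuous_slice[OF assms(1)]]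
      vanishes_cis[OF vanishes_slice[OF assms(2)]]])

lemma vanishes_pft:
  fixes \<phi> :: "'a::euclidean_space \<times> 'b::euclidean_space \<Rightarrow> complex"
  assumes "vanishes R \<phi>"
  shows "vanishes R (pft \<phi> \<tau>)"
  unfolding vanishes_def
proof (intro allI impI)
  fix x :: 'a assume x: "R < norm x"
  have "\<phi> (x, t) = 0" for t
  proof -
    note x also have "norm x \<le> norm (x, t)" by (rule norm_fst_le)
    finally show ?thesis using assms by (simp add: vanishes_def)
  qed
  then show "pft \<phi> \<tau> x = 0" by (simp add: pft_def)
qed

lemma continuous_pft:
  fixes \<phi> :: "'a::euclidean_space \<times> 'b::euclidean_space \<Rightarrow> complex"
  assumes c: "continuous_on UNIV \<phi>" and v: "vanishes R \<phi>"
  shows "continuous_on UNIV (pft \<phi> \<tau>)"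
proof -
  obtain a b :: 'b where ab: "cball 0 R \<subseteq> cbox a b" by (rule cball_subset_cube)
  have "pft \<phi> \<tau> = (\<lambda>x. integral (cbox a b) (\<lambda>t. cis (- (t \<bullet> \<tau>)) * \<phi> (x, t)))"
    unfolding pft_def
    by (intro ext lint_vanishes[OF _ _ ab] continuous_on_mult[OF continuous_on_cis_inner continuous_slice[OF c]]
      vanishes_cis[OF vanishes_slice[OF v]])
  moreover have "continuous_on UNIV (\<lambda>x. integral (cbox a b) (\<lambda>t. cis (- (t \<bullet> \<tau>)) * \<phi> (x, t)))"
  proof (rule integral_continuous_on_param)
    show "continuous_on (UNIV \<times> cbox a b) (\<lambda>(x, t). cis (- (t \<bullet> \<tau>)) * \<phi> (x, t))"
      unfolding split_beta by (intro continuous_intros continuous_on_compose2[OF c]) auto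
  qed
  ultimately show ?thesis by simp
qed

lemma measurable_pft:
  fixes \<phi> :: "'a::euclidean_space \<times> 'b::euclidean_space \<Rightarrow> complex"
  assumes c: "continuous_on UNIV \<phi>"
  shows "(\<lambda>z. pft \<phi> (snd z) (fst z)) \<in> borel_measurable (lborel \<Otimes>\<^sub>M lborel)"
proof -
  have "(\<lambda>(z, t). cis (- (t \<bullet> snd z)) * \<phi> (fst z, t)) \<in> borel_measurable ((lborel \<Otimes>\<^sub>M lborel) \<Otimes>\<^sub>M lborel)"
    unfolding lborel_prod split_beta
    by (intro borel_measurable_lborel_continuous continuous_intros continuous_on_compose2[OF c]) auto
  from lborel.borel_measurable_lebesgue_integral[OF this] show ?thesis by (simp add: pft_def)
qed

lemma pft_derivative:
  fixes \<phi> :: "'a::euclidean_space \<times> 'b::euclidean_space \<Rightarrow> complex"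
  assumes f: "cdiff1 \<phi>" and v: "vanishes R \<phi>"
  shows "((\<lambda>s. pft \<phi> \<tau> (x + s *\<^sub>R u)) has_vector_derivative pft (dderiv (u, 0) \<phi>) \<tau> x) (at 0)"
proof -
  have "((\<lambda>s. LINT t|lborel. cis (- (t \<bullet> \<tau>)) * \<phi> (x + s *\<^sub>R u, t)) has_vector_derivative
      (LINT t|lborel. cis (- (t \<bullet> \<tau>)) * dderiv (u, 0) \<phi> (x + 0 *\<^sub>R u, t))) (at 0)"
  proof (rule has_vector_derivative_lint[where U=UNIV and R=R])
    fix s :: real and t :: 'b
    have "((\<lambda>s. \<phi> ((x, t) + s *\<^sub>R (u, 0))) has_vector_derivative dderiv (u, 0) \<phi> ((x, t) + s *\<^sub>R (u, 0))) (at s)"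
      by (rule cdiff1_has_vector_derivative[OF f])
    then show "((\<lambda>s. cis (- (t \<bullet> \<tau>)) * \<phi> (x + s *\<^sub>R u, t)) has_vector_derivative
        cis (- (t \<bullet> \<tau>)) * dderiv (u, 0) \<phi> (x + s *\<^sub>R u, t)) (at s)"
      by (intro has_vector_derivative_mult_right) simp
    show "continuous_on UNIV (\<lambda>t. cis (- (t \<bullet> \<tau>)) * \<phi> (x + s *\<^sub>R u, t))"
      by (rule continuous_on_mult[OF continuous_on_cis_inner continuous_slice[OF cdiff1_cont[OF f]]])
    show "vanishes R (\<lambda>t. cis (- (t \<bullet> \<tau>)) * \<phi> (x + s *\<^sub>R u, t))"
      by (rule vanishes_cis[OF vanishes_slice[OF v]])
    show "continuous_on (UNIV \<times> UNIV) (\<lambda>(s, t). cis (- (t \<bullet> \<tau>)) * dderiv (u, 0) \<phi> (x + s *\<^sub>R u, t))"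
      unfolding split_beta by (intro continuous_intros continuous_on_compose2[OF cdiff1_cont_dderiv[OF f]]) auto
  qed auto
  then show ?thesis by (simp add: pft_def)
qed

lemma pft_dderiv_snd:
  fixes \<phi> :: "'a::euclidean_space \<times> 'b::euclidean_space \<Rightarrow> complex"
  assumes f: "cdiff1 \<phi>" and v: "vanishes R \<phi>"
  shows "pft (dderiv (0, u) \<phi>) \<tau> x = \<i> * of_real (u \<bullet> \<tau>) * pft \<phi> \<tau> x"
  unfolding pft_def
proof (rule integral_cis_derivative[where R=R])
  fix t :: 'b
  show "((\<lambda>s. \<phi> (x, t + s *\<^sub>R u)) has_vector_derivative dderiv (0, u) \<phi> (x, t)) (at 0)"
    using cdiff1_has_vector_derivative[OF f, of "(x, t)" "(0, u)" 0 UNIV] by simp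
qed (rule continuous_slice[OF cdiff1_cont[OF f]] continuous_slice[OF cdiff1_cont_dderiv[OF f]]
    vanishes_slice[OF v] vanishes_slice[OF vanishes_dderiv[OF f v]])+

text \<open>A real potential, linear in x: at fixed \<tau> the field X_b acts as the magnetic
  derivative in x_b with this potential (see \<open>pft_hor\<close>).\<close>

definition phase_coeff :: "('n::finite) gram \<Rightarrow> real ^ 3 \<Rightarrow> 'n \<times> 4 \<Rightarrow> real ^ ('n \<times> 4) \<Rightarrow> real" where
  "phase_coeff S \<tau> b x = (\<Sum>\<beta>\<in>UNIV. hor_coeff S \<beta> b x * \<tau> $ \<beta>)"

lemma pft_hor:
  assumes f: "cdiff1 \<phi>" and v: "vanishes R \<phi>"
  shows "pft (hor S b \<phi>) \<tau> x = pft (dderiv (e_x b) \<phi>) \<tau> x + \<i> * of_real (phase_coeff S \<tau> b x) * pft \<phi> \<tau> x"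
proof -
  have i: "integrable lborel (\<lambda>t. cis (- (t \<bullet> \<tau>)) * dderiv w \<phi> (x, t))" for w
    by (intro integrable_cis_slice[where R=R] cdiff1_cont_dderiv vanishes_dderiv f v)
  have "pft (hor S b \<phi>) \<tau> x = (LINT t|lborel. cis (- (t \<bullet> \<tau>)) * dderiv (e_x b) \<phi> (x, t) +
      (\<Sum>\<beta>\<in>UNIV. of_real (hor_coeff S \<beta> b x) * (cis (- (t \<bullet> \<tau>)) * dderiv (e_t \<beta>) \<phi> (x, t))))"
    unfolding pft_def hor_eq[OF f] by (simp add: algebra_simps sum_distrib_left)
  also have "\<dots> = pft (dderiv (e_x b) \<phi>) \<tau> x + (LINT t|lborel. (\<Sum>\<beta>\<in>UNIV. of_real (hor_coeff S \<beta> b x) * (cis (- (t \<bullet> \<tau>)) * dderiv (e_t \<beta>) \<phi> (x, t))))"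
    unfolding pft_def
    by (intro lebesgue_add lebesgue_intros i)
  also have "(LINT t|lborel. (\<Sum>\<beta>\<in>UNIV. of_real (hor_coeff S \<beta> b x) * (cis (- (t \<bullet> \<tau>)) * dderiv (e_t \<beta>) \<phi> (x, t)))) =
     (\<Sum>\<beta>\<in>UNIV. LINT t|lborel. of_real (hor_coeff S \<beta> b x) * (cis (- (t \<bullet> \<tau>)) * dderiv (e_t \<beta>) \<phi> (x, t)))"
    by (intro lebesgue_sum Bochner_Integration.integrable_mult_right i)
  also have "\<dots> = (\<Sum>\<beta>\<in>UNIV. of_real (hor_coeff S \<beta> b x) * pft (dderiv (e_t \<beta>) \<phi>) \<tau> x)"
    by (simp add: pft_def)
  also have "\<dots> = \<i> * of_real (phase_coeff S \<tau> b x) * pft \<phi> \<tau> x"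
    unfolding pft_dderiv_snd[OF f v] by (simp add: phase_coeff_def sum_distrib_left sum_distrib_right inner_axis' ac_simps)
  finally show ?thesis .
qed

text \<open>The magnetic derivative is skew-adjoint in x for each fixed \<tau>, because the
  potential is real.\<close>

lemma pft_by_parts:
  assumes f: "cdiff1 \<phi>" "vanishes R \<phi>" and g: "cdiff1 \<psi>" "vanishes R \<psi>"
  shows "(LINT x|lborel. pft (hor S b \<phi>) \<tau> x * cnj (pft \<psi> \<tau> x)) = - (LINT x|lborel. pft \<phi> \<tau> x * cnj (pft (hor S b \<psi>) \<tau> x))"
proof -
  note c = continuous_pft[where R=R] vanishes_pft[where R=R] cdiff1_cont cdiff1_cont_dderiv vanishes_dderiv f g continuous_hor vanishes_hor
  let ?d = "\<lambda>x. pft \<phi> \<tau> x * cnj (pft (dderiv (e_x b) \<psi>) \<tau> x) + pft (dderiv (e_x b) \<phi>) \<tau> x * cnj (pft \<psi> \<tau> x)"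
  have "(LINT x|lborel. ?d x) = 0"
  proof (rule integral_directional_derivative[where \<phi>="\<lambda>x. pft \<phi> \<tau> x * cnj (pft \<psi> \<tau> x)" and R=R and v="axis b 1"])
    show "((\<lambda>s. pft \<phi> \<tau> (p + s *\<^sub>R axis b 1) * cnj (pft \<psi> \<tau> (p + s *\<^sub>R axis b 1))) has_vector_derivative ?d p) (at 0)" for p
      using has_vector_derivative_mult[OF pft_derivative[OF f] has_vector_derivative_cnj[OF pft_derivative[OF g]]] by simp
    show "continuous_on UNIV (\<lambda>x. pft \<phi> \<tau> x * cnj (pft \<psi> \<tau> x))"
      by (intro continuous_on_mult continuous_on_cnj c)
    show "continuous_on UNIV ?d"
      by (intro continuous_on_add continuous_on_mult continuous_on_cnj c)
    show "vanishes R (\<lambda>x. pft \<phi> \<tau> x * cnj (pft \<psi> \<tau> x))"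
      by (intro vanishes_mult c)
  qed
  \<comment> \<open>The two potential terms added here cancel: conjugation changes the sign of \<i>
    and leaves the real potential alone.\<close>
  also have "?d = (\<lambda>x. pft (hor S b \<phi>) \<tau> x * cnj (pft \<psi> \<tau> x) + pft \<phi> \<tau> x * cnj (pft (hor S b \<psi>) \<tau> x))"
    by (simp add: fun_eq_iff pft_hor[OF f] pft_hor[OF g] algebra_simps)
  also have "(LINT x|lborel. pft (hor S b \<phi>) \<tau> x * cnj (pft \<psi> \<tau> x) + pft \<phi> \<tau> x * cnj (pft (hor S b \<psi>) \<tau> x)) =
     (LINT x|lborel. pft (hor S b \<phi>) \<tau> x * cnj (pft \<psi> \<tau> x)) + (LINT x|lborel. pft \<phi> \<tau> x * cnj (pft (hor S b \<psi>) \<tau> x))"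
    by (intro lebesgue_add integrable_mult_vanishes[where R=R] continuous_on_cnj c)
  finally show ?thesis by (simp add: eq_neg_iff_add_eq_0)
qed

lemma pft_diff:
  assumes "continuous_on UNIV \<phi>" "vanishes R \<phi>" "continuous_on UNIV \<psi>" "vanishes R \<psi>"
  shows "pft (\<lambda>p. \<phi> p - \<psi> p) \<tau> x = pft \<phi> \<tau> x - pft \<psi> \<tau> x"
  unfolding pft_def right_diff_distrib
  by (intro lebesgue_diff integrable_cis_slice[where R=R] assms)

definition pft_sq :: "('a::euclidean_space \<times> 'b::euclidean_space \<Rightarrow> complex) \<Rightarrow> 'b \<Rightarrow> real" where
  "pft_sq \<phi> \<tau> = (sqint (pft \<phi> \<tau>))"

text \<open>Moving one horizontal derivative across in each term leaves the commutator of X_a and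
  X_b paired with f. Its central derivatives become multiplications by \<i> times a coordinate of
  \<tau>.\<close>

lemma pft_commutator:
  fixes S :: "('n::finite) gram"
  assumes S: "transpose S = S" and f: "cdiff2 f" "vanishes R f"
  shows "(LINT x|lborel. pft (hor S a f) \<tau> x * cnj (pft (hor S b f) \<tau> x) - pft (hor S b f) \<tau> x * cnj (pft (hor S a f) \<tau> x))
    = 4 * \<i> * of_real (Bmat_comb S \<tau> $ a $ b) * of_real (pft_sq f \<tau>)"
proof -
  note f1 = cdiff2_cdiff1[OF f(1)]
  note fx = cdiff1_hor[OF f(1)] 
  note vx = vanishes_hor[OF f1 f(2)]
  note c = continuous_pft[where R=R] vanishes_pft[where R=R] cdiff1_cont fx vx f1 f continuous_hor vanishes_hor
  have e: "(\<lambda>p. hor S a (hor S b f) p - hor S b (hor S a f) p) = (\<lambda>p. \<Sum>\<beta>\<in>UNIV. of_real (4 * Bmat S \<beta> $ a $ b) * dderiv (e_t \<beta>) f p)"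
    by (rule ext) (rule hor_commutator[OF f(1) S])
  have i: "integrable lborel (\<lambda>t. cis (- (t \<bullet> \<tau>)) * dderiv w f (x, t))" for w x
    by (intro integrable_cis_slice[where R=R] cdiff1_cont_dderiv vanishes_dderiv f1 f)
  have g: "pft (\<lambda>p. hor S a (hor S b f) p - hor S b (hor S a f) p) \<tau> x = 4 * \<i> * of_real (Bmat_comb S \<tau> $ a $ b) * pft f \<tau> x" for x
  proof -
    have "pft (\<lambda>p. hor S a (hor S b f) p - hor S b (hor S a f) p) \<tau> x =
       (LINT t|lborel. (\<Sum>\<beta>\<in>UNIV. of_real (4 * Bmat S \<beta> $ a $ b) * (cis (- (t \<bullet> \<tau>)) * dderiv (e_t \<beta>) f (x, t))))"
      unfolding e pft_def by (simp add: sum_distrib_left ac_simps)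
    also have "\<dots> = (\<Sum>\<beta>\<in>UNIV. LINT t|lborel. of_real (4 * Bmat S \<beta> $ a $ b) * (cis (- (t \<bullet> \<tau>)) * dderiv (e_t \<beta>) f (x, t)))"
      by (intro lebesgue_sum Bochner_Integration.integrable_mult_right i)
    also have "\<dots> = (\<Sum>\<beta>\<in>UNIV. of_real (4 * Bmat S \<beta> $ a $ b) * pft (dderiv (e_t \<beta>) f) \<tau> x)"
      by (simp add: pft_def)
    also have "\<dots> = 4 * \<i> * of_real (Bmat_comb S \<tau> $ a $ b) * pft f \<tau> x"
      unfolding pft_dderiv_snd[OF f1 f(2)] by (simp add: Bmat_comb_def sum_distrib_left sum_distrib_right inner_axis' ac_simps)
    finally show ?thesis .
  qed
  have "(LINT x|lborel. pft (hor S a f) \<tau> x * cnj (pft (hor S b f) \<tau> x) - pft (hor S b f) \<tau> x * cnj (pft (hor S a f) \<tau> x)) =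
      (LINT x|lborel. pft (hor S a f) \<tau> x * cnj (pft (hor S b f) \<tau> x)) - (LINT x|lborel. pft (hor S b f) \<tau> x * cnj (pft (hor S a f) \<tau> x))"
    by (intro lebesgue_diff integrable_mult_vanishes[where R=R] continuous_on_cnj c)
  also have "\<dots> = (LINT x|lborel. pft (hor S a (hor S b f)) \<tau> x * cnj (pft f \<tau> x)) - (LINT x|lborel. pft (hor S b (hor S a f)) \<tau> x * cnj (pft f \<tau> x))"
    unfolding pft_by_parts[OF fx vx f1 f(2)] by simp
  also have "\<dots> = (LINT x|lborel. pft (hor S a (hor S b f)) \<tau> x * cnj (pft f \<tau> x) - pft (hor S b (hor S a f)) \<tau> x * cnj (pft f \<tau> x))"
    by (intro lebesgue_diff[symmetric] integrable_mult_vanishes[where R=R] continuous_on_cnj c)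
  also have "\<dots> = (LINT x|lborel. pft (\<lambda>p. hor S a (hor S b f) p - hor S b (hor S a f) p) \<tau> x * cnj (pft f \<tau> x))"
    by (simp only: pft_diff[OF continuous_hor[OF fx] vanishes_hor[OF fx vx] continuous_hor[OF fx] vanishes_hor[OF fx vx]] left_diff_distrib)
  also have "\<dots> = (LINT x|lborel. 4 * \<i> * of_real (Bmat_comb S \<tau> $ a $ b) * of_real ((cmod (pft f \<tau> x))\<^sup>2))"
    unfolding g complex_norm_square mult.assoc ..
  also have "\<dots> = 4 * \<i> * of_real (Bmat_comb S \<tau> $ a $ b) * of_real (pft_sq f \<tau>)"
    unfolding pft_sq_def by (subst integral_mult_right_zero) (simp only: integral_complex_of_real)
  finally show ?thesis .
qed

lemma pft_sq_nonneg: "pft_sq \<phi> \<tau> \<ge> 0"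
  by (simp add: pft_sq_def)

text \<open>Robertson's inequality for X_a and X_b at fixed \<tau>. The 4 is that of the commutator;
  the factor 2 from the two equal products is absorbed by 2uv \<le> u^2 + v^2.\<close>

lemma uncertainty:
  fixes S :: "('n::finite) gram"
  assumes S: "transpose S = S" and f: "cdiff2 f" "vanishes R f"
  shows "4 * \<bar>Bmat_comb S \<tau> $ a $ b\<bar> * pft_sq f \<tau> \<le> pft_sq (hor S a f) \<tau> + pft_sq (hor S b f) \<tau>"
proof -
  note f1 = cdiff2_cdiff1[OF f(1)]
  have c: "continuous_on UNIV (pft (hor S b f) \<tau>)" "vanishes R (pft (hor S b f) \<tau>)" for b
    by (intro continuous_pft[where R=R] vanishes_pft continuous_hor vanishes_hor f1 f)+
  let ?w = "\<lambda>x. pft (hor S a f) \<tau> x * cnj (pft (hor S b f) \<tau> x) - pft (hor S b f) \<tau> x * cnj (pft (hor S a f) \<tau> x)"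
  have iw: "integrable lborel ?w"
    by (intro lebesgue_intros integrable_mult_vanishes[where R=R] continuous_on_cnj c)
  have "4 * \<bar>Bmat_comb S \<tau> $ a $ b\<bar> * pft_sq f \<tau> = norm (LINT x|lborel. ?w x)"
    unfolding pft_commutator[OF S f] by (simp add: norm_mult pft_sq_nonneg)
  also have "\<dots> \<le> (LINT x|lborel. norm (?w x))" by (rule integral_norm_bound)
  also have "\<dots> \<le> (LINT x|lborel. (cmod (pft (hor S a f) \<tau> x))\<^sup>2 + (cmod (pft (hor S b f) \<tau> x))\<^sup>2)"
  proof (rule integral_mono)
    show "integrable lborel (\<lambda>x. norm (?w x))" using iw by (rule integrable_norm)
    show "integrable lborel (\<lambda>x. (cmod (pft (hor S a f) \<tau> x))\<^sup>2 + (cmod (pft (hor S b f) \<tau> x))\<^sup>2)"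
      by (intro lebesgue_intros integrable_cmod_sq[where R=R] c)
    show "norm (?w x) \<le> (cmod (pft (hor S a f) \<tau> x))\<^sup>2 + (cmod (pft (hor S b f) \<tau> x))\<^sup>2" for x
    proof -
      have "norm (?w x) \<le> 2 * cmod (pft (hor S a f) \<tau> x) * cmod (pft (hor S b f) \<tau> x)"
        by (rule order_trans[OF norm_triangle_ineq4]) (simp add: norm_mult)
      also have "\<dots> \<le> (cmod (pft (hor S a f) \<tau> x))\<^sup>2 + (cmod (pft (hor S b f) \<tau> x))\<^sup>2"
        by (rule sum_squares_bound)
      finally show ?thesis .
    qed
  qed
  also have "\<dots> = pft_sq (hor S a f) \<tau> + pft_sq (hor S b f) \<tau>"
    unfolding pft_sq_def by (intro lebesgue_add integrable_cmod_sq[where R=R] c)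
  finally show ?thesis .
qed

subsection \<open>The subelliptic estimate\<close>

text \<open>A crude bound for \<open>phase_coeff\<close> on the ball of radius R per unit of
  |\<tau>|. Summing over \<open>b\<close> gives one constant for all fields.\<close>

definition phase_bound :: "('n::finite) gram \<Rightarrow> real \<Rightarrow> real" where
  "phase_bound S R = (\<Sum>b\<in>UNIV. \<Sum>\<beta>\<in>UNIV. 2 * (\<Sum>a\<in>UNIV. \<bar>Bmat S \<beta> $ a $ b\<bar>) * R)"

lemma phase_coeff_bound:
  assumes x: "norm x \<le> R" and R: "0 \<le> R"
  shows "\<bar>phase_coeff S \<tau> b x\<bar> \<le> phase_bound S R * norm \<tau>"
proof -
  let ?k = "\<lambda>b \<beta>. 2 * (\<Sum>a\<in>UNIV. \<bar>Bmat S \<beta> $ a $ b\<bar>) * R"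
  have hor_coeff: "\<bar>hor_coeff S \<beta> b x\<bar> \<le> ?k b \<beta>" for \<beta>
  proof -
    have "\<bar>hor_coeff S \<beta> b x\<bar> \<le> 2 * (\<Sum>a\<in>UNIV. \<bar>Bmat S \<beta> $ a $ b * x $ a\<bar>)"
      using sum_abs[of "\<lambda>a. Bmat S \<beta> $ a $ b * x $ a" UNIV] by (simp add: hor_coeff_def abs_mult)
    also have "\<dots> \<le> 2 * (\<Sum>a\<in>UNIV. \<bar>Bmat S \<beta> $ a $ b\<bar> * R)"
      by (auto simp: abs_mult intro!: mult_left_mono sum_mono order_trans[OF component_le_norm_cart x])
    finally show ?thesis by (simp only: sum_distrib_right[symmetric] mult.assoc)
  qed
  have "\<bar>phase_coeff S \<tau> b x\<bar> \<le> (\<Sum>\<beta>\<in>UNIV. \<bar>hor_coeff S \<beta> b x\<bar> * \<bar>\<tau> $ \<beta>\<bar>)"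
    unfolding phase_coeff_def by (rule order_trans[OF sum_abs]) (simp add: abs_mult)
  also have "\<dots> \<le> (\<Sum>\<beta>\<in>UNIV. ?k b \<beta> * norm \<tau>)"
    using R by (intro sum_mono mult_mono hor_coeff component_le_norm_cart) (auto intro!: mult_nonneg_nonneg sum_nonneg)
  also have "\<dots> = (\<Sum>\<beta>\<in>UNIV. ?k b \<beta>) * norm \<tau>" by (simp add: sum_distrib_right)
  also have "\<dots> \<le> phase_bound S R * norm \<tau>"
    unfolding phase_bound_def using R
    by (intro mult_right_mono member_le_sum[of b UNIV "\<lambda>b. \<Sum>\<beta>\<in>UNIV. ?k b \<beta>"]) (auto intro!: sum_nonneg mult_nonneg_nonneg)
  finally show ?thesis .
qed

text \<open>\<open>pft_hor\<close> solved for the plain derivative. The potential grows with x, and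
  the restriction of the support to |x| \<le> R is what keeps it below a multiple of
  |\<tau>|.\<close>

lemma pft_sq_dderiv:
  fixes S :: "('n::finite) gram"
  assumes f: "cdiff1 f" "vanishes R f" and R: "0 \<le> R"
  shows "pft_sq (dderiv (e_x b) f) \<tau> \<le> 2 * pft_sq (hor S b f) \<tau> + 2 * (phase_bound S R * norm \<tau>)\<^sup>2 * pft_sq f \<tau>"
proof -
  note i = integrable_cmod_sq[where R=R] continuous_pft[where R=R] vanishes_pft[where R=R] continuous_hor vanishes_hor cdiff1_cont cdiff1_cont_dderiv vanishes_dderiv f
  have "pft_sq (dderiv (e_x b) f) \<tau> \<le> (LINT x|lborel. 2 * (cmod (pft (hor S b f) \<tau> x))\<^sup>2 + 2 * (phase_bound S R * norm \<tau>)\<^sup>2 * (cmod (pft f \<tau> x))\<^sup>2)"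
    unfolding pft_sq_def
  proof (rule integral_mono)
    fix x :: "real ^ ('n \<times> 4)"
    let ?G = "pft (hor S b f) \<tau> x" and ?z = "\<i> * of_real (phase_coeff S \<tau> b x) * pft f \<tau> x"
    have z: "(cmod ?z)\<^sup>2 \<le> (phase_bound S R * norm \<tau>)\<^sup>2 * (cmod (pft f \<tau> x))\<^sup>2"
    proof (cases "norm x \<le> R")
      case True
      have "(phase_coeff S \<tau> b x)\<^sup>2 \<le> (phase_bound S R * norm \<tau>)\<^sup>2"
        using phase_coeff_bound[OF True R] by (metis abs_ge_zero power2_abs power_mono)
      then show ?thesis by (simp add: norm_mult power_mult_distrib mult_right_mono)
    next
      case False
      then have "pft f \<tau> x = 0" using vanishes_pft[OF f(2)] by (simp add: vanishes_def)
      then show ?thesis by simp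
    qed
    have "cmod (pft (dderiv (e_x b) f) \<tau> x) = cmod (?G - ?z)" by (simp add: pft_hor[OF f])
    also have "\<dots> \<le> cmod ?G + cmod ?z" by (rule norm_triangle_ineq4)
    finally have "(cmod (pft (dderiv (e_x b) f) \<tau> x))\<^sup>2 \<le> (cmod ?G + cmod ?z)\<^sup>2" by (intro power_mono) auto
    also have "\<dots> \<le> 2 * (cmod ?G)\<^sup>2 + 2 * (cmod ?z)\<^sup>2"
      using sum_squares_bound[of "cmod ?G" "cmod ?z"] by (simp add: power2_sum)
    finally show "(cmod (pft (dderiv (e_x b) f) \<tau> x))\<^sup>2 \<le> 2 * (cmod ?G)\<^sup>2 + 2 * (phase_bound S R * norm \<tau>)\<^sup>2 * (cmod (pft f \<tau> x))\<^sup>2"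
      using z by simp
  qed (intro lebesgue_intros i)+
  also have "\<dots> = 2 * pft_sq (hor S b f) \<tau> + 2 * (phase_bound S R * norm \<tau>)\<^sup>2 * pft_sq f \<tau>"
  proof -
    have i1: "integrable lborel (\<lambda>x. (cmod (pft f \<tau> x))\<^sup>2)"
      by (rule integrable_cmod_sq[OF continuous_pft[OF cdiff1_cont[OF f(1)] f(2)] vanishes_pft[OF f(2)]])
    have i2: "integrable lborel (\<lambda>x. (cmod (pft (hor S b f) \<tau> x))\<^sup>2)"
      by (rule integrable_cmod_sq[OF continuous_pft[OF continuous_hor[OF f(1)] vanishes_hor[OF f]] vanishes_pft[OF vanishes_hor[OF f]]])
    show ?thesis
      unfolding pft_sq_def
      by (simp only: lebesgue_add[OF integrable_mult_right[OF i2] integrable_mult_right[OF i1]]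
          integral_mult_right_zero)
  qed
  finally show ?thesis .
qed

text \<open>Sum \<open>uncertainty\<close> over all pairs (a, b). Each field occurs 2N times among
  the N^2 pairs, N being the number of fields, so 4c |\<tau>| faces 2N and the constant is
  N/(2c).\<close>

lemma pft_sq_weighted:
  fixes S :: "('n::finite) gram"
  assumes S: "transpose S = S" and f: "cdiff2 f" "vanishes R f"
    and c: "c > 0" "c * norm \<tau> \<le> (\<Sum>a\<in>UNIV. \<Sum>b\<in>UNIV. \<bar>Bmat_comb S \<tau> $ a $ b\<bar>)"
  shows "norm \<tau> * pft_sq f \<tau> \<le> real CARD('n \<times> 4) / (2 * c) * (\<Sum>b\<in>UNIV. pft_sq (hor S b f) \<tau>)"
proof -
  let ?M = "\<Sum>b\<in>UNIV. pft_sq (hor S b f) \<tau>"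
  have "4 * (c * norm \<tau>) * pft_sq f \<tau> \<le> 4 * (\<Sum>a\<in>UNIV. \<Sum>b\<in>UNIV. \<bar>Bmat_comb S \<tau> $ a $ b\<bar>) * pft_sq f \<tau>"
    by (intro mult_right_mono mult_left_mono c(2) pft_sq_nonneg) auto
  also have "\<dots> = (\<Sum>a\<in>UNIV. \<Sum>b\<in>UNIV. 4 * \<bar>Bmat_comb S \<tau> $ a $ b\<bar> * pft_sq f \<tau>)"
    by (simp add: sum_distrib_left sum_distrib_right)
  also have "\<dots> \<le> (\<Sum>a\<in>UNIV. \<Sum>b\<in>UNIV. pft_sq (hor S a f) \<tau> + pft_sq (hor S b f) \<tau>)"
    by (intro sum_mono uncertainty[OF S f])
  also have "\<dots> = 2 * real CARD('n \<times> 4) * ?M"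
    by (simp add: sum.distrib sum_distrib_left[symmetric] del: card_prod)
  finally show ?thesis using c(1) by (simp add: field_simps)
qed

lemma nn_integral_pft:
  assumes "continuous_on UNIV \<phi>" "vanishes R \<phi>"
  shows "(\<integral>\<^sup>+x. ennreal ((cmod (pft \<phi> \<tau> x))\<^sup>2) \<partial>lborel) = ennreal (pft_sq \<phi> \<tau>)"
  unfolding pft_sq_def
  by (rule nn_integral_eq_integral[OF integrable_cmod_sq[OF continuous_pft[OF assms] vanishes_pft[OF assms(2)]]]) simp

text \<open>Bessel's inequality in t for each fixed x, integrated over x; Tonelli exchanges the
  order of x and \<tau>.\<close>

lemma nn_integral_pft_sq:
  fixes \<phi> :: "'a::euclidean_space \<times> 'b::euclidean_space \<Rightarrow> complex"
  assumes c: "continuous_on UNIV \<phi>" and v: "vanishes R \<phi>"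
  shows "(\<integral>\<^sup>+\<tau>. ennreal (pft_sq \<phi> \<tau>) \<partial>lborel) \<le> ennreal ((2 * pi) ^ DIM('b) * (sqint \<phi>))"
proof -
  have m: "(\<lambda>z. ennreal ((cmod (pft \<phi> (snd z) (fst z)))\<^sup>2)) \<in> borel_measurable (lborel \<Otimes>\<^sub>M lborel)"
    using measurable_pft[OF c, measurable] by measurable
  have m\<phi>: "\<phi> \<in> borel_measurable (lborel \<Otimes>\<^sub>M lborel)"
    unfolding lborel_prod by (rule borel_measurable_lborel_continuous[OF c])
  have "(\<integral>\<^sup>+\<tau>. ennreal (pft_sq \<phi> \<tau>) \<partial>lborel) = (\<integral>\<^sup>+\<tau>. \<integral>\<^sup>+x. ennreal ((cmod (pft \<phi> \<tau> x))\<^sup>2) \<partial>lborel \<partial>lborel)"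
    by (simp only: nn_integral_pft[OF c v])
  also have "\<dots> = (\<integral>\<^sup>+x. \<integral>\<^sup>+\<tau>. ennreal ((cmod (pft \<phi> \<tau> x))\<^sup>2) \<partial>lborel \<partial>lborel)"
    using lborel_pair.nn_integral_snd[OF m] lborel.nn_integral_fst[OF m] by simp
  also have "\<dots> \<le> (\<integral>\<^sup>+x. ennreal ((2 * pi) ^ DIM('b)) * (\<integral>\<^sup>+t. ennreal ((cmod (\<phi> (x, t)))\<^sup>2) \<partial>lborel) \<partial>lborel)"
    unfolding pft_def by (intro nn_integral_mono bessel[where R=R] continuous_slice[OF c] vanishes_slice[OF v])
  also have "\<dots> = ennreal ((2 * pi) ^ DIM('b)) * (\<integral>\<^sup>+x. \<integral>\<^sup>+t. ennreal ((cmod (\<phi> (x, t)))\<^sup>2) \<partial>lborel \<partial>lborel)"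
    using m\<phi>[measurable] by (intro nn_integral_cmult) measurable
  also have "(\<integral>\<^sup>+x. \<integral>\<^sup>+t. ennreal ((cmod (\<phi> (x, t)))\<^sup>2) \<partial>lborel \<partial>lborel) = (\<integral>\<^sup>+p. ennreal ((cmod (\<phi> p))\<^sup>2) \<partial>(lborel \<Otimes>\<^sub>M lborel))"
    using m\<phi>[measurable] by (intro lborel.nn_integral_fst) measurable
  also have "\<dots> = ennreal (sqint \<phi>)"
    unfolding lborel_prod by (rule nn_integral_eq_integral[OF integrable_cmod_sq[OF c v]]) simp
  finally show ?thesis by (simp add: ennreal_mult)
qed

text \<open>By Fubini the full transform at (\<xi>, \<tau>). The integral in x is kept outermost so
  that estimates at fixed \<tau> can be inserted.\<close>

definition pft_fint :: "('a::euclidean_space \<times> 'b::euclidean_space \<Rightarrow> complex) \<Rightarrow> 'a \<Rightarrow> 'b \<Rightarrow> complex" where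
  "pft_fint \<phi> \<xi> \<tau> = (LINT x|lborel. cis (- (x \<bullet> \<xi>)) * pft \<phi> \<tau> x)"

lemma pft_fint_eq:
  fixes \<phi> :: "'a::euclidean_space \<times> 'b::euclidean_space \<Rightarrow> complex"
  assumes c: "continuous_on UNIV \<phi>" and v: "vanishes R \<phi>"
  shows "pft_fint \<phi> \<xi> \<tau> = (fint \<phi> (\<xi>, \<tau>))"
proof -
  have i: "integrable (lborel \<Otimes>\<^sub>M lborel) (\<lambda>p. cis (- (p \<bullet> (\<xi>, \<tau>))) * \<phi> p)"
    unfolding lborel_prod
    by (rule integrable_vanishes[OF continuous_on_mult[OF continuous_on_cis_inner c] vanishes_cis[OF v]])
  have "(fint \<phi> (\<xi>, \<tau>)) = (LINT x|lborel. LINT t|lborel. cis (- ((x, t) \<bullet> (\<xi>, \<tau>))) * \<phi> (x, t))"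
    using lborel_pair.integral_fst'[OF i] by (simp only: lborel_prod)
  also have "\<dots> = (LINT x|lborel. LINT t|lborel. cis (- (x \<bullet> \<xi>)) * (cis (- (t \<bullet> \<tau>)) * \<phi> (x, t)))"
    by (simp add: inner_Pair mult.assoc[symmetric] cis_mult)
  also have "\<dots> = pft_fint \<phi> \<xi> \<tau>"
    unfolding pft_fint_def pft_def by (simp only: integral_mult_right_zero)
  finally show ?thesis ..
qed

lemma measurable_transform:
  fixes \<phi> :: "'a::euclidean_space \<Rightarrow> complex"
  assumes c: "continuous_on UNIV \<phi>"
  shows "(\<lambda>\<zeta>. fint \<phi> \<zeta>) \<in> borel_measurable lborel"
proof -
  have "(\<lambda>(\<zeta>, p). cis (- (p \<bullet> \<zeta>)) * \<phi> p) \<in> borel_measurable (lborel \<Otimes>\<^sub>M lborel)"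
    unfolding lborel_prod split_beta
    by (intro borel_measurable_lborel_continuous continuous_intros continuous_on_compose2[OF c]) auto
  from lborel.borel_measurable_lebesgue_integral[OF this] show ?thesis by simp
qed

lemma nn_integral_pft_fint:
  fixes \<phi> :: "'a::euclidean_space \<times> 'b::euclidean_space \<Rightarrow> complex"
  assumes c: "continuous_on UNIV \<phi>" and v: "vanishes R \<phi>"
  shows "(\<integral>\<^sup>+\<xi>. ennreal ((cmod (pft_fint \<phi> \<xi> \<tau>))\<^sup>2) \<partial>lborel) \<le> ennreal ((2 * pi) ^ DIM('a) * pft_sq \<phi> \<tau>)"
proof -
  have "(\<integral>\<^sup>+\<xi>. ennreal ((cmod (pft_fint \<phi> \<xi> \<tau>))\<^sup>2) \<partial>lborel) \<le> ennreal ((2 * pi) ^ DIM('a)) * (\<integral>\<^sup>+x. ennreal ((cmod (pft \<phi> \<tau> x))\<^sup>2) \<partial>lborel)"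
    unfolding pft_fint_def by (rule bessel[OF continuous_pft[OF c v] vanishes_pft[OF v]])
  then show ?thesis by (simp add: nn_integral_pft[OF c v] ennreal_mult pft_sq_nonneg)
qed

lemma pft_fint_dderiv:
  fixes f :: "('n::finite) grp \<Rightarrow> complex"
  assumes f: "cdiff1 f" "vanishes R f"
  shows "pft_fint (dderiv (e_x b) f) \<xi> \<tau> = \<i> * of_real (\<xi> $ b) * pft_fint f \<xi> \<tau>"
proof -
  have "(LINT x|lborel. cis (- (x \<bullet> \<xi>)) * pft (dderiv (e_x b) f) \<tau> x) =
      \<i> * of_real (axis b 1 \<bullet> \<xi>) * (LINT x|lborel. cis (- (x \<bullet> \<xi>)) * pft f \<tau> x)"
    by (rule integral_cis_derivative[where R=R])
       (intro pft_derivative[OF f] continuous_pft[where R=R] vanishes_pft cdiff1_cont cdiff1_cont_dderiv vanishes_dderiv f)+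
  then show ?thesis by (simp add: pft_fint_def inner_axis')
qed

text \<open>The weight \<open>1 / (1 + |\<tau>|)\<close> compensates the growth of \<open>phase_coeff\<close> in \<open>\<tau>\<close>, by which \<open>\<partial>\<close> differs
  from the horizontal derivative.\<close>

lemma weight_bound:
  fixes \<xi> :: "real ^ 'm" and \<tau> :: "real ^ 'k"
  shows "(1 + (norm (\<xi>, \<tau>))\<^sup>2) powr (1/2) \<le> (2 + 2 * norm \<tau>) + 1 / (1 + norm \<tau>) * (\<Sum>b\<in>UNIV. (\<xi> $ b)\<^sup>2)"
proof -
  let ?a = "norm \<xi>" and ?b = "norm \<tau>"
  have "(1 + (norm (\<xi>, \<tau>))\<^sup>2) powr (1/2) = sqrt (1 + ?a\<^sup>2 + ?b\<^sup>2)"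
    by (simp add: powr_half_sqrt norm_Pair algebra_simps)
  also have "\<dots> \<le> sqrt ((1 + ?a + ?b)\<^sup>2)"
    by (rule real_sqrt_le_mono) (simp add: power2_eq_square algebra_simps)
  also have "\<dots> = 1 + ?a + ?b" by simp
  \<comment> \<open>This adds a second 1 + |\<tau>| to the one already present, which gives the 2 +
    2 |\<tau>| of the bound.\<close>
  also have "?a \<le> 1 / (1 + ?b) * ?a\<^sup>2 + (1 + ?b)"
  proof (cases "?a \<le> 1 + ?b")
    case True
    moreover have "0 \<le> 1 / (1 + ?b) * ?a\<^sup>2" by simp
    ultimately show ?thesis by linarith
  next
    case False
    then have "?a * (1 + ?b) \<le> ?a * ?a" by (intro mult_left_mono) auto
    then have "?a \<le> 1 / (1 + ?b) * ?a\<^sup>2" by (simp add: field_simps power2_eq_square add_pos_nonneg)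
    then show ?thesis using norm_ge_zero[of \<tau>] by linarith
  qed
  also have "?a\<^sup>2 = (\<Sum>b\<in>UNIV. (\<xi> $ b)\<^sup>2)" by (simp add: norm_vec_def L2_set_def sum_nonneg)
  finally show ?thesis by (simp add: algebra_simps)
qed

text \<open>In \<open>K\<close> the power of 2 pi is the cost of Bessel's inequality in x, the 4
  covers the terms free of |\<tau>|, and 2 + 2N \<open>phase_bound\<close>^2 is the total
  coefficient of |\<tau>| \<open>pft_sq f \<tau>\<close>, converted into horizontal terms at the
  rate N/(2c) of \<open>pft_sq_weighted\<close>.\<close>

lemma subelliptic_slice:
  fixes S :: "('n::finite) gram"
  assumes S: "transpose S = S" and f: "cdiff2 f" "vanishes R f" and R: "0 \<le> R"
    and c: "c > 0" "\<And>\<tau>. c * norm \<tau> \<le> (\<Sum>a\<in>UNIV. \<Sum>b\<in>UNIV. \<bar>Bmat_comb S \<tau> $ a $ b\<bar>)"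
  defines "N \<equiv> real CARD('n \<times> 4)"
  defines "K \<equiv> (2 * pi) ^ DIM(real ^ ('n \<times> 4)) * (4 + (2 + 2 * N * (phase_bound S R)\<^sup>2) * (N / (2 * c)))"
  shows "(\<integral>\<^sup>+\<xi>. ennreal ((1 + (norm (\<xi>, \<tau>))\<^sup>2) powr (1/2) * (cmod (pft_fint f \<xi> \<tau>))\<^sup>2) \<partial>lborel) \<le>
     ennreal (K * (pft_sq f \<tau> + (\<Sum>b\<in>UNIV. pft_sq (hor S b f) \<tau>)))"
proof -
  note f1 = cdiff2_cdiff1[OF f(1)]
  let ?P = "(2 * pi) ^ DIM(real ^ ('n \<times> 4))" and ?t = "norm \<tau>" and ?A = "phase_bound S R"
  let ?M = "\<Sum>b\<in>UNIV. pft_sq (hor S b f) \<tau>"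
  have mF: "(\<lambda>\<xi>. pft_fint g \<xi> \<tau>) \<in> borel_measurable lborel" if "continuous_on UNIV g" "vanishes R g" for g
    unfolding pft_fint_def by (rule measurable_transform[OF continuous_pft[OF that]])
  note [measurable] = mF[OF cdiff1_cont[OF f1] f(2)]
  have "(\<integral>\<^sup>+\<xi>. ennreal ((1 + (norm (\<xi>, \<tau>))\<^sup>2) powr (1/2) * (cmod (pft_fint f \<xi> \<tau>))\<^sup>2) \<partial>lborel) \<le>
     (\<integral>\<^sup>+\<xi>. ennreal (2 + 2 * ?t) * ennreal ((cmod (pft_fint f \<xi> \<tau>))\<^sup>2) +
        (\<Sum>b\<in>UNIV. ennreal (1 / (1 + ?t)) * ennreal ((cmod (pft_fint (dderiv (e_x b) f) \<xi> \<tau>))\<^sup>2)) \<partial>lborel)"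
  proof (rule nn_integral_mono)
    fix \<xi> :: "real ^ ('n \<times> 4)"
    let ?F = "(cmod (pft_fint f \<xi> \<tau>))\<^sup>2"
    have e: "(cmod (pft_fint (dderiv (e_x b) f) \<xi> \<tau>))\<^sup>2 = (\<xi> $ b)\<^sup>2 * ?F" for b
      by (simp add: pft_fint_dderiv[OF f1 f(2)] norm_mult power_mult_distrib)
    have "(1 + (norm (\<xi>, \<tau>))\<^sup>2) powr (1/2) * ?F \<le> ((2 + 2 * ?t) + 1 / (1 + ?t) * (\<Sum>b\<in>UNIV. (\<xi> $ b)\<^sup>2)) * ?F"
      by (intro mult_right_mono weight_bound) simp
    also have "\<dots> = (2 + 2 * ?t) * ?F + (\<Sum>b\<in>UNIV. 1 / (1 + ?t) * (cmod (pft_fint (dderiv (e_x b) f) \<xi> \<tau>))\<^sup>2)"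
      by (simp add: e distrib_right sum_distrib_right sum_distrib_left mult.assoc)
    finally have "ennreal ((1 + (norm (\<xi>, \<tau>))\<^sup>2) powr (1/2) * ?F) \<le>
        ennreal ((2 + 2 * ?t) * ?F + (\<Sum>b\<in>UNIV. 1 / (1 + ?t) * (cmod (pft_fint (dderiv (e_x b) f) \<xi> \<tau>))\<^sup>2))"
      by (rule ennreal_leI)
    also have "\<dots> = ennreal (2 + 2 * ?t) * ennreal ?F + (\<Sum>b\<in>UNIV. ennreal (1 / (1 + ?t)) * ennreal ((cmod (pft_fint (dderiv (e_x b) f) \<xi> \<tau>))\<^sup>2))"
    proof -
      have e: "ennreal (a * u + (\<Sum>b\<in>UNIV. k * w b)) = ennreal a * ennreal u + (\<Sum>b\<in>UNIV. ennreal k * ennreal (w b))"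
        if "0 \<le> a" "0 \<le> u" "0 \<le> k" "\<And>b. 0 \<le> w b" for a u k and w :: "'n \<times> 4 \<Rightarrow> real"
      proof -
        have "ennreal (a * u + (\<Sum>b\<in>UNIV. k * w b)) = ennreal (a * u) + ennreal (\<Sum>b\<in>UNIV. k * w b)"
          using that by (intro ennreal_plus) (auto intro!: sum_nonneg)
        also have "ennreal (\<Sum>b\<in>UNIV. k * w b) = (\<Sum>b\<in>UNIV. ennreal (k * w b))"
          using that by (intro sum_ennreal[symmetric]) auto
        finally show ?thesis using that by (simp only: ennreal_mult)
      qed
      show ?thesis by (rule e) auto
    qed
    finally show "ennreal ((1 + (norm (\<xi>, \<tau>))\<^sup>2) powr (1/2) * ?F) \<le> \<dots>" .
  qed
  also have "\<dots> = ennreal (2 + 2 * ?t) * (\<integral>\<^sup>+\<xi>. ennreal ((cmod (pft_fint f \<xi> \<tau>))\<^sup>2) \<partial>lborel) +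
      (\<Sum>b\<in>UNIV. ennreal (1 / (1 + ?t)) * (\<integral>\<^sup>+\<xi>. ennreal ((cmod (pft_fint (dderiv (e_x b) f) \<xi> \<tau>))\<^sup>2) \<partial>lborel))"
  proof -
    have [measurable]: "(\<lambda>\<xi>. pft_fint (dderiv (e_x b) f) \<xi> \<tau>) \<in> borel_measurable lborel" for b
      by (intro mF cdiff1_cont_dderiv vanishes_dderiv f1 f)
    show ?thesis by (subst nn_integral_add, measurable) (simp add: nn_integral_cmult nn_integral_sum)
  qed
  also have "\<dots> \<le> ennreal (2 + 2 * ?t) * ennreal (?P * pft_sq f \<tau>) + (\<Sum>b\<in>UNIV. ennreal (1 / (1 + ?t)) * ennreal (?P * pft_sq (dderiv (e_x b) f) \<tau>))"
    by (intro add_mono sum_mono mult_left_mono nn_integral_pft_fint[where R=R] cdiff1_cont cdiff1_cont_dderiv vanishes_dderiv f1 f) auto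
  also have "\<dots> = ennreal ((2 + 2 * ?t) * (?P * pft_sq f \<tau>) + (\<Sum>b\<in>UNIV. 1 / (1 + ?t) * (?P * pft_sq (dderiv (e_x b) f) \<tau>)))"
  proof -
    have "ennreal (1 / (1 + ?t)) * ennreal (?P * pft_sq (dderiv (e_x b) f) \<tau>) = ennreal (1 / (1 + ?t) * (?P * pft_sq (dderiv (e_x b) f) \<tau>))" for b
      by (rule ennreal_mult[symmetric]) (auto simp: pft_sq_nonneg)
    moreover have "ennreal (2 + 2 * ?t) * ennreal (?P * pft_sq f \<tau>) = ennreal ((2 + 2 * ?t) * (?P * pft_sq f \<tau>))"
      by (rule ennreal_mult[symmetric]) (auto simp: pft_sq_nonneg)
    moreover have "(\<Sum>b\<in>UNIV. ennreal (1 / (1 + ?t) * (?P * pft_sq (dderiv (e_x b) f) \<tau>))) = ennreal (\<Sum>b\<in>UNIV. 1 / (1 + ?t) * (?P * pft_sq (dderiv (e_x b) f) \<tau>))"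
      by (rule sum_ennreal) (auto simp: pft_sq_nonneg)
    ultimately show ?thesis
      by (simp only:) (rule ennreal_plus[symmetric], auto intro!: sum_nonneg simp: pft_sq_nonneg)
  qed
  also have "\<dots> \<le> ennreal (K * (pft_sq f \<tau> + ?M))"
  proof (rule ennreal_leI)
    have "(\<Sum>b\<in>UNIV. 1 / (1 + ?t) * (?P * pft_sq (dderiv (e_x b) f) \<tau>)) \<le> (\<Sum>b\<in>UNIV. ?P * (2 * pft_sq (hor S b f) \<tau> + 2 * ?A\<^sup>2 * (?t * pft_sq f \<tau>)))"
    proof (rule sum_mono)
      fix b
      have "1 / (1 + ?t) * pft_sq (dderiv (e_x b) f) \<tau> \<le> 1 / (1 + ?t) * (2 * pft_sq (hor S b f) \<tau> + 2 * (?A * ?t)\<^sup>2 * pft_sq f \<tau>)"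
        by (intro mult_left_mono pft_sq_dderiv[OF f1 f(2) R]) auto
      also have "\<dots> = 1 / (1 + ?t) * (2 * pft_sq (hor S b f) \<tau>) + ?t / (1 + ?t) * (2 * ?A\<^sup>2 * (?t * pft_sq f \<tau>))"
        by (simp add: distrib_left power_mult_distrib power2_eq_square)
      \<comment> \<open>The weight absorbs one of the two powers of |\<tau>| coming from the squared
        potential, as |\<tau>|/(1 + |\<tau>|) \<le> 1. The power left over is what
        \<open>pft_sq_weighted\<close> controls.\<close>
      also have "\<dots> \<le> 1 * (2 * pft_sq (hor S b f) \<tau>) + 1 * (2 * ?A\<^sup>2 * (?t * pft_sq f \<tau>))"
        by (intro add_mono mult_right_mono) (auto simp: pft_sq_nonneg add_pos_nonneg)
      finally have "1 / (1 + ?t) * pft_sq (dderiv (e_x b) f) \<tau> \<le> 2 * pft_sq (hor S b f) \<tau> + 2 * ?A\<^sup>2 * (?t * pft_sq f \<tau>)" by simp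
      then have "?P * (1 / (1 + ?t) * pft_sq (dderiv (e_x b) f) \<tau>) \<le> ?P * (2 * pft_sq (hor S b f) \<tau> + 2 * ?A\<^sup>2 * (?t * pft_sq f \<tau>))"
        by (rule mult_left_mono) simp
      then show "1 / (1 + ?t) * (?P * pft_sq (dderiv (e_x b) f) \<tau>) \<le> ?P * (2 * pft_sq (hor S b f) \<tau> + 2 * ?A\<^sup>2 * (?t * pft_sq f \<tau>))"
        by (simp add: mult.left_commute)
    qed
    also have "\<dots> = ?P * (2 * ?M + N * (2 * ?A\<^sup>2 * (?t * pft_sq f \<tau>)))"
      by (simp add: sum_distrib_left[symmetric] sum.distrib N_def del: card_prod)
    finally have "(2 + 2 * ?t) * (?P * pft_sq f \<tau>) + (\<Sum>b\<in>UNIV. 1 / (1 + ?t) * (?P * pft_sq (dderiv (e_x b) f) \<tau>)) \<le>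
       (2 + 2 * ?t) * (?P * pft_sq f \<tau>) + ?P * (2 * ?M + N * (2 * ?A\<^sup>2 * (?t * pft_sq f \<tau>)))" by simp
    also have "\<dots> = ?P * (2 * pft_sq f \<tau> + 2 * ?M + (2 + 2 * N * ?A\<^sup>2) * (?t * pft_sq f \<tau>))"
      by (simp add: algebra_simps)
    \<comment> \<open>The only place where the commutators enter: every remaining factor |\<tau>| is
      exchanged for horizontal derivatives.\<close>
    also have "\<dots> \<le> ?P * (2 * pft_sq f \<tau> + 2 * ?M + (2 + 2 * N * ?A\<^sup>2) * (N / (2 * c) * ?M))"
      using pft_sq_weighted[OF S f c(1) c(2)]
      by (intro mult_left_mono add_mono order_refl) (auto simp: N_def)
    also have "\<dots> \<le> K * (pft_sq f \<tau> + ?M)"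
    proof -
      define q where "q = (2 + 2 * N * ?A\<^sup>2) * (N / (2 * c))"
      have q: "0 \<le> q" using c(1) by (simp add: q_def N_def)
      have M: "0 \<le> ?M" by (intro sum_nonneg pft_sq_nonneg)
      have "2 * pft_sq f \<tau> + 2 * ?M + q * ?M \<le> (4 + q) * (pft_sq f \<tau> + ?M)"
        using q M pft_sq_nonneg[of f \<tau>] mult_nonneg_nonneg[OF q pft_sq_nonneg[of f \<tau>]] by (simp add: algebra_simps)
      then have "?P * (2 * pft_sq f \<tau> + 2 * ?M + q * ?M) \<le> ?P * ((4 + q) * (pft_sq f \<tau> + ?M))"
        by (rule mult_left_mono) simp
      then show ?thesis unfolding K_def q_def by (simp only: mult.assoc)
    qed
    finally show "(2 + 2 * ?t) * (?P * pft_sq f \<tau>) + (\<Sum>b\<in>UNIV. 1 / (1 + ?t) * (?P * pft_sq (dderiv (e_x b) f) \<tau>)) \<le> K * (pft_sq f \<tau> + ?M)" .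
  qed
  finally show ?thesis .
qed

text \<open>Integrates the slice estimate over \<tau>. The further factor \<open>Q\<close> is the
  cost of Bessel's inequality in the three central variables, applied to f and to each X_b
  f.\<close>

theorem subelliptic:
  fixes S :: "('n::finite) gram"
  assumes S: "transpose S = S" "stratified S" and R: "0 \<le> R"
  obtains C where "C > 0" "\<And>f. cdiff2 f \<Longrightarrow> vanishes R f \<Longrightarrow>
    (\<integral>\<^sup>+\<zeta>. ennreal ((1 + (norm \<zeta>)\<^sup>2) powr (1/2) * (cmod (fourier f \<zeta>))\<^sup>2) \<partial>lborel) \<le>
     ennreal (C * (energy S f + (sqint f)))"
proof -
  obtain c where c: "c > 0" "\<And>\<tau>. c * norm \<tau> \<le> (\<Sum>a\<in>UNIV. \<Sum>b\<in>UNIV. \<bar>Bmat_comb S \<tau> $ a $ b\<bar>)"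
    using stratified_lower_bound[OF S(2)] by metis
  define N where "N = real CARD('n \<times> 4)"
  define K where "K = (2 * pi) ^ DIM(real ^ ('n \<times> 4)) * (4 + (2 + 2 * N * (phase_bound S R)\<^sup>2) * (N / (2 * c)))"
  define Q where "Q = (2 * pi) ^ DIM(real ^ 3)"
  have K: "K > 0" unfolding K_def N_def using c(1) by (intro mult_pos_pos add_pos_nonneg) auto
  have Q: "Q > 0" by (simp add: Q_def)
  show ?thesis
  proof (rule that[of "K * Q"])
    show "K * Q > 0" using K Q by simp
    fix f :: "'n grp \<Rightarrow> complex" assume f: "cdiff2 f" "vanishes R f"
    note f1 = cdiff2_cdiff1[OF f(1)]
    note hor_coeff = cdiff1_cont[OF f1]
    let ?E = "LINT p|lborel. (cmod (f p))\<^sup>2"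
    let ?w = "\<lambda>\<zeta>::'n grp. (1 + (norm \<zeta>)\<^sup>2) powr (1/2)"
    let ?T = "\<lambda>\<zeta>. fint f \<zeta>"
    have m: "(\<lambda>\<zeta>. ennreal (?w \<zeta> * (cmod (?T \<zeta>))\<^sup>2)) \<in> borel_measurable (lborel \<Otimes>\<^sub>M lborel)"
      unfolding lborel_prod using measurable_transform[OF hor_coeff, measurable] by measurable
    have XXc: "continuous_on UNIV (hor S b f)" "vanishes R (hor S b f)" for b
      by (intro continuous_hor vanishes_hor f1 f)+
    have mN: "(\<lambda>\<tau>. ennreal (pft_sq g \<tau>)) \<in> borel_measurable lborel" if g: "continuous_on UNIV g" "vanishes R g" for g :: "'n grp \<Rightarrow> complex"
    proof -
      have "(\<lambda>z. ennreal ((cmod (pft g (snd z) (fst z)))\<^sup>2)) \<in> borel_measurable (lborel \<Otimes>\<^sub>M lborel)"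
        using measurable_pft[OF g(1), measurable] by measurable
      then have "(\<lambda>(\<tau>, x). ennreal ((cmod (pft g \<tau> x))\<^sup>2)) \<in> borel_measurable (lborel \<Otimes>\<^sub>M lborel)"
        unfolding measurable_pair_swap_iff[of "\<lambda>z. ennreal ((cmod (pft g (snd z) (fst z)))\<^sup>2)"] by (simp add: split_beta)
      then have "(\<lambda>\<tau>. \<integral>\<^sup>+x. ennreal ((cmod (pft g \<tau> x))\<^sup>2) \<partial>lborel) \<in> borel_measurable lborel"
        by (rule lborel.borel_measurable_nn_integral)
      then show ?thesis by (simp only: nn_integral_pft[OF g])
    qed
    have le1: "(2 * pi) powr (- real DIM('n grp) / 2) \<le> 1"
    proof -
      have "1 \<le> 2 * pi" using pi_gt3 by linarith
      then have "(2 * pi) powr (- real DIM('n grp) / 2) \<le> (2 * pi) powr 0" by (intro powr_mono) auto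
      then show ?thesis using pi_gt_zero by simp
    qed
    have fle: "(cmod (fourier f \<zeta>))\<^sup>2 \<le> (cmod (?T \<zeta>))\<^sup>2" for \<zeta>
    proof (rule power_mono)
      have "cmod (fourier f \<zeta>) = (2 * pi) powr (- real DIM('n grp) / 2) * cmod (?T \<zeta>)"
        unfolding fourier_def norm_mult by simp
      also have "\<dots> \<le> 1 * cmod (?T \<zeta>)" by (intro mult_right_mono le1) simp
      finally show "cmod (fourier f \<zeta>) \<le> cmod (?T \<zeta>)" by simp
    qed simp
    have "(\<integral>\<^sup>+\<zeta>. ennreal (?w \<zeta> * (cmod (fourier f \<zeta>))\<^sup>2) \<partial>lborel) \<le> (\<integral>\<^sup>+\<zeta>. ennreal (?w \<zeta> * (cmod (?T \<zeta>))\<^sup>2) \<partial>lborel)"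
      by (intro nn_integral_mono ennreal_leI mult_left_mono fle) simp
    also have "\<dots> = (\<integral>\<^sup>+\<tau>. \<integral>\<^sup>+\<xi>. ennreal (?w (\<xi>, \<tau>) * (cmod (?T (\<xi>, \<tau>)))\<^sup>2) \<partial>lborel \<partial>lborel)"
      using lborel_pair.nn_integral_snd[OF m] by (simp add: lborel_prod)
    also have "\<dots> = (\<integral>\<^sup>+\<tau>. \<integral>\<^sup>+\<xi>. ennreal (?w (\<xi>, \<tau>) * (cmod (pft_fint f \<xi> \<tau>))\<^sup>2) \<partial>lborel \<partial>lborel)"
      by (simp only: pft_fint_eq[OF hor_coeff f(2)])
    also have "\<dots> \<le> (\<integral>\<^sup>+\<tau>. ennreal (K * (pft_sq f \<tau> + (\<Sum>b\<in>UNIV. pft_sq (hor S b f) \<tau>))) \<partial>lborel)"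
      unfolding K_def N_def by (intro nn_integral_mono subelliptic_slice[OF S(1) f R c])
    also have "\<dots> = (\<integral>\<^sup>+\<tau>. ennreal K * (ennreal (pft_sq f \<tau>) + (\<Sum>b\<in>UNIV. ennreal (pft_sq (hor S b f) \<tau>))) \<partial>lborel)"
    proof (rule nn_integral_cong)
      fix \<tau>
      have "ennreal (K * (pft_sq f \<tau> + (\<Sum>b\<in>UNIV. pft_sq (hor S b f) \<tau>))) = ennreal K * ennreal (pft_sq f \<tau> + (\<Sum>b\<in>UNIV. pft_sq (hor S b f) \<tau>))"
        using K by (intro ennreal_mult) (auto intro!: add_nonneg_nonneg sum_nonneg pft_sq_nonneg)
      also have "ennreal (pft_sq f \<tau> + (\<Sum>b\<in>UNIV. pft_sq (hor S b f) \<tau>)) = ennreal (pft_sq f \<tau>) + ennreal (\<Sum>b\<in>UNIV. pft_sq (hor S b f) \<tau>)"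
        by (intro ennreal_plus pft_sq_nonneg sum_nonneg)
      also have "ennreal (\<Sum>b\<in>UNIV. pft_sq (hor S b f) \<tau>) = (\<Sum>b\<in>UNIV. ennreal (pft_sq (hor S b f) \<tau>))"
        by (rule sum_ennreal[symmetric]) (rule pft_sq_nonneg)
      finally show "ennreal (K * (pft_sq f \<tau> + (\<Sum>b\<in>UNIV. pft_sq (hor S b f) \<tau>))) = ennreal K * (ennreal (pft_sq f \<tau>) + (\<Sum>b\<in>UNIV. ennreal (pft_sq (hor S b f) \<tau>)))" .
    qed
    also have "\<dots> = ennreal K * ((\<integral>\<^sup>+\<tau>. ennreal (pft_sq f \<tau>) \<partial>lborel) + (\<Sum>b\<in>UNIV. \<integral>\<^sup>+\<tau>. ennreal (pft_sq (hor S b f) \<tau>) \<partial>lborel))"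
    proof -
      note [measurable] = mN[OF hor_coeff f(2)] mN[OF XXc]
      show ?thesis
        by (subst nn_integral_cmult, measurable) (subst nn_integral_add, measurable, subst nn_integral_sum, measurable)
    qed
    also have "\<dots> \<le> ennreal K * (ennreal (Q * ?E) + (\<Sum>b\<in>UNIV. ennreal (Q * (sqint (hor S b f)))))"
      unfolding Q_def by (intro mult_left_mono add_mono sum_mono nn_integral_pft_sq[where R=R] XXc hor_coeff f) auto
    also have "\<dots> = ennreal (K * (Q * ?E + (\<Sum>b\<in>UNIV. Q * (sqint (hor S b f)))))"
    proof -
      have "(\<Sum>b\<in>UNIV. ennreal (Q * (sqint (hor S b f)))) = ennreal (\<Sum>b\<in>UNIV. Q * (sqint (hor S b f)))"
        using Q by (intro sum_ennreal) auto
      moreover have "ennreal (Q * ?E) + ennreal (\<Sum>b\<in>UNIV. Q * (sqint (hor S b f))) =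
          ennreal (Q * ?E + (\<Sum>b\<in>UNIV. Q * (sqint (hor S b f))))"
        using Q by (intro ennreal_plus[symmetric]) (auto intro!: sum_nonneg)
      ultimately show ?thesis
        using K Q by (simp only:) (intro ennreal_mult[symmetric], auto intro!: sum_nonneg add_nonneg_nonneg)
    qed
    also have "K * (Q * ?E + (\<Sum>b\<in>UNIV. Q * (sqint (hor S b f)))) = K * Q * (energy S f + ?E)"
      by (simp add: energy_def sum_distrib_left[symmetric] algebra_simps)
    finally show "(\<integral>\<^sup>+\<zeta>. ennreal (?w \<zeta> * (cmod (fourier f \<zeta>))\<^sup>2) \<partial>lborel) \<le> ennreal (K * Q * (energy S f + ?E))" .
  qed
qed

subsection \<open>Hermitian inner products on finite-dimensional spaces of functions\<close>

text \<open>The coefficients with respect to the spanning family \<open>w\<close> are the values \<open>u j\<close> themselves. The family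
  need not be linearly independent, which allows antisymmetrized unit vectors for two-forms.\<close>

definition framed :: "('i \<Rightarrow> complex) set \<Rightarrow> 'i set \<Rightarrow> ('i \<Rightarrow> 'i \<Rightarrow> complex) \<Rightarrow> bool" where
  "framed V J w \<longleftrightarrow> finite J \<and> (\<lambda>_. 0) \<in> V \<and> (\<forall>u\<in>V. \<forall>v\<in>V. (\<lambda>i. u i + v i) \<in> V) \<and>
     (\<forall>c. \<forall>u\<in>V. (\<lambda>i. c * u i) \<in> V) \<and> (\<forall>j\<in>J. w j \<in> V) \<and> (\<forall>u\<in>V. \<forall>i. u i = (\<Sum>j\<in>J. u j * w j i))"

lemma framed_sum:
  assumes "framed V J w" "finite F" "F \<subseteq> J"
  shows "(\<lambda>i. \<Sum>j\<in>F. z j * w j i) \<in> V"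
  using assms(2,3)
proof (induction F rule: finite_induct)
  case empty
  then show ?case using assms(1) by (simp add: framed_def)
next
  case (insert j F)
  then show ?case using assms(1) by (simp add: framed_def)
qed

lemma
  assumes h: "hermitian_inner V h" and u: "u \<in> V"
  shows hermitian_add: "v \<in> V \<Longrightarrow> w \<in> V \<Longrightarrow> h (\<lambda>i. u i + v i) w = h u w + h v w"
    and hermitian_scale: "w \<in> V \<Longrightarrow> h (\<lambda>i. c * u i) w = c * h u w"
    and hermitian_swap: "w \<in> V \<Longrightarrow> h w u = cnj (h u w)"
    and hermitian_pos: "u \<noteq> (\<lambda>_. 0) \<Longrightarrow> Re (h u u) > 0"
proof -
  note h' = h[unfolded hermitian_inner_def]
  show "v \<in> V \<Longrightarrow> w \<in> V \<Longrightarrow> h (\<lambda>i. u i + v i) w = h u w + h v w"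
    by (rule h'[THEN conjunct1, rule_format]) (rule u)
  show "w \<in> V \<Longrightarrow> h (\<lambda>i. c * u i) w = c * h u w"
    by (rule h'[THEN conjunct2, THEN conjunct1, rule_format]) (rule u)
  show "w \<in> V \<Longrightarrow> h w u = cnj (h u w)"
    by (rule h'[THEN conjunct2, THEN conjunct2, THEN conjunct1, rule_format]) (rule u)
  show "u \<noteq> (\<lambda>_. 0) \<Longrightarrow> Re (h u u) > 0"
    by (rule h'[THEN conjunct2, THEN conjunct2, THEN conjunct2, rule_format]) (rule u)
qed

lemma hermitian_sum_left:
  assumes V: "framed V J w" and h: "hermitian_inner V h" and F: "finite F" "F \<subseteq> J" and v: "v \<in> V"
  shows "h (\<lambda>i. \<Sum>j\<in>F. z j * w j i) v = (\<Sum>j\<in>F. z j * h (w j) v)"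
  using F
proof (induction F rule: finite_induct)
  case empty
  have "h (\<lambda>i. 0 * v i) v = 0 * h v v" by (rule hermitian_scale[OF h v v])
  then show ?case by simp
next
  case (insert j F)
  have 1: "(\<lambda>i. \<Sum>j\<in>F. z j * w j i) \<in> V" by (rule framed_sum[OF V]) (use insert in auto)
  have 2: "w j \<in> V" "(\<lambda>i. z j * w j i) \<in> V" using V insert.prems by (auto simp: framed_def)
  have "h (\<lambda>i. z j * w j i + (\<Sum>j\<in>F. z j * w j i)) v = h (\<lambda>i. z j * w j i) v + h (\<lambda>i. \<Sum>j\<in>F. z j * w j i) v"
    by (rule hermitian_add[OF h 2(2) 1 v])
  also have "h (\<lambda>i. z j * w j i) v = z j * h (w j) v"
    by (rule hermitian_scale[OF h 2(1) v])
  finally show ?case using insert by simp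
qed

lemma hermitian_expand:
  assumes V: "framed V J w" and h: "hermitian_inner V h" and u: "u \<in> V"
  shows "h u u = (\<Sum>j\<in>J. \<Sum>l\<in>J. u j * cnj (u l) * h (w j) (w l))"
proof -
  have fin: "finite J" and wV: "\<And>j. j \<in> J \<Longrightarrow> w j \<in> V" using V by (auto simp: framed_def)
  have eq: "(\<lambda>i. \<Sum>j\<in>J. u j * w j i) = u"
    using V u by (intro ext) (simp add: framed_def)
  have sl: "h u v = (\<Sum>j\<in>J. u j * h (w j) v)" if "v \<in> V" for v
    using hermitian_sum_left[OF V h fin subset_refl that, of u] by (simp only: eq)
  have sr: "h (w j) u = (\<Sum>l\<in>J. cnj (u l) * h (w j) (w l))" if j: "j \<in> J" for j
  proof -
    have sw: "h a b = cnj (h b a)" if "a \<in> V" "b \<in> V" for a b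
      by (rule hermitian_swap[OF h that(2) that(1)])
    have "h (w j) u = cnj (\<Sum>l\<in>J. u l * h (w l) (w j))"
      unfolding sw[OF wV[OF j] u] sl[OF wV[OF j]] ..
    also have "\<dots> = (\<Sum>l\<in>J. cnj (u l) * cnj (h (w l) (w j)))" by simp
    also have "\<dots> = (\<Sum>l\<in>J. cnj (u l) * h (w j) (w l))"
      by (intro sum.cong refl) (simp only: sw[OF wV[OF j] wV])
    finally show ?thesis .
  qed
  show ?thesis unfolding sl[OF u]
    by (intro sum.cong refl) (simp add: sr sum_distrib_left mult.assoc)
qed

lemma hermitian_nonneg:
  assumes V: "framed V J w" and h: "hermitian_inner V h" and u: "u \<in> V"
  shows "0 \<le> Re (h u u)"
proof (cases "u = (\<lambda>_. 0)")
  case True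
  have "h (\<lambda>i. 0 * u i) u = 0 * h u u" by (rule hermitian_scale[OF h u u])
  then show ?thesis by (simp add: True)
next
  case False
  then show ?thesis by (intro less_imp_le hermitian_pos[OF h u])
qed

lemma hermitian_upper:
  assumes V: "framed V J w" and h: "hermitian_inner V h"
  obtains C where "C > 0" "\<And>u. u \<in> V \<Longrightarrow> Re (h u u) \<le> C * (\<Sum>j\<in>J. (cmod (u j))\<^sup>2)"
proof (rule that)
  let ?H = "\<Sum>j\<in>J. \<Sum>l\<in>J. cmod (h (w j) (w l))"
  have fin: "finite J" using V by (simp add: framed_def)
  show "?H + 1 > 0" by (intro add_nonneg_pos sum_nonneg) auto
  fix u assume u: "u \<in> V"
  let ?s = "\<Sum>j\<in>J. (cmod (u j))\<^sup>2"
  have s: "0 \<le> ?s" by (intro sum_nonneg) auto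
  have mem: "(cmod (u j))\<^sup>2 \<le> ?s" if "j \<in> J" for j
    by (rule member_le_sum[OF that]) (use fin in auto)
  have "Re (h u u) \<le> cmod (h u u)" by (rule complex_Re_le_cmod)
  also have "\<dots> \<le> (\<Sum>j\<in>J. \<Sum>l\<in>J. cmod (u j * cnj (u l) * h (w j) (w l)))"
    unfolding hermitian_expand[OF V h u] by (rule order_trans[OF norm_sum]) (intro sum_mono norm_sum)
  also have "\<dots> \<le> (\<Sum>j\<in>J. \<Sum>l\<in>J. ?s * cmod (h (w j) (w l)))"
  proof (intro sum_mono)
    fix j l assume jl: "j \<in> J" "l \<in> J"
    have "2 * (cmod (u j) * cmod (u l)) \<le> (cmod (u j))\<^sup>2 + (cmod (u l))\<^sup>2"
      using sum_squares_bound[of "cmod (u j)" "cmod (u l)"] by simp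
    then have "cmod (u j) * cmod (u l) \<le> ?s" using mem[OF jl(1)] mem[OF jl(2)] by linarith
    then show "cmod (u j * cnj (u l) * h (w j) (w l)) \<le> ?s * cmod (h (w j) (w l))"
      by (simp add: norm_mult mult_right_mono)
  qed
  also have "\<dots> = ?s * ?H" by (simp add: sum_distrib_left)
  also have "\<dots> \<le> (?H + 1) * ?s" using s by (simp add: algebra_simps)
  finally show "Re (h u u) \<le> (?H + 1) * ?s" .
qed

text \<open>The unit sphere of \<open>V\<close> is compact in the product topology although the
  index type may be infinite: the frame bounds every coordinate by the finitely many in
  \<open>J\<close>, and Tychonoff's theorem applies. A positive continuous function then has a
  positive minimum.\<close>

lemma hermitian_lower:
  fixes V :: "('i \<Rightarrow> complex) set"
  assumes V: "framed V J w" and h: "hermitian_inner V h"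
  obtains c where "c > 0" "\<And>u. u \<in> V \<Longrightarrow> c * (\<Sum>j\<in>J. (cmod (u j))\<^sup>2) \<le> Re (h u u)"
proof -
  have fin: "finite J" using V by (simp add: framed_def)
  have Vrep: "u i = (\<Sum>j\<in>J. u j * w j i)" if "u \<in> V" for u i
    using V that unfolding framed_def by blast
  \<comment> \<open>With \<open>Vrep\<close> this describes \<open>V\<close> by equations between
    finitely many coordinates each, so that the sphere is closed.\<close>
  have VI: "u \<in> V" if "\<And>i. u i = (\<Sum>j\<in>J. u j * w j i)" for u
  proof -
    have "(\<lambda>i. \<Sum>j\<in>J. u j * w j i) = u" by (intro ext that[symmetric])
    then show ?thesis using framed_sum[OF V fin subset_refl, of u] by simp
  qed
  define K where "K = {u. (\<forall>i. u i = (\<Sum>j\<in>J. u j * w j i)) \<and> (\<Sum>j\<in>J. (cmod (u j))\<^sup>2) = 1}"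
  have coord: "continuous_on UNIV (\<lambda>u::'i \<Rightarrow> complex. u i)" for i
    by (rule continuous_on_product_coordinates)
  have "closed K"
    unfolding K_def
    by (intro closed_Collect_conj closed_Collect_all closed_Collect_eq continuous_intros coord)
  moreover have "compact (PiE UNIV (\<lambda>i. cball (0::complex) (\<Sum>j\<in>J. cmod (w j i))))"
    unfolding compactin_euclidean_iff[symmetric] euclidean_product_topology[symmetric] compactin_PiE
    by simp
  moreover have "K \<subseteq> PiE UNIV (\<lambda>i. cball (0::complex) (\<Sum>j\<in>J. cmod (w j i)))"
  proof
    fix u assume u: "u \<in> K"
    have "cmod (u i) \<le> (\<Sum>j\<in>J. cmod (w j i))" for i
    proof -
      have "cmod (u i) \<le> (\<Sum>j\<in>J. cmod (u j * w j i))"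
      proof -
        have "u i = (\<Sum>j\<in>J. u j * w j i)" using u unfolding K_def by blast
        then show ?thesis by (metis norm_sum)
      qed
      also have "\<dots> \<le> (\<Sum>j\<in>J. 1 * cmod (w j i))"
      proof (rule sum_mono)
        fix j assume j: "j \<in> J"
        have "(cmod (u j))\<^sup>2 \<le> (\<Sum>j\<in>J. (cmod (u j))\<^sup>2)" by (rule member_le_sum[OF j]) (use fin in auto)
        also have "\<dots> = 1" using u unfolding K_def by blast
        finally have "cmod (u j) \<le> 1" by (simp add: abs_square_le_1)
        then show "cmod (u j * w j i) \<le> 1 * cmod (w j i)" unfolding norm_mult by (rule mult_right_mono) simp
      qed
      finally show ?thesis by simp
    qed
    then show "u \<in> PiE UNIV (\<lambda>i. cball (0::complex) (\<Sum>j\<in>J. cmod (w j i)))" by (auto simp: PiE_UNIV_domain)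
  qed
  ultimately have cK: "compact K" using compact_Int_closed inf.absorb_iff2 by metis
  \<comment> \<open>The squared norm as a formula in finitely many coordinates, from which
    continuity is visible; for \<open>h\<close> itself no continuity is assumed.\<close>
  define q where "q u = Re (\<Sum>j\<in>J. \<Sum>l\<in>J. u j * cnj (u l) * h (w j) (w l))" for u :: "'i \<Rightarrow> complex"
  have qh: "q u = Re (h u u)" if "u \<in> V" for u
    unfolding q_def hermitian_expand[OF V h that] ..
  have cq: "continuous_on K q"
    unfolding q_def by (intro continuous_intros continuous_on_subset[OF coord]) auto
  obtain c where c: "c > 0" "\<And>u. u \<in> K \<Longrightarrow> c \<le> q u"
  \<comment> \<open>The sphere is empty when \<open>V\<close> contains only 0, and then any positive
    constant will do.\<close>
  proof (cases "K = {}")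
    case True then show ?thesis using that[of 1] by simp
  next
    case False
    from continuous_attains_inf[OF cK False cq] obtain u0 where u0: "u0 \<in> K" "\<And>u. u \<in> K \<Longrightarrow> q u0 \<le> q u" by blast
    have "(\<Sum>j\<in>J. (cmod (u0 j))\<^sup>2) = 1" using u0(1) unfolding K_def by blast
    then have "u0 \<noteq> (\<lambda>_. 0)" by auto
    moreover have u0V: "u0 \<in> V"
      using u0(1) unfolding K_def by (intro VI) (elim CollectE conjE, erule spec)
    ultimately have "q u0 > 0" unfolding qh[OF u0V] by (intro hermitian_pos[OF h u0V])
    with u0 that show ?thesis by blast
  qed
  show ?thesis
  proof (rule that[OF c(1)])
    fix u assume u: "u \<in> V"
    let ?s = "\<Sum>j\<in>J. (cmod (u j))\<^sup>2"
    show "c * ?s \<le> Re (h u u)"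
    proof (cases "?s = 0")
      case True then show ?thesis using hermitian_nonneg[OF V h u] by simp
    next
      case False
      then have s: "?s > 0" by (simp add: order.not_eq_order_implies_strict sum_nonneg)
      let ?r = "complex_of_real (1 / sqrt ?s)"
      let ?v = "\<lambda>i. ?r * u i"
      have "?v \<in> K"
      proof -
        have "?v i = (\<Sum>j\<in>J. ?v j * w j i)" for i
          by (subst Vrep[OF u, of i]) (simp only: sum_distrib_left mult.assoc)
        moreover have "(\<Sum>j\<in>J. (cmod (?v j))\<^sup>2) = (1 / sqrt ?s)\<^sup>2 * ?s"
          by (simp only: norm_mult norm_of_real power_mult_distrib power2_abs sum_distrib_left)
        moreover have "(1 / sqrt ?s)\<^sup>2 * ?s = 1" using s by (simp add: power_divide)
        ultimately show ?thesis unfolding K_def by (intro CollectI conjI allI) (assumption | metis)+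
      qed
      then have "c \<le> q ?v" by (rule c(2))
      also have "q ?v = Re (\<Sum>j\<in>J. \<Sum>l\<in>J. complex_of_real ((1 / sqrt ?s)\<^sup>2) * (u j * cnj (u l) * h (w j) (w l)))"
        unfolding q_def by (simp add: power2_eq_square ac_simps)
      also have "\<dots> = (1 / sqrt ?s)\<^sup>2 * q u"
        by (simp only: sum_distrib_left[symmetric] q_def Re_complex_of_real times_complex.simps Im_complex_of_real)
      also have "\<dots> = q u / ?s" using s by (simp add: power_divide)
      finally show ?thesis using s by (simp add: field_simps qh[OF u])
    qed
  qed
qed

lemma framed_Re_integrable:
  fixes F :: "'p::euclidean_space \<Rightarrow> 'i \<Rightarrow> complex"
  assumes V: "framed V J w" and h: "hermitian_inner V h" and F: "\<And>p. F p \<in> V"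
    and c: "\<And>j. continuous_on UNIV (\<lambda>p. F p j)" and v: "\<And>j. vanishes R (\<lambda>p. F p j)"
  shows "integrable lborel (\<lambda>p. Re (h (F p) (F p)))"
proof -
  have "integrable lborel (\<lambda>p. F p j * cnj (F p l) * h (w j) (w l))" for j l
    by (intro integrable_mult_vanishes[where R=R] vanishes_mult v continuous_on_mult continuous_on_cnj c continuous_on_const)
  then show ?thesis unfolding hermitian_expand[OF V h F]
    by (intro integrable_Re Bochner_Integration.integrable_sum)
qed

lemma
  fixes F :: "'p::euclidean_space \<Rightarrow> 'i \<Rightarrow> complex"
  assumes V: "framed V J w" and h: "hermitian_inner V h" and F: "\<And>p. F p \<in> V"
    and c: "\<And>j. continuous_on UNIV (\<lambda>p. F p j)" and v: "\<And>j. vanishes R (\<lambda>p. F p j)"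
    and k: "\<And>u. u \<in> V \<Longrightarrow> k * (\<Sum>j\<in>J. (cmod (u j))\<^sup>2) \<le> Re (h u u)"
  shows L2_norm_lower: "k * (\<Sum>j\<in>J. LINT p|lborel. (cmod (F p j))\<^sup>2) \<le> (L2_norm h F)\<^sup>2"
proof -
  have i: "integrable lborel (\<lambda>p. (cmod (F p j))\<^sup>2)" for j by (rule integrable_cmod_sq[OF c v])
  have nn: "0 \<le> (LINT p|lborel. Re (h (F p) (F p)))"
    by (intro Bochner_Integration.integral_nonneg hermitian_nonneg[OF V h F])
  have "k * (\<Sum>j\<in>J. LINT p|lborel. (cmod (F p j))\<^sup>2) = (LINT p|lborel. k * (\<Sum>j\<in>J. (cmod (F p j))\<^sup>2))"
    by (simp add: i)
  also have "\<dots> \<le> (LINT p|lborel. Re (h (F p) (F p)))"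
    by (intro integral_mono framed_Re_integrable[OF V h F c v] k F integrable_mult_right Bochner_Integration.integrable_sum i)
  also have "\<dots> = (L2_norm h F)\<^sup>2" unfolding L2_norm_def using nn by simp
  finally show ?thesis .
qed

lemma measurable_fourier:
  fixes \<phi> :: "'a::euclidean_space \<Rightarrow> complex"
  assumes c: "continuous_on UNIV \<phi>"
  shows "fourier \<phi> \<in> borel_measurable lborel"
  unfolding fourier_def[abs_def] using measurable_transform[OF c, measurable] by measurable

text \<open>The component bounds enter as nonnegative integrals, the form in which
  \<open>subelliptic\<close> delivers them. \<open>integral_real_bounded\<close> returns to the
  Lebesgue integral without a separate integrability proof.\<close>

lemma sobolev_norm_upper:
  fixes F :: "'p::euclidean_space \<Rightarrow> 'i \<Rightarrow> complex"
  assumes V: "framed V J w" and h: "hermitian_inner V h" and F: "\<And>\<xi>. (\<lambda>i. fourier (\<lambda>p. F p i) \<xi>) \<in> V"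
    and c: "\<And>j. continuous_on UNIV (\<lambda>p. F p j)"
    and k: "\<And>u. u \<in> V \<Longrightarrow> Re (h u u) \<le> k * (\<Sum>j\<in>J. (cmod (u j))\<^sup>2)" "0 \<le> k"
    and b: "\<And>j. j \<in> J \<Longrightarrow> (\<integral>\<^sup>+\<xi>. ennreal ((1 + (norm \<xi>)\<^sup>2) powr s * (cmod (fourier (\<lambda>p. F p j) \<xi>))\<^sup>2) \<partial>lborel) \<le> ennreal (B j)" 
      "\<And>j. j \<in> J \<Longrightarrow> 0 \<le> B j"
  shows "(sobolev_norm h s F)\<^sup>2 \<le> k * (\<Sum>j\<in>J. B j)"
proof -
  let ?u = "\<lambda>\<xi> i. fourier (\<lambda>p. F p i) \<xi>" and ?w = "\<lambda>\<xi>::'p. (1 + (norm \<xi>)\<^sup>2) powr s"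
  have B: "0 \<le> k * (\<Sum>j\<in>J. B j)" by (intro mult_nonneg_nonneg sum_nonneg k b)
  have nn: "0 \<le> (LINT \<xi>|lborel. ?w \<xi> * Re (h (?u \<xi>) (?u \<xi>)))"
    by (intro Bochner_Integration.integral_nonneg mult_nonneg_nonneg hermitian_nonneg[OF V h F]) simp
  have "(\<integral>\<^sup>+\<xi>. ennreal (?w \<xi> * Re (h (?u \<xi>) (?u \<xi>))) \<partial>lborel) \<le>
      (\<integral>\<^sup>+\<xi>. ennreal k * (\<Sum>j\<in>J. ennreal (?w \<xi> * (cmod (?u \<xi> j))\<^sup>2)) \<partial>lborel)"
  proof (rule nn_integral_mono)
    fix \<xi>
    have "?w \<xi> * Re (h (?u \<xi>) (?u \<xi>)) \<le> ?w \<xi> * (k * (\<Sum>j\<in>J. (cmod (?u \<xi> j))\<^sup>2))"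
      by (intro mult_left_mono k F) simp
    also have "\<dots> = k * (\<Sum>j\<in>J. ?w \<xi> * (cmod (?u \<xi> j))\<^sup>2)" by (simp add: sum_distrib_left ac_simps)
    finally have "ennreal (?w \<xi> * Re (h (?u \<xi>) (?u \<xi>))) \<le> ennreal (k * (\<Sum>j\<in>J. ?w \<xi> * (cmod (?u \<xi> j))\<^sup>2))"
      by (rule ennreal_leI)
    also have "\<dots> = ennreal k * ennreal (\<Sum>j\<in>J. ?w \<xi> * (cmod (?u \<xi> j))\<^sup>2)"
      by (intro ennreal_mult k sum_nonneg) simp
    also have "ennreal (\<Sum>j\<in>J. ?w \<xi> * (cmod (?u \<xi> j))\<^sup>2) = (\<Sum>j\<in>J. ennreal (?w \<xi> * (cmod (?u \<xi> j))\<^sup>2))"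
      by (intro sum_ennreal[symmetric]) simp
    finally show "ennreal (?w \<xi> * Re (h (?u \<xi>) (?u \<xi>))) \<le> ennreal k * (\<Sum>j\<in>J. ennreal (?w \<xi> * (cmod (?u \<xi> j))\<^sup>2))" .
  qed
  also have "\<dots> = ennreal k * (\<Sum>j\<in>J. \<integral>\<^sup>+\<xi>. ennreal (?w \<xi> * (cmod (?u \<xi> j))\<^sup>2) \<partial>lborel)"
  proof -
    have [measurable]: "(\<lambda>\<xi>. ?u \<xi> j) \<in> borel_measurable lborel" for j
      using measurable_fourier[OF c[of j]] by simp
    show ?thesis by (subst nn_integral_cmult, measurable) (subst nn_integral_sum, measurable)
  qed
  also have "\<dots> \<le> ennreal k * (\<Sum>j\<in>J. ennreal (B j))"
    by (intro mult_left_mono sum_mono b) auto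
  also have "\<dots> = ennreal (k * (\<Sum>j\<in>J. B j))"
    using b k by (simp add: sum_ennreal ennreal_mult sum_nonneg)
  finally have "(LINT \<xi>|lborel. ?w \<xi> * Re (h (?u \<xi>) (?u \<xi>))) \<le> k * (\<Sum>j\<in>J. B j)"
    by (intro integral_real_bounded B)
  then show ?thesis unfolding sobolev_norm_def using nn by simp
qed

subsection \<open>The operator \<open>D0\<close>\<close>

definition supported_on :: "'i set \<Rightarrow> ('i \<Rightarrow> complex) set" where
  "supported_on J = {u. \<forall>x. x \<notin> J \<longrightarrow> u x = 0}"

definition idx_set :: "nat \<Rightarrow> nat \<Rightarrow> 'n idx set" where
  "idx_set \<sigma> \<tau> = {(i, j, L). i + j = \<sigma> \<and> length L = \<tau>}"

lemma finite_idx_set: "finite (idx_set \<sigma> \<tau> :: ('n::finite) idx set)"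
proof (rule finite_subset)
  show "idx_set \<sigma> \<tau> \<subseteq> {..\<sigma>} \<times> {..\<sigma>} \<times> {L :: 'n spinor list. set L \<subseteq> UNIV \<and> length L = \<tau>}"
    by (auto simp: idx_set_def)
  show "finite ({..\<sigma>} \<times> {..\<sigma>} \<times> {L :: 'n spinor list. set L \<subseteq> UNIV \<and> length L = \<tau>})"
    by (intro finite_cartesian_product finite_lists_length_eq) auto
qed

lemma framed_supported_on:
  assumes "finite J"
  shows "framed (supported_on J) J (\<lambda>j i. if i = j then 1 else 0)"
  using assms by (auto simp: framed_def supported_on_def if_distrib[of "\<lambda>x. _ * x"] cong: if_cong)

text \<open>A list of fewer than two indices has no two positions to exchange, so alternation is
  vacuous and the unit vectors form a frame.\<close>

lemma sym_forms_supported_on: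
  assumes "\<tau> < 2"
  shows "sym_forms \<sigma> \<tau> = supported_on (idx_set \<sigma> \<tau>)"
proof (intro set_eqI iffI)
  fix u :: "'a val" assume "u \<in> supported_on (idx_set \<sigma> \<tau>)"
  then have u: "u (i, j, L) = 0" if "i + j \<noteq> \<sigma> \<or> length L \<noteq> \<tau>" for i j L
    using that by (auto simp: supported_on_def idx_set_def)
  show "u \<in> sym_forms \<sigma> \<tau>"
    unfolding sym_forms_def alternating_form_def
  proof (intro CollectI conjI allI impI)
    fix i j and L :: "'a spinor list" and a b assume "a < b \<and> b < length L"
    then have "length L \<noteq> \<tau>" using assms by linarith
    then show "u (i, j, L[a := L ! b, b := L ! a]) = - u (i, j, L)" by (simp add: u)
  qed (use u in auto)
qed (auto simp: sym_forms_def alternating_form_def supported_on_def idx_set_def)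

lemma sym_forms_2:
  "u \<in> sym_forms \<sigma> 2 \<longleftrightarrow> u \<in> supported_on (idx_set \<sigma> 2) \<and> (\<forall>i j L. length L = 2 \<longrightarrow> u (i, j, rev L) = - u (i, j, L))"
proof -
  have "(\<forall>a b. a < b \<and> b < length L \<longrightarrow> v (L[a := L ! b, b := L ! a]) = - v L) \<longleftrightarrow> v (rev L) = - v L"
    if L: "length L = 2" for L :: "'a spinor list" and v :: "'a spinor list \<Rightarrow> complex"
  proof -
    obtain P Q where PQ: "L = [P, Q]"
      using L by (auto simp: length_Suc_conv numeral_2_eq_2)
    have i: "a < b \<and> b < length L \<longleftrightarrow> a = 0 \<and> b = 1" for a b :: nat using L by auto
    show ?thesis unfolding i by (simp add: PQ)
  qed
  note swap = this
  have "alternating_form 2 v \<longleftrightarrow> (\<forall>L. length L \<noteq> 2 \<longrightarrow> v L = 0) \<and> (\<forall>L. length L = 2 \<longrightarrow> v (rev L) = - v L)"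
    for v :: "'a spinor list \<Rightarrow> complex"
  proof -
    have "(\<forall>a b. a < b \<and> b < length L \<longrightarrow> v (L[a := L ! b, b := L ! a]) = - v L) \<longleftrightarrow> (length L = 2 \<longrightarrow> v (rev L) = - v L)"
      if "\<forall>L. length L \<noteq> 2 \<longrightarrow> v L = 0" for L
      using that swap[of L v] by (cases "length L = 2") auto
    then show ?thesis unfolding alternating_form_def by blast
  qed
  then show ?thesis
    by (auto simp: sym_forms_def supported_on_def idx_set_def)
qed

lemma V0_eq: "V0 k = supported_on (idx_set k 0)"
  by (simp add: V0_def sym_forms_supported_on)

lemma framed_V0: "framed (V0 k :: ('n::finite) val set) (idx_set k 0) (\<lambda>j i. if i = j then 1 else 0)"
  unfolding V0_eq by (rule framed_supported_on[OF finite_idx_set])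

lemma case_sum_supported_on:
  "{case_sum u v | u v. u \<in> supported_on A \<and> v \<in> supported_on B} = supported_on (A <+> B)"
proof (intro set_eqI iffI)
  fix w :: "'a + 'b \<Rightarrow> complex" assume w: "w \<in> supported_on (A <+> B)"
  have "w = case_sum (w \<circ> Inl) (w \<circ> Inr)" by (auto simp: fun_eq_iff split: sum.split)
  moreover have "w \<circ> Inl \<in> supported_on A" "w \<circ> Inr \<in> supported_on B"
    using w by (auto simp: supported_on_def)
  ultimately show "w \<in> {case_sum u v | u v. u \<in> supported_on A \<and> v \<in> supported_on B}" by blast
qed (auto simp: supported_on_def split: sum.split)

definition V1_idx :: "nat \<Rightarrow> ('n idx + 'n idx) set" where
  "V1_idx k = (if k \<ge> 2 then idx_set (k - 1) 1 <+> idx_set (k - 2) 0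
     else if k = 1 then idx_set 0 1 <+> idx_set 0 1 else idx_set 0 2 <+> {})"

lemma finite_V1_idx: "finite (V1_idx k :: ('n::finite idx + 'n idx) set)"
  by (simp add: V1_idx_def finite_idx_set)

lemma V1_pos: "k \<ge> 1 \<Longrightarrow> V1 k = supported_on (V1_idx k)"
  by (simp add: V1_def V1_idx_def sym_forms_supported_on case_sum_supported_on)

lemma V1_zero:
  "u \<in> V1 0 \<longleftrightarrow> u \<in> supported_on (V1_idx 0) \<and> (\<forall>i j L. length L = 2 \<longrightarrow> u (Inl (i, j, rev L)) = - u (Inl (i, j, L)))"
proof
  assume "u \<in> V1 0"
  then obtain v where "u = case_sum v (\<lambda>_. 0)" "v \<in> sym_forms 0 2" by (auto simp: V1_def)
  then show "u \<in> supported_on (V1_idx 0) \<and> (\<forall>i j L. length L = 2 \<longrightarrow> u (Inl (i, j, rev L)) = - u (Inl (i, j, L)))"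
    by (auto simp: sym_forms_2 supported_on_def V1_idx_def split: sum.split)
next
  assume u: "u \<in> supported_on (V1_idx 0) \<and> (\<forall>i j L. length L = 2 \<longrightarrow> u (Inl (i, j, rev L)) = - u (Inl (i, j, L)))"
  then have "u \<circ> Inl \<in> sym_forms 0 2"
    by (auto simp: sym_forms_2 supported_on_def V1_idx_def)
  moreover have "u = case_sum (u \<circ> Inl) (\<lambda>_. 0)"
    using u by (auto simp: fun_eq_iff supported_on_def V1_idx_def split: sum.split)
  ultimately show "u \<in> V1 0" unfolding V1_def by auto
qed

definition rev_idx :: "'n idx + 'n idx \<Rightarrow> 'n idx + 'n idx" where
  "rev_idx x = map_sum (\<lambda>(i, j, L). (i, j, rev L)) id x"

text \<open>An index y and its reversal yield the same contribution to the expansion of an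
  alternating u, hence the factor 1/2. For a repeated form index the frame vector is 0, in
  accordance with u vanishing there.\<close>

lemma framed_V1_zero:
  "framed (V1 0 :: (('n::finite) idx + 'n idx \<Rightarrow> complex) set) (V1_idx 0)
     (\<lambda>y x. ((if x = y then 1 else 0) - (if x = rev_idx y then 1 else 0)) / 2)" (is "framed ?V ?J ?w")
proof -
  have rr: "rev_idx (rev_idx x) = x" for x :: "'n idx + 'n idx"
    by (cases x) (auto simp: rev_idx_def)
  have rJ: "rev_idx x \<in> V1_idx 0 \<longleftrightarrow> x \<in> V1_idx 0" for x :: "'n idx + 'n idx"
    by (cases x) (auto simp: rev_idx_def V1_idx_def idx_set_def)
  have V: "u \<in> ?V \<longleftrightarrow> u \<in> supported_on ?J \<and> (\<forall>x\<in>?J. u (rev_idx x) = - u x)" for u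
    unfolding V1_zero
  proof (intro conj_cong refl iffI allI impI ballI)
    fix x :: "'n idx + 'n idx"
    assume "\<forall>i j L. length L = 2 \<longrightarrow> u (Inl (i, j, rev L)) = - u (Inl (i, j, L))" "x \<in> V1_idx 0"
    then show "u (rev_idx x) = - u x" by (auto simp: V1_idx_def idx_set_def rev_idx_def)
  next
    fix i j and L :: "'n spinor list"
    assume u: "u \<in> supported_on ?J" "\<forall>x\<in>V1_idx 0. u (rev_idx x) = - u x" "length L = 2"
    show "u (Inl (i, j, rev L)) = - u (Inl (i, j, L))"
    proof (cases "i + j = 0")
      case True
      then have "Inl (i, j, L) \<in> (V1_idx 0 :: ('n idx + 'n idx) set)" using u(3) by (auto simp: V1_idx_def idx_set_def)
      with u(2) have "u (rev_idx (Inl (i, j, L))) = - u (Inl (i, j, L))" by blast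
      then show ?thesis by (simp add: rev_idx_def)
    next
      case False
      then have "Inl (i, j, rev L) \<notin> (V1_idx 0 :: ('n idx + 'n idx) set)" "Inl (i, j, L) \<notin> (V1_idx 0 :: ('n idx + 'n idx) set)"
        by (auto simp: V1_idx_def idx_set_def)
      then show ?thesis using u(1) unfolding supported_on_def by simp
    qed
  qed
  have w: "?w y \<in> ?V" if "y \<in> ?J" for y
  proof -
    have "rev_idx x = y \<longleftrightarrow> x = rev_idx y" for x using rr by metis
    moreover have "rev_idx x = rev_idx y \<longleftrightarrow> x = y" for x using rr by metis
    ultimately show ?thesis unfolding V using that rJ by (auto simp: supported_on_def)
  qed
  have rep: "u x = (\<Sum>y\<in>?J. u y * ?w y x)" if u: "u \<in> ?V" for u x
  proof -
    have e: "x = rev_idx y \<longleftrightarrow> rev_idx x = y" for y using rr by metis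
    have "(\<Sum>y\<in>?J. u y * ?w y x) = ((\<Sum>y\<in>?J. u y * (if x = y then 1 else 0)) - (\<Sum>y\<in>?J. u y * (if rev_idx x = y then 1 else 0))) / 2"
      unfolding e by (simp add: sum_subtractf[symmetric] right_diff_distrib sum_divide_distrib)
    also have "\<dots> = ((if x \<in> ?J then u x else 0) - (if rev_idx x \<in> ?J then u (rev_idx x) else 0)) / 2"
      by (simp add: finite_V1_idx if_distrib[of "\<lambda>x. _ * x"] cong: if_cong)
    also have "\<dots> = u x"
    proof (cases "x \<in> ?J")
      case True
      then have "u (rev_idx x) = - u x" using u V by blast
      then show ?thesis using True rJ by simp
    next
      case False
      then have "u x = 0" using u V by (auto simp: supported_on_def)
      then show ?thesis using False rJ by simp
    qed
    finally show ?thesis by simp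
  qed
  show ?thesis
    unfolding framed_def using finite_V1_idx w rep
    by (intro conjI ballI allI) (auto simp: V supported_on_def)
qed

lemma framed_V1:
  obtains w where "framed (V1 k :: (('n::finite) idx + 'n idx \<Rightarrow> complex) set) (V1_idx k) w"
proof (cases "k = 0")
  case True
  then show ?thesis using that framed_V1_zero by blast
next
  case False
  then show ?thesis using that framed_supported_on[OF finite_V1_idx] V1_pos[of k] by (metis One_nat_def Suc_leI neq0_conv)
qed

section \<open>Components of the first operator: values, regularity and supports\<close>

lemma D0_Inl:
  assumes "k \<ge> 1"
  shows "D0 S k f p (Inl (i, j, L)) =
    of_nat (Suc i) * dd S 0 f p (Suc i, j, L) + of_nat (Suc j) * dd S 1 f p (i, Suc j, L)"
proof -
  consider "k \<ge> 2" | "k = 1" using assms by linarith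
  then show ?thesis by cases (simp_all add: D0_def sum_2_UNIV ds_def)
qed

lemma D0_Inr_ge2:
  assumes "k \<ge> 2"
  shows "D0 S k f p (Inr (i, j, L)) = - (
     of_nat (Suc i) * (of_nat (Suc (Suc i)) * T_up 0 0 (\<lambda>q. f q (Suc (Suc i), j, L)) p)
   + of_nat (Suc i) * (of_nat (Suc j) * T_up 0 1 (\<lambda>q. f q (Suc i, Suc j, L)) p)
   + (of_nat (Suc j) * (of_nat (Suc i) * T_up 1 0 (\<lambda>q. f q (Suc i, Suc j, L)) p)
   + of_nat (Suc j) * (of_nat (Suc (Suc j)) * T_up 1 1 (\<lambda>q. f q (i, Suc (Suc j), L)) p)))"
  using assms unfolding D0_def by (simp only: if_True sum.case sum_2_UNIV) (simp add: ds_def componentwise_def)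

lemma D0_Inr_1:
  "D0 S 1 f p (Inr (i, j, L)) = - (
     of_nat (Suc i) * dd S 0 (componentwise (T_low 0 0) f) p (Suc i, j, L)
   + of_nat (Suc i) * dd S 1 (componentwise (T_low 1 0) f) p (Suc i, j, L)
   + (of_nat (Suc j) * dd S 0 (componentwise (T_low 0 1) f) p (i, Suc j, L)
   + of_nat (Suc j) * dd S 1 (componentwise (T_low 1 1) f) p (i, Suc j, L)))"
  unfolding D0_def by (simp add: sum_2_UNIV ds_def)

lemma Z_zero: "Z S A A' (\<lambda>q. 0) p = 0"
proof -
  obtain c b d b' where e: "\<And>f. Z S A A' f = (\<lambda>p. c * hor S b f p + d * hor S b' f p)"
    by (rule Z_cases[of S A A']) blast
  show ?thesis unfolding e by (simp add: hor_def dderiv_const)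
qed

lemma T_low_zero: "T_low A' B' (\<lambda>q. 0) p = 0"
  by (simp add: T_low_def deriv_along_dderiv dderiv_const)

lemma T_up_zero: "T_up A' B' (\<lambda>q. 0) p = 0"
  by (simp add: T_up_def T_low_zero)

lemma dd_zero:
  assumes "\<And>M q. Suc (length M) = length L \<Longrightarrow> f q (i, j, M) = 0"
  shows "dd S A' f p (i, j, L) = 0"
proof -
  have "(\<lambda>q. f q (i, j, take m L @ drop (Suc m) L)) = (\<lambda>q. 0)" if "m < length L" for m
    using that by (intro ext assms) auto
  then show ?thesis unfolding dd_def omega_wedge_def by (auto intro!: sum.neutral simp: Z_zero)
qed

lemma dd_1: "dd S A' f p (i, j, [P]) = Z S P A' (\<lambda>q. f q (i, j, [])) p"
  by (simp add: dd_def)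

lemma dd_2: "dd S A' f p (i, j, [P, Q]) = Z S P A' (\<lambda>q. f q (i, j, [Q])) p - Z S Q A' (\<lambda>q. f q (i, j, [P])) p"
  by (simp add: dd_def sum_subtractf)

lemma D0_zero: "D0 S 0 f p = case_sum (dd S 0 (dd S 1 f) p) (\<lambda>_. 0)"
  by (simp add: D0_def)

lemma D0_zero_2: "D0 S 0 f p (Inl (i, j, [P, Q])) =
    Z S P 0 (Z S Q 1 (\<lambda>q. f q (i, j, []))) p - Z S Q 0 (Z S P 1 (\<lambda>q. f q (i, j, []))) p"
  by (simp add: D0_zero dd_2 dd_1)

text \<open>The lower bound for \<open>h1\<close> holds on \<open>V1 k\<close> only. The point is
  that degrees match; for k = 0 the alternation is read off from \<open>D0_zero_2\<close>.\<close>

lemma D0_in_V1: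
  assumes f: "\<And>p. f p \<in> V0 k"
  shows "D0 S k f p \<in> V1 k"
proof -
  have f0: "f q (i, j, L) = 0" if "i + j \<noteq> k \<or> L \<noteq> []" for q i j L
    using f[of q] that by (auto simp: V0_def sym_forms_supported_on supported_on_def idx_set_def)
  have dd0: "dd S A' f q (i, j, L) = 0" if "i + j \<noteq> k \<or> length L \<noteq> 1" for A' q i j L
    by (rule dd_zero) (use that in \<open>auto intro: f0\<close>)
  have T0: "T_low A' B' (\<lambda>q. f q (i, j, L)) p = 0" "T_up A' B' (\<lambda>q. f q (i, j, L)) p = 0" if "i + j \<noteq> k \<or> L \<noteq> []" for A' B' p i j L
    using f0[OF that] by (simp_all add: T_low_zero T_up_zero)
  consider "k \<ge> 2" | "k = 1" | "k = 0" by linarith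
  then show ?thesis
  proof cases
    case 1
    have "D0 S k f p x = 0" if "x \<notin> V1_idx k" for x
    proof (cases x)
      case (Inl y)
      obtain i j L where y: "y = (i, j, L)" by (cases y)
      have "Suc (i + j) \<noteq> k \<or> length L \<noteq> 1" using that Inl y 1 by (auto simp: V1_idx_def idx_set_def)
      then show ?thesis using 1 by (auto simp: Inl y D0_Inl dd0)
    next
      case (Inr y)
      obtain i j L where y: "y = (i, j, L)" by (cases y)
      have "Suc (Suc (i + j)) \<noteq> k \<or> L \<noteq> []" using that Inr y 1 by (auto simp: V1_idx_def idx_set_def)
      then show ?thesis using 1 by (auto simp: Inr y D0_Inr_ge2 T0)
    qed
    moreover have "k \<ge> 1" using 1 by simp
    ultimately show ?thesis by (simp add: V1_pos supported_on_def)
  next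
    case 2
    have "D0 S 1 f p x = 0" if "x \<notin> V1_idx 1" for x
    proof (cases x)
      case (Inl y)
      obtain i j L where y: "y = (i, j, L)" by (cases y)
      have "Suc (i + j) \<noteq> k \<or> length L \<noteq> 1" using that Inl y 2 by (auto simp: V1_idx_def idx_set_def)
      then show ?thesis by (auto simp: Inl y D0_Inl dd0)
    next
      case (Inr y)
      obtain i j L where y: "y = (i, j, L)" by (cases y)
      have n: "Suc (i + j) \<noteq> k \<or> length L \<noteq> 1" using that Inr y 2 by (auto simp: V1_idx_def idx_set_def)
      have "dd S A' (componentwise (T_low A' B') f) p (i', j', L) = 0" if "i' + j' = Suc (i + j)" for A' B' i' j'
        by (rule dd_zero) (use n that in \<open>auto simp: componentwise_def intro!: T0\<close>)
      then show ?thesis unfolding Inr y D0_Inr_1 by simp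
    qed
    moreover have "k \<ge> 1" using 2 by simp
    ultimately show ?thesis using 2 by (simp add: V1_pos supported_on_def)
  next
    case 3
    have "D0 S 0 f p x = 0" if "x \<notin> V1_idx 0" for x
    proof (cases x)
      case (Inl y)
      obtain i j L where y: "y = (i, j, L)" by (cases y)
      have n: "i + j \<noteq> k \<or> length L \<noteq> 2" using that Inl y 3 by (auto simp: V1_idx_def idx_set_def)
      have "dd S 0 (dd S 1 f) p (i, j, L) = 0"
        by (rule dd_zero) (use n in \<open>auto intro!: dd0\<close>)
      then show ?thesis by (simp add: Inl y D0_zero)
    qed (simp add: D0_zero)
    moreover have "D0 S 0 f p (Inl (i, j, rev L)) = - D0 S 0 f p (Inl (i, j, L))" if L: "length L = 2" for i j L
    proof -
      obtain P Q where "L = [P, Q]" using L by (auto simp: length_Suc_conv numeral_2_eq_2)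
      then show ?thesis by (simp add: D0_zero_2)
    qed
    ultimately show ?thesis unfolding 3 V1_zero by (simp add: supported_on_def)
  qed
qed

text \<open>Bundled with its C^1 counterpart so that the nested sums and scalings making up
  \<open>D0\<close> are handled by one closure rule per operation.\<close>

definition cont_van :: "real \<Rightarrow> ('p::real_normed_vector \<Rightarrow> complex) \<Rightarrow> bool" where
  "cont_van R g \<longleftrightarrow> continuous_on UNIV g \<and> vanishes R g"

definition cdiff1_van :: "real \<Rightarrow> ('p::real_normed_vector \<Rightarrow> complex) \<Rightarrow> bool" where
  "cdiff1_van R g \<longleftrightarrow> cdiff1 g \<and> vanishes R g"

lemma cont_van_zero: "cont_van R (\<lambda>p. 0)" and cdiff1_van_zero: "cdiff1_van R (\<lambda>p. 0)"
  by (simp_all add: cont_van_def cdiff1_van_def vanishes_def cdiff1_const)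

lemma cont_van_add: "cont_van R f \<Longrightarrow> cont_van R g \<Longrightarrow> cont_van R (\<lambda>p. f p + g p)"
  by (auto simp: cont_van_def vanishes_def intro: continuous_on_add)

lemma cdiff1_van_add: "cdiff1_van R f \<Longrightarrow> cdiff1_van R g \<Longrightarrow> cdiff1_van R (\<lambda>p. f p + g p)"
  by (auto simp: cdiff1_van_def vanishes_def intro: cdiff1_add)

lemma cont_van_cmult: "cont_van R f \<Longrightarrow> cont_van R (\<lambda>p. c * f p)"
  by (auto simp: cont_van_def vanishes_def intro: continuous_on_mult)

lemma cdiff1_van_cmult: "cdiff1_van R f \<Longrightarrow> cdiff1_van R (\<lambda>p. c * f p)"
  by (auto simp: cdiff1_van_def vanishes_def intro: cdiff1_cmult)

lemma cont_van_uminus: "cont_van R f \<Longrightarrow> cont_van R (\<lambda>p. - f p)"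
  by (auto simp: cont_van_def vanishes_def intro: continuous_on_minus)

lemma cont_van_sum: "(\<And>i. i \<in> I \<Longrightarrow> cont_van R (f i)) \<Longrightarrow> cont_van R (\<lambda>p. \<Sum>i\<in>I. f i p)"
  by (induction I rule: infinite_finite_induct) (auto intro: cont_van_zero cont_van_add)

lemma cdiff1_van_sum: "(\<And>i. i \<in> I \<Longrightarrow> cdiff1_van R (f i)) \<Longrightarrow> cdiff1_van R (\<lambda>p. \<Sum>i\<in>I. f i p)"
  by (induction I rule: infinite_finite_induct) (auto intro: cdiff1_van_zero cdiff1_van_add)

lemma cdiff1_van_cont_van: "cdiff1_van R f \<Longrightarrow> cont_van R f"
  by (simp add: cont_van_def cdiff1_van_def cdiff1_cont)

lemma dd_eq:
  "dd S A' f p (i, j, L) = (\<Sum>A\<in>UNIV. \<Sum>m<length L. (if L ! m = A then (-1) ^ m else 0) *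
     Z S A A' (\<lambda>q. f q (i, j, take m L @ drop (Suc m) L)) p)"
  unfolding dd_def omega_wedge_def by (auto intro!: sum.cong)

lemma cont_van_dd:
  assumes "\<And>M. cdiff1_van R (\<lambda>q. f q (i, j, M))"
  shows "cont_van R (\<lambda>p. dd S A' f p (i, j, L))"
proof -
  have "cont_van R (Z S A A' (\<lambda>q. f q (i, j, M)))" for A M
    using assms[of M] by (simp add: cont_van_def cdiff1_van_def continuous_Z vanishes_Z)
  then show ?thesis unfolding dd_eq by (intro cont_van_sum cont_van_cmult)
qed

lemma cdiff1_van_dd:
  assumes "\<And>M. cdiff2 (\<lambda>q. f q (i, j, M))" "\<And>M. vanishes R (\<lambda>q. f q (i, j, M))"
  shows "cdiff1_van R (\<lambda>p. dd S A' f p (i, j, L))"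
proof -
  have "cdiff1_van R (Z S A A' (\<lambda>q. f q (i, j, M)))" for A M
    using assms[of M] by (simp add: cdiff1_van_def cdiff1_Z vanishes_Z cdiff2_cdiff1)
  then show ?thesis unfolding dd_eq by (intro cdiff1_van_sum cdiff1_van_cmult)
qed

lemma cdiff1_van_T_low:
  assumes f: "cdiff2 f" "vanishes R f"
  shows "cdiff1_van R (T_low A' B' f)"
proof -
  have D: "cdiff1_van R (dderiv (e_t \<beta>) f)" for \<beta>
    using f by (simp add: cdiff1_van_def cdiff2_cdiff1_dderiv vanishes_dderiv cdiff2_cdiff1)
  have d: "deriv_along (dt \<beta>) f p = dderiv (e_t \<beta>) f p" for \<beta> p
    by (simp add: deriv_along_dderiv dt_def)
  have "A' = 0 \<or> A' = 1" "B' = 0 \<or> B' = 1" using exhaust_2[of A'] exhaust_2[of B'] by auto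
  then obtain b c b' c' where "T_low A' B' f = (\<lambda>p. c * dderiv (e_t b) f p + c' * dderiv (e_t b') f p)"
  proof (elim disjE)
    assume "A' = 0" "B' = 0"
    then show ?thesis by (intro that[of "-\<i>" 1 0 1]) (simp add: fun_eq_iff T_low_def d)
  next
    assume "A' = 0" "B' = 1"
    then show ?thesis by (intro that[of "-1" 2 "\<i>" 3]) (simp add: fun_eq_iff T_low_def d)
  next
    assume "A' = 1" "B' = 0"
    then show ?thesis by (intro that[of 1 2 "\<i>" 3]) (simp add: fun_eq_iff T_low_def d)
  next
    assume "A' = 1" "B' = 1"
    then show ?thesis by (intro that[of "\<i>" 1 0 1]) (simp add: fun_eq_iff T_low_def d)
  qed
  then show ?thesis by (simp add: cdiff1_van_add cdiff1_van_cmult D)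
qed

lemma cont_van_T_up:
  assumes "cdiff2 f" "vanishes R f"
  shows "cont_van R (T_up A' B' f)"
proof -
  have "T_up A' B' f = (if B' = 0 then T_low 1 A' f else (\<lambda>p. - T_low 0 A' f p))"
    by (auto simp: fun_eq_iff T_up_def)
  then show ?thesis using cdiff1_van_cont_van[OF cdiff1_van_T_low[OF assms]] by (simp add: cont_van_uminus)
qed

text \<open>Operators of order two use up both derivatives of f: the inner factor leaves a C^1
  function, the outer one a continuous function.\<close>

lemma cont_van_D0:
  assumes f: "\<And>x. cdiff2 (\<lambda>p. f p x)" "\<And>x. vanishes R (\<lambda>p. f p x)"
  shows "cont_van R (\<lambda>p. D0 S k f p x)"
proof -
  have f1: "cdiff1_van R (\<lambda>q. f q x)" for x using f by (simp add: cdiff1_van_def cdiff2_cdiff1)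
  consider "k \<ge> 2" | "k = 1" | "k = 0" by linarith
  then show ?thesis
  proof cases
    case 1
    show ?thesis
    proof (cases x)
      case (Inl y)
      obtain i j L where y: "y = (i, j, L)" by (cases y)
      have "k \<ge> 1" using 1 by simp
      then show ?thesis unfolding Inl y by (subst D0_Inl) (assumption, intro cont_van_add cont_van_cmult cont_van_dd f1)
    next
      case (Inr y)
      obtain i j L where y: "y = (i, j, L)" by (cases y)
      show ?thesis unfolding Inr y D0_Inr_ge2[OF 1] by (intro cont_van_uminus cont_van_add cont_van_cmult cont_van_T_up f)
    qed
  next
    case 2
    show ?thesis
    proof (cases x)
      case (Inl y)
      obtain i j L where y: "y = (i, j, L)" by (cases y)
      have "k \<ge> 1" using 2 by simp
      then show ?thesis unfolding Inl y by (subst D0_Inl) (assumption, intro cont_van_add cont_van_cmult cont_van_dd f1)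
    next
      case (Inr y)
      obtain i j L where y: "y = (i, j, L)" by (cases y)
      have "cdiff1_van R (\<lambda>q. componentwise (T_low A' B') f q z)" for A' B' z
        using cdiff1_van_T_low[OF f[of z], of A' B'] by (simp add: componentwise_def)
      then show ?thesis unfolding Inr y 2 D0_Inr_1 by (intro cont_van_uminus cont_van_add cont_van_cmult cont_van_dd)
    qed
  next
    case 3
    show ?thesis
    proof (cases x)
      case (Inl y)
      obtain i j L where y: "y = (i, j, L)" by (cases y)
      show ?thesis unfolding Inl y 3 D0_zero sum.case by (intro cont_van_dd cdiff1_van_dd f)
    next
      case (Inr y)
      then show ?thesis by (simp add: 3 D0_zero cont_van_zero)
    qed
  qed
qed

section \<open>Control of the horizontal energy by the first operator\<close>

lemma energy_cmult:
  assumes "cdiff1 f"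
  shows "energy S (\<lambda>p. c * f p) = (cmod c)\<^sup>2 * energy S f"
  unfolding energy_def hor_cmult[OF assms] by (simp add: norm_mult power_mult_distrib sum_distrib_left)

lemma energy_nonneg: "0 \<le> energy S f"
  unfolding energy_def by (intro sum_nonneg Bochner_Integration.integral_nonneg) simp

lemma cdiff2_cmult:
  assumes "cdiff2 f"
  shows "cdiff2 (\<lambda>p. c * f p)"
proof -
  have "dderiv v (\<lambda>p. c * f p) = (\<lambda>p. c * dderiv v f p)" for v using dderiv_cmult[OF cdiff2_cdiff1[OF assms]] by auto
  then show ?thesis using assms by (simp add: cdiff2_def cdiff1_cmult)
qed

lemma Z_cmult:
  assumes "cdiff1 f"
  shows "Z S A A' (\<lambda>p. c * f p) p = c * Z S A A' f p"
proof -
  obtain a b d b' where e: "\<And>f. Z S A A' f = (\<lambda>p. a * hor S b f p + d * hor S b' f p)"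
    by (rule Z_cases[of S A A']) blast
  show ?thesis unfolding e hor_cmult[OF assms] by (simp add: algebra_simps)
qed

text \<open>For exponents (i, j) of degree k - 1 the one-form coefficients of the first component
  are exactly the combinations in \<open>energy_identity\<close>, with g and h multiples of the
  coefficients of f at (i+1, j) and (i, j+1). As k \<ge> 1, every coefficient of f occurs in such a
  pair.\<close>

lemma energy_le_D0_pos:
  fixes S :: "('n::finite) gram"
  assumes S: "transpose S = S" "right_type S" and k: "k \<ge> 1"
    and f: "\<And>x. cdiff2 (\<lambda>p. f p x)" "\<And>x. vanishes R (\<lambda>p. f p x)" and x: "x \<in> idx_set k 0"
  shows "energy S (\<lambda>p. f p x) \<le> (\<Sum>y\<in>V1_idx k. LINT p|lborel. (cmod (D0 S k f p y))\<^sup>2)"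
proof -
  let ?T = "\<Sum>y\<in>V1_idx k. sqint (\<lambda>p. D0 S k f p y)"
  have main: "energy S (\<lambda>p. f p (Suc i, j, [])) \<le> ?T \<and> energy S (\<lambda>p. f p (i, Suc j, [])) \<le> ?T" if ij: "Suc (i + j) = k" for i j
  proof -
    let ?g = "\<lambda>p. of_nat (Suc i) * f p (Suc i, j, [])" and ?h = "\<lambda>p. of_nat (Suc j) * f p (i, Suc j, [])"
    have D: "D0 S k f p (Inl (i, j, [A])) = Z S A 0 ?g p + Z S A 1 ?h p" for A p
      unfolding D0_Inl[OF k] dd_1 by (simp only: Z_cmult cdiff2_cdiff1[OF f(1)])
    have g: "cdiff2 ?g" "vanishes R ?g" and h: "cdiff2 ?h" "vanishes R ?h"
      using f(2) by (auto intro!: cdiff2_cmult f(1) simp: vanishes_def)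
    have "energy S ?g + energy S ?h = (\<Sum>A\<in>UNIV. LINT p|lborel. (cmod (D0 S k f p (Inl (i, j, [A]))))\<^sup>2)"
      unfolding D by (rule energy_identity[OF S g h, symmetric])
    also have "\<dots> = (\<Sum>y\<in>range (\<lambda>A. Inl (i, j, [A])). LINT p|lborel. (cmod (D0 S k f p y))\<^sup>2)"
      by (subst sum.reindex) (auto simp: inj_on_def)
    also have "\<dots> \<le> ?T"
      using ij k by (intro sum_mono2 finite_V1_idx) (auto simp: V1_idx_def idx_set_def)
    finally have T: "energy S ?g + energy S ?h \<le> ?T" .
    have sc: "energy S (\<lambda>p. f p x) \<le> energy S (\<lambda>p. of_nat (Suc m) * f p x)" for m x
    proof -
      have "1 * energy S (\<lambda>p. f p x) \<le> (cmod (of_nat (Suc m)))\<^sup>2 * energy S (\<lambda>p. f p x)"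
        unfolding norm_of_nat by (intro mult_right_mono energy_nonneg one_le_power) simp
      then show ?thesis by (simp only: energy_cmult[OF cdiff2_cdiff1[OF f(1)]] mult_1)
    qed
    show ?thesis
      using T sc[of "(Suc i, j, [])" i] sc[of "(i, Suc j, [])" j] energy_nonneg[of S ?g] energy_nonneg[of S ?h] by linarith
  qed
  obtain a b where ab: "x = (a, b, [])" "a + b = k" using x by (auto simp: idx_set_def)
  show ?thesis
  proof (cases a)
    case (Suc i)
    then show ?thesis using main[of i b] ab by simp
  next
    \<comment> \<open>The exponent of the first variable cannot be lowered, so the coefficient is
      met as the h of a pair.\<close>
    case 0
    then obtain j where "b = Suc j" using ab k by (cases b) auto
    then show ?thesis using main[of 0 j] ab 0 by simp
  qed
qed

text \<open>Pairing the sublaplacian with f costs the extra squared norm of f. The sublaplacian is a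
  sum of one component of \<open>D0\<close> per quaternionic variable, and Cauchy-Schwarz for this
  sum costs the factor \<open>CARD('n)\<close>.\<close>

lemma energy_le_D0_zero:
  fixes S :: "('n::finite) gram"
  assumes S: "transpose S = S" "right_type S"
    and f: "\<And>x. cdiff2 (\<lambda>p. f p x)" "\<And>x. vanishes R (\<lambda>p. f p x)" and x: "x \<in> idx_set 0 0"
  shows "energy S (\<lambda>p. f p x) \<le> real CARD('n) * (\<Sum>y\<in>V1_idx 0. LINT p|lborel. (cmod (D0 S 0 f p y))\<^sup>2) + (sqint (\<lambda>p. f p x))"
proof -
  let ?T = "\<Sum>y\<in>V1_idx 0. LINT p|lborel. (cmod (D0 S 0 f p y))\<^sup>2"
  let ?f = "\<lambda>p. f p x"
  let ?y = "\<lambda>l. Inl (0, 0, [(l, 0), (l, 1)]) :: 'n idx + 'n idx"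
  have x: "x = (0, 0, [])" using x by (auto simp: idx_set_def)
  have sublaplacian: "sublaplacian S ?f p = (\<Sum>l\<in>UNIV. D0 S 0 f p (?y l))" for p
    unfolding sublaplacian_def sum_coord D0_zero_2 x by (intro sum.cong refl) (rule Z_Z[OF S f(1), symmetric])
  have iD: "integrable lborel (\<lambda>p. (cmod (D0 S 0 f p y))\<^sup>2)" for y
    by (intro integrable_cmod_sq[where R=R]) (use cont_van_D0[of f R S 0 y, OF f] in \<open>auto simp: cont_van_def\<close>)
  have if2: "integrable lborel (\<lambda>p. (cmod (f p x))\<^sup>2)"
    by (intro integrable_cmod_sq[where R=R] cdiff1_cont cdiff2_cdiff1 f)
  have clap: "continuous_on UNIV (sublaplacian S ?f)"
    unfolding sublaplacian_def by (intro continuous_on_sum continuous_hor cdiff1_hor f)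
  have vlap: "vanishes R (sublaplacian S ?f)"
    using vanishes_hor[OF cdiff1_hor[OF f(1)] vanishes_hor[OF cdiff2_cdiff1[OF f(1)] f(2)], of S _ S _ x] by (simp add: vanishes_def sublaplacian_def)
  have "energy S ?f = cmod (LINT p|lborel. sublaplacian S ?f p * cnj (f p x))"
    unfolding integral_sublaplacian[OF f] by (simp add: energy_nonneg)
  also have "\<dots> \<le> (LINT p|lborel. cmod (sublaplacian S ?f p * cnj (f p x)))" by (rule integral_norm_bound)
  also have "\<dots> \<le> (LINT p|lborel. real CARD('n) * (\<Sum>l\<in>UNIV. (cmod (D0 S 0 f p (?y l)))\<^sup>2) + (cmod (f p x))\<^sup>2)"
  proof (rule integral_mono)
    show "integrable lborel (\<lambda>p. cmod (sublaplacian S ?f p * cnj (f p x)))"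
      by (intro integrable_norm integrable_mult_vanishes[where R=R] clap vlap continuous_on_cnj cdiff1_cont cdiff2_cdiff1 f)
    show "integrable lborel (\<lambda>p. real CARD('n) * (\<Sum>l\<in>UNIV. (cmod (D0 S 0 f p (?y l)))\<^sup>2) + (cmod (f p x))\<^sup>2)"
      by (intro lebesgue_intros integrable_mult_right Bochner_Integration.integrable_sum iD if2)
    fix p
    let ?a = "cmod (sublaplacian S ?f p)" and ?b = "cmod (f p x)"
    have ab: "0 \<le> ?a * ?b" by simp
    have "cmod (sublaplacian S ?f p * cnj (f p x)) = ?a * ?b" by (simp add: norm_mult)
    also have "\<dots> \<le> ?a\<^sup>2 + ?b\<^sup>2"
      using sum_squares_bound[of ?a ?b] ab unfolding mult.assoc by linarith
    also have "?a \<le> (\<Sum>l\<in>UNIV. cmod (D0 S 0 f p (?y l)))" unfolding sublaplacian by (rule norm_sum)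
    then have "?a\<^sup>2 \<le> (\<Sum>l\<in>UNIV. cmod (D0 S 0 f p (?y l)))\<^sup>2" by (rule power_mono) simp
    also have "\<dots> \<le> real CARD('n) * (\<Sum>l\<in>UNIV. (cmod (D0 S 0 f p (?y l)))\<^sup>2)"
      using sum_squared_le_sum_of_squares[where f = "\<lambda>l. cmod (D0 S 0 f p (?y l))" and I = UNIV] by (simp add: mult.commute)
    finally show "cmod (sublaplacian S ?f p * cnj (f p x)) \<le> real CARD('n) * (\<Sum>l\<in>UNIV. (cmod (D0 S 0 f p (?y l)))\<^sup>2) + (cmod (f p x))\<^sup>2"
      by simp
  qed
  also have "\<dots> = real CARD('n) * (\<Sum>l\<in>UNIV. LINT p|lborel. (cmod (D0 S 0 f p (?y l)))\<^sup>2) + (sqint (\<lambda>p. f p x))"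
    by (simp add: iD if2)
  also have "(\<Sum>l\<in>UNIV. LINT p|lborel. (cmod (D0 S 0 f p (?y l)))\<^sup>2) = (\<Sum>y\<in>range ?y. LINT p|lborel. (cmod (D0 S 0 f p y))\<^sup>2)"
    by (subst sum.reindex) (auto simp: inj_on_def)
  also have "real CARD('n) * \<dots> \<le> real CARD('n) * ?T"
    by (intro mult_left_mono sum_mono2 finite_V1_idx) (auto simp: V1_idx_def idx_set_def)
  finally show ?thesis by simp
qed

lemma test_function_vanishes:
  fixes f :: "'p::euclidean_space \<Rightarrow> 'i \<Rightarrow> complex"
  assumes f: "f \<in> test_functions K V" and K: "closure K \<subseteq> cball 0 R"
  shows "vanishes R (\<lambda>p. f p x)"
  unfolding vanishes_def
proof (intro allI impI)
  fix p :: 'p assume p: "R < norm p"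
  have "closure {p. f p \<noteq> (\<lambda>_. 0)} \<subseteq> K" using f by (simp add: test_functions_def)
  then have "{p. f p \<noteq> (\<lambda>_. 0)} \<subseteq> cball 0 R"
    using closure_subset K order_trans by metis
  moreover have "p \<notin> cball 0 R" using p by simp
  ultimately have "f p = (\<lambda>_. 0)" by blast
  then show "f p x = 0" by simp
qed

theorem proposition1p1:
  fixes k :: nat
    and S :: "real ^ ('n::finite \<times> 4) ^ ('n \<times> 4)"
    and K :: "'n grp set"
    and h0 :: "'n val \<Rightarrow> 'n val \<Rightarrow> complex"
    and h1 :: "('n idx + 'n idx \<Rightarrow> complex) \<Rightarrow> ('n idx + 'n idx \<Rightarrow> complex) \<Rightarrow> complex"
  assumes "transpose S = S"
    and "stratified S"
    and "right_type S"
    and "compact (closure K)"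
    and "hermitian_inner (V0 k) h0"
    and "hermitian_inner (V1 k) h1"
  shows "\<exists>C1>0. \<exists>C2>0. \<forall>f\<in>test_functions K (V0 k).
           (L2_norm h1 (D0 S k f))\<^sup>2 \<ge> C1 * (sobolev_norm h0 (1/2) f)\<^sup>2 - C2 * (L2_norm h0 f)\<^sup>2"
proof -
  note S = assms(1,3)
  \<comment> \<open>The constants are chosen after this radius, and K enters them through it
    alone.\<close>
  obtain R where "0 < R" "closure K \<subseteq> ball 0 R"
    using bounded_subset_ballD[OF compact_imp_bounded[OF assms(4)]] by blast
  then have R: "0 \<le> R" "closure K \<subseteq> cball 0 R" using ball_subset_cball by (simp, blast)
  obtain w1 where fr1: "framed (V1 k :: ('n idx + 'n idx \<Rightarrow> complex) set) (V1_idx k) w1" by (rule framed_V1)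
  note fr0 = framed_V0[where 'n='n, of k]
  obtain c1 where c1: "c1 > 0" "\<And>u. u \<in> V1 k \<Longrightarrow> c1 * (\<Sum>j\<in>V1_idx k. (cmod (u j))\<^sup>2) \<le> Re (h1 u u)"
    using hermitian_lower[OF fr1 assms(6)] by metis
  obtain c0 where c0: "c0 > 0" "\<And>u. u \<in> V0 k \<Longrightarrow> c0 * (\<Sum>j\<in>idx_set k 0. (cmod (u j))\<^sup>2) \<le> Re (h0 u u)"
    using hermitian_lower[OF fr0 assms(5)] by metis
  obtain C0 where C0: "C0 > 0" "\<And>u. u \<in> V0 k \<Longrightarrow> Re (h0 u u) \<le> C0 * (\<Sum>j\<in>idx_set k 0. (cmod (u j))\<^sup>2)"
    using hermitian_upper[OF fr0 assms(5)] by metis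
  obtain Cs where Cs: "Cs > 0" "\<And>f. cdiff2 f \<Longrightarrow> vanishes R f \<Longrightarrow>
    (\<integral>\<^sup>+\<zeta>. ennreal ((1 + (norm \<zeta>)\<^sup>2) powr (1/2) * (cmod (fourier f \<zeta>))\<^sup>2) \<partial>lborel) \<le>
     ennreal (Cs * (energy S f + (sqint f)))"
    by (rule subelliptic[OF assms(1,2) R(1)]) (rule that, assumption, simp only:)
  define m where "m = real (card (idx_set k 0 :: 'n idx set))"
  \<comment> \<open>Read off from the chain in \<open>main\<close>: \<open>m\<close> counts the
    coefficients of f, since each of their energies is bounded by the same sum over
    \<open>V1_idx k\<close>; dividing by \<open>c1\<close> and \<open>c0\<close> returns from
    coordinates to the given norms.\<close>
  define \<alpha> where "\<alpha> = C0 * Cs * m * real CARD('n) / c1"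
  define \<beta> where "\<beta> = C0 * Cs * 2 / c0"
  have "(k, 0, []) \<in> (idx_set k 0 :: 'n idx set)" by (simp add: idx_set_def)
  then have m: "m > 0" unfolding m_def using finite_idx_set card_gt_0_iff by fastforce
  have \<alpha>: "\<alpha> > 0" and \<beta>: "\<beta> > 0"
    using C0(1) Cs(1) c1(1) c0(1) m by (simp_all add: \<alpha>_def \<beta>_def)
  have main: "(sobolev_norm h0 (1/2) f)\<^sup>2 \<le> \<alpha> * (L2_norm h1 (D0 S k f))\<^sup>2 + \<beta> * (L2_norm h0 f)\<^sup>2"
    if ft: "f \<in> test_functions K (V0 k)" for f
  proof -
    have fV: "f p \<in> V0 k" for p using ft unfolding test_functions_def by blast
    have f: "cdiff2 (\<lambda>p. f p x)" "vanishes R (\<lambda>p. f p x)" for x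
    proof -
      have "smooth (\<lambda>p. f p x)" using ft unfolding test_functions_def by blast
      then show "cdiff2 (\<lambda>p. f p x)" by (rule smooth_cdiff2)
      show "vanishes R (\<lambda>p. f p x)" by (rule test_function_vanishes[OF ft R(2)])
    qed
    have c: "continuous_on UNIV (\<lambda>p. f p x)" for x by (intro cdiff1_cont cdiff2_cdiff1 f)
    let ?T = "\<Sum>y\<in>V1_idx k. sqint (\<lambda>p. D0 S k f p y)"
    let ?N = "\<lambda>x. LINT p|lborel. (cmod (f p x))\<^sup>2"
    have T0: "0 \<le> ?T" by (intro sum_nonneg Bochner_Integration.integral_nonneg) simp
    have N0: "0 \<le> ?N x" for x by (intro Bochner_Integration.integral_nonneg) simp
    have n1: "1 \<le> real CARD('n)" using zero_less_card_finite[where 'a='n] by linarith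
    \<comment> \<open>One form for all k: the sharper bound for k \<ge> 1 is weakened to match the
      one for k = 0.\<close>
    have E: "energy S (\<lambda>p. f p x) \<le> real CARD('n) * ?T + ?N x" if "x \<in> idx_set k 0" for x
    proof (cases "k = 0")
      case True
      then show ?thesis using energy_le_D0_zero[OF S f, of x] that by simp
    next
      case False
      then have "energy S (\<lambda>p. f p x) \<le> 1 * ?T" using energy_le_D0_pos[OF S _ f that] by simp
      also have "\<dots> \<le> real CARD('n) * ?T" by (intro mult_right_mono n1 T0)
      finally show ?thesis using N0[of x] by linarith
    qed
    have fo: "(\<lambda>i. fourier (\<lambda>p. f p i) \<xi>) \<in> V0 k" for \<xi>
    proof -
      have "fourier (\<lambda>p. f p i) \<xi> = 0" if "i \<notin> idx_set k 0" for i
      proof -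
        have "f p i = 0" for p using fV[of p] that unfolding V0_eq supported_on_def by blast
        then show ?thesis by (simp add: fourier_def)
      qed
      then show ?thesis unfolding V0_eq supported_on_def by blast
    qed
    have cD: "continuous_on UNIV (\<lambda>p. D0 S k f p y)" "vanishes R (\<lambda>p. D0 S k f p y)" for y
      using cont_van_D0[of f R S k y, OF f] by (auto simp: cont_van_def)
    have T: "c1 * ?T \<le> (L2_norm h1 (D0 S k f))\<^sup>2"
      by (rule L2_norm_lower[OF fr1 assms(6) D0_in_V1[OF fV] cD c1(2)])
    have N: "c0 * (\<Sum>x\<in>idx_set k 0. ?N x) \<le> (L2_norm h0 f)\<^sup>2"
      by (rule L2_norm_lower[OF fr0 assms(5) fV c f(2) c0(2)])
    have "(sobolev_norm h0 (1/2) f)\<^sup>2 \<le> C0 * (\<Sum>x\<in>idx_set k 0. Cs * (energy S (\<lambda>p. f p x) + ?N x))"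
      by (rule sobolev_norm_upper[OF fr0 assms(5) fo c C0(2)])
         (use C0(1) Cs f N0 in \<open>auto intro!: mult_nonneg_nonneg add_nonneg_nonneg energy_nonneg\<close>)
    \<comment> \<open>The 2 combines the squared norm already in the subelliptic estimate with the
      one contributed by \<open>E\<close>.\<close>
    also have "\<dots> \<le> C0 * (\<Sum>x\<in>idx_set k 0. Cs * (real CARD('n) * ?T + 2 * ?N x))"
      using C0(1) Cs(1) E by (intro mult_left_mono sum_mono) fastforce+
    also have "\<dots> = C0 * Cs * m * real CARD('n) * ?T + C0 * Cs * 2 * (\<Sum>x\<in>idx_set k 0. ?N x)"
      by (simp add: m_def sum.distrib sum_distrib_left[symmetric] algebra_simps)
    also have "\<dots> = \<alpha> * (c1 * ?T) + \<beta> * (c0 * (\<Sum>x\<in>idx_set k 0. ?N x))"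
      using c1(1) c0(1) by (simp add: \<alpha>_def \<beta>_def)
    also have "\<dots> \<le> \<alpha> * (L2_norm h1 (D0 S k f))\<^sup>2 + \<beta> * (L2_norm h0 f)\<^sup>2"
      using \<alpha> \<beta> T N by (intro add_mono mult_left_mono) auto
    finally show ?thesis .
  qed
  show ?thesis
  proof (intro exI conjI ballI)
    show "1 / \<alpha> > 0" "\<beta> / \<alpha> > 0" using \<alpha> \<beta> by auto
    fix f :: "'n grp \<Rightarrow> 'n val" assume "f \<in> test_functions K (V0 k)"
    from main[OF this] have "1 / \<alpha> * (sobolev_norm h0 (1/2) f)\<^sup>2 \<le> 1 / \<alpha> * (\<alpha> * (L2_norm h1 (D0 S k f))\<^sup>2 + \<beta> * (L2_norm h0 f)\<^sup>2)"
      using \<alpha> by (intro mult_left_mono) auto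
    also have "\<dots> = (L2_norm h1 (D0 S k f))\<^sup>2 + \<beta> / \<alpha> * (L2_norm h0 f)\<^sup>2"
      using \<alpha> by (simp add: field_simps)
    finally show "(L2_norm h1 (D0 S k f))\<^sup>2 \<ge> 1 / \<alpha> * (sobolev_norm h0 (1/2) f)\<^sup>2 - \<beta> / \<alpha> * (L2_norm h0 f)\<^sup>2"
      by simp
  qed
qed

end
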